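(* For every $n\ge1$, the poset $\Pi_{S_n}$ is homotopically Cohen-Macaulay.
   Context: $\Pi_{S_n}$ is the poset on the permutations of $[n]$ together with an adjoined maximum element $\hat1$, in which a permutation $\sigma$ covers a permutation $\tau$ if $\tau$ is obtained from $\sigma$ by splitting one cycle: write the cycle as $(a_1,\dots,a_r)$ with $\sigma(a_i)=a_{i+1}$, choose a nonempty proper subset $S=\{i_1<\dots<i_k\}\subset[r]$ with complement $\{j_1<\dots<j_{r-k}\}$, and replace the cycle by the two cycles $(a_{i_1},\dots,a_{i_k})$ and $(a_{j_1},\dots,a_{j_{r-k}})$; the $n$-cycles are covered by $\hat1$, and the order is the transitive closure of these covering relations (the identity is the minimum). A finite bounded poset is homotopically Cohen-Macaulay if, for each interval, the order complex of the open interval (simplicial complex of its chains) is homotopy equivalent to a wedge of spheres of the top dimension of that complex. *)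

theory Defs
  imports "HOL-Analysis.Analysis" "HOL-Combinatorics.Combinatorics"
begin

section \<open>Simplicial complexes and their geometric realization\<close>

text \<open>A finite abstract simplicial complex is given by its set of simplices, including the empty
  simplex. The complex without vertices is thus \<open>{{}}\<close>; it has dimension \<open>-1\<close> and empty
  realization.\<close>

definition complex_dim :: "'a set set \<Rightarrow> int" where
  "complex_dim K = int (Max (card ` K)) - 1"

text \<open>Points are given by barycentric coordinates, and the empty simplex carries no point. The
  product topology is the usual (coherent) topology of the realization because it is only used for
  complexes with finitely many vertices.\<close>

definition geometric_realization :: "'a set set \<Rightarrow> ('a \<Rightarrow> real) topology" where
  "geometric_realization K = subtopology (powertop_real UNIV)
     {\<alpha>. (\<forall>v. 0 \<le> \<alpha> v) \<and> {v. \<alpha> v \<noteq> 0} \<in> K \<and> (\<Sum>v | \<alpha> v \<noteq> 0. \<alpha> v) = 1}"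

section \<open>Wedges of spheres\<close>

text \<open>The wedge of the pointed spaces \<open>(X i, p i)\<close>, \<open>i \<in> I\<close>, is the quotient of their disjoint union
  that identifies all base points; \<open>None\<close> is the common base point, which is present also for
  \<open>I = {}\<close>.\<close>

definition wedge_map :: "('i \<Rightarrow> 'a) \<Rightarrow> 'i \<times> 'a \<Rightarrow> ('i \<times> 'a) option" where
  "wedge_map p = (\<lambda>(i, x). if x = p i then None else Some (i, x))"

definition wedge :: "('i \<Rightarrow> 'a topology) \<Rightarrow> ('i \<Rightarrow> 'a) \<Rightarrow> 'i set \<Rightarrow> ('i \<times> 'a) option topology" where
  "wedge X p I = topology (\<lambda>U.
     U \<subseteq> insert None (wedge_map p ` topspace (sum_topology X I)) \<and>
     openin (sum_topology X I) {z \<in> topspace (sum_topology X I). wedge_map p z \<in> U})"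

lemma istopology_wedge:
  "istopology (\<lambda>U. U \<subseteq> insert None (f ` topspace Y) \<and> openin Y {z \<in> topspace Y. f z \<in> U})"
proof -
  have 1: "{z \<in> topspace Y. f z \<in> S \<inter> T} =
      {z \<in> topspace Y. f z \<in> S} \<inter> {z \<in> topspace Y. f z \<in> T}" for S T
    by auto
  have 2: "{z \<in> topspace Y. f z \<in> \<Union>\<K>} = (\<Union>S\<in>\<K>. {z \<in> topspace Y. f z \<in> S})" for \<K>
    by auto
  show ?thesis
    unfolding istopology_def 1 2 by blast
qed

lemma openin_wedge:
  "openin (wedge X p I) U \<longleftrightarrow>
     U \<subseteq> insert None (wedge_map p ` topspace (sum_topology X I)) \<and>
     openin (sum_topology X I) {z \<in> topspace (sum_topology X I). wedge_map p z \<in> U}"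
  unfolding wedge_def topology_inverse'[OF istopology_wedge] ..

lemma topspace_wedge:
  "topspace (wedge X p I) = insert None (wedge_map p ` topspace (sum_topology X I))"
proof
  show "topspace (wedge X p I) \<subseteq> insert None (wedge_map p ` topspace (sum_topology X I))"
    using openin_topspace openin_wedge by blast
  have "{z \<in> topspace (sum_topology X I).
      wedge_map p z \<in> insert None (wedge_map p ` topspace (sum_topology X I))}
      = topspace (sum_topology X I)"
    by auto
  then have "openin (wedge X p I) (insert None (wedge_map p ` topspace (sum_topology X I)))"
    unfolding openin_wedge by (metis openin_topspace subset_refl)
  then show "insert None (wedge_map p ` topspace (sum_topology X I)) \<subseteq> topspace (wedge X p I)"
    by (rule openin_subset)
qed

lemma quotient_map_wedge:
  assumes "i \<in> I" "p i \<in> topspace (X i)"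
  shows "quotient_map (sum_topology X I) (wedge X p I) (wedge_map p)"
proof -
  have "(i, p i) \<in> topspace (sum_topology X I)" "wedge_map p (i, p i) = None"
    using assms by (auto simp: wedge_map_def)
  then have "None \<in> wedge_map p ` topspace (sum_topology X I)"
    by (metis image_eqI)
  then have "insert None (wedge_map p ` topspace (sum_topology X I))
      = wedge_map p ` topspace (sum_topology X I)"
    by (rule insert_absorb)
  then show ?thesis
    unfolding quotient_map_def topspace_wedge openin_wedge by auto
qed

text \<open>The wedge of \<open>k\<close> spheres of dimension \<open>d \<ge> -1\<close>, where the \<open>(-1)\<close>-sphere is the empty space.
  For \<open>d \<ge> 0\<close> and \<open>k = 0\<close> it is a point.\<close>

definition sphere_wedge :: "int \<Rightarrow> nat \<Rightarrow> (nat \<times> (nat \<Rightarrow> real)) option topology" where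
  "sphere_wedge d k =
     (if d < 0 then trivial_topology
      else wedge (\<lambda>_. nsphere (nat d)) (\<lambda>_ n. if n = 0 then 1 else 0) {..<k})"

section \<open>Homotopically Cohen--Macaulay posets\<close>

text \<open>A poset is a carrier set together with its reflexive order relation; \<open>(x, y) \<in> r\<close> means
  \<open>x \<le> y\<close>.\<close>

definition open_interval :: "'a rel \<Rightarrow> 'a \<Rightarrow> 'a \<Rightarrow> 'a set" where
  "open_interval r x y = {z. (x, z) \<in> r \<and> z \<noteq> x \<and> (z, y) \<in> r \<and> z \<noteq> y}"

definition order_complex :: "'a rel \<Rightarrow> 'a set \<Rightarrow> 'a set set" where
  "order_complex r Q = {C. finite C \<and> C \<subseteq> Q \<and> C \<in> Chains r}"

definition finite_bounded_poset :: "'a set \<Rightarrow> 'a rel \<Rightarrow> bool" where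
  "finite_bounded_poset P r \<longleftrightarrow> finite P \<and> partial_order_on P r \<and>
     (\<exists>b\<in>P. \<forall>x\<in>P. (b, x) \<in> r) \<and> (\<exists>t\<in>P. \<forall>x\<in>P. (x, t) \<in> r)"

definition homotopically_Cohen_Macaulay :: "'a set \<Rightarrow> 'a rel \<Rightarrow> bool" where
  "homotopically_Cohen_Macaulay P r \<longleftrightarrow> finite_bounded_poset P r \<and>
     (\<forall>(x, y) \<in> r. let K = order_complex r (open_interval r x y)
        in \<exists>k. geometric_realization K homotopy_equivalent_space sphere_wedge (complex_dim K) k)"

section \<open>The poset of permutations under splitting of cycles\<close>

text \<open>The cycle \<open>(a\<^sub>1, \<dots>, a\<^sub>r)\<close> of \<open>\<sigma>\<close> is the list \<open>as\<close>; its positions are numbered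
  from \<open>0\<close>, so that \<open>S\<close> is a subset of \<open>{..<r}\<close>.\<close>

definition splits_to :: "(nat \<Rightarrow> nat) \<Rightarrow> (nat \<Rightarrow> nat) \<Rightarrow> bool" where
  "splits_to \<sigma> \<tau> \<longleftrightarrow> (\<exists>as S. distinct as \<and> map \<sigma> as = rotate1 as \<and>
     S \<noteq> {} \<and> S \<subset> {..<length as} \<and>
     (\<forall>x. \<tau> x =
        (if x \<in> set (nths as S) then cycle_of_list (nths as S) x
         else if x \<in> set (nths as ({..<length as} - S))
              then cycle_of_list (nths as ({..<length as} - S)) x
         else \<sigma> x)))"

text \<open>\<open>None\<close> is the adjoined maximum.\<close>

definition Pi_carrier :: "nat \<Rightarrow> (nat \<Rightarrow> nat) option set" where
  "Pi_carrier n = insert None (Some ` {\<sigma>. \<sigma> permutes {1..n}})"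

text \<open>Pairs are of the form (covered element, covering element).\<close>

inductive_set Pi_covers :: "nat \<Rightarrow> (nat \<Rightarrow> nat) option rel" for n :: nat where
  split: "\<lbrakk>\<sigma> permutes {1..n}; \<tau> permutes {1..n}; splits_to \<sigma> \<tau>\<rbrakk>
          \<Longrightarrow> (Some \<tau>, Some \<sigma>) \<in> Pi_covers n"
| top: "\<lbrakk>distinct as; set as = {1..n}\<rbrakk> \<Longrightarrow> (Some (cycle_of_list as), None) \<in> Pi_covers n"

definition Pi_order :: "nat \<Rightarrow> (nat \<Rightarrow> nat) option rel" where
  "Pi_order n = Restr ((Pi_covers n)\<^sup>*) (Pi_carrier n)"

end

(*
An open interval is shown to have a spherical order complex: a collapsible complex together with
simplices of one fixed dimension. Contracting the collapsible part does not change the homotopy type,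
and it turns each remaining simplex into a sphere.

For permutations, p <= q holds iff the cycle of p through any x is a sublist of the cycle of q through
x. In an interval from t to y fix a point x0 whose cycle grows between t and y. The elements in which
this cycle is not yet merged form a down-set; they are added to the other elements from bottom to top,
and the link of such an element b is the join of the interval from t to b with the elements above b
that merge the cycle of x0, so that induction on the rank applies.

The elements in which the cycle of x0 is merged retract onto those that agree with t elsewhere. If y is
a permutation, these form a Boolean lattice without its minimum, and without its maximum if that is y.
If y is the maximum, take x0 = 1; they are then the shuffles of cycles of t into the cycle of 1,
ordered by restriction, and the lexicographic order of the full shuffles, in which letters are
compared first by the minimum of their cycle under t, is a shelling.
*)
theory Submission
  imports Defs
begin


section \<open>Complexes that are contractible up to top-dimensional simplices\<close>

text \<open>Gluing homotopy equivalences is laborious, so topology enters only once, for complexes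
  already known to be \<open>spherical\<close>. That property is purely combinatorial and survives
  joins and the addition of a vertex whose link is spherical in one dimension less. For a
  contractible complex its parameter is merely a bound on the size of simplices, so a link that is a
  cone fits into every induction.

  The obstacle in the poset is that links need not be intervals: above an element \<open>b\<close>
  of the down-set one meets only those elements that merge the cycle of x0. As \<open>b\<close> and
  \<open>t\<close> have the same cycle through x0, this set has the same form with \<open>b\<close>
  in place of \<open>t\<close>. It is therefore treated for arbitrary base permutations before the
  induction over intervals starts.

  Below the maximum, the flat elements are not restrictions of one common cycle. Cutting the full
  cycles at 1 turns them into words; since 1 is the least label, it stays in front whenever a block
  of larger label is moved. Comparing labels first gives every block a canonical place, before the
  first larger label, and moving a block there is the exchange that a shelling requires.\<close>

definition simplicial_complex :: "'a set set \<Rightarrow> bool" where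
  "simplicial_complex K \<longleftrightarrow> finite K \<and> (\<forall>s\<in>K. finite s \<and> (\<forall>t. t \<subseteq> s \<longrightarrow> t \<in> K))"

text \<open>The sequences of elementary expansions start at the void complex, whose first expansion is
  the complex of a point with its empty simplex.\<close>

inductive collapsible :: "'a set set \<Rightarrow> bool" where
  void: "collapsible {}"
| expand: "\<lbrakk>collapsible K; finite s; w \<notin> s; s \<notin> K; \<forall>x\<in>s. insert w (s - {x}) \<in> K\<rbrakk>
    \<Longrightarrow> collapsible (insert s (insert (insert w s) K))"

text \<open>This is why an expansion adds exactly two simplices: apart from the free face
  \<open>s\<close>, every proper face of \<open>insert w s\<close> lies in a facet through
  \<open>w\<close>.\<close>

lemma subset_insert_facet:
  assumes "t \<subseteq> insert w s" "t \<noteq> s" "t \<noteq> insert w s"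
  shows "\<exists>x\<in>s. t \<subseteq> insert w (s - {x})"
  using assms by blast

lemma collapsible_closed:
  assumes "collapsible K"
  shows "simplicial_complex K"
  using assms
proof induction
  case void
  then show ?case by (simp add: simplicial_complex_def)
next
  case (expand K s w)
  have "t \<in> insert s (insert (insert w s) K)" if sub: "t \<subseteq> insert w s" for t
  proof (cases "t = s \<or> t = insert w s")
    case False
    then obtain x where "x \<in> s" "t \<subseteq> insert w (s - {x})"
      using subset_insert_facet[OF sub] by blast
    then show ?thesis
      using expand unfolding simplicial_complex_def by blast
  qed auto
  moreover have "t \<in> insert s (insert (insert w s) K)" if "t \<subseteq> s" for t
    using calculation that by blast
  ultimately show ?case
    using expand unfolding simplicial_complex_def by blast
qed

text \<open>The number \<open>m\<close> counts vertices, so the spheres that arise have dimension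
  \<open>m - 1\<close>. With the void complex as collapsible part, \<open>{{}}\<close> is included
  for \<open>m = 0\<close> as the (-1)-sphere.\<close>

definition spherical :: "nat \<Rightarrow> 'a set set \<Rightarrow> bool" where
  "spherical m K \<longleftrightarrow> simplicial_complex K \<and> (\<forall>s\<in>K. card s \<le> m) \<and>
     (\<exists>K'\<subseteq>K. collapsible K' \<and> (\<forall>s\<in>K - K'. card s = m))"

lemma spherical_complex: "spherical m K \<Longrightarrow> simplicial_complex K"
  by (simp add: spherical_def)

lemma spherical_card_le: "spherical m K \<Longrightarrow> s \<in> K \<Longrightarrow> card s \<le> m"
  by (simp add: spherical_def)

lemma spherical_collapsible:
  "collapsible K \<Longrightarrow> (\<And>s. s \<in> K \<Longrightarrow> card s \<le> m) \<Longrightarrow> spherical m K"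
  using collapsible_closed unfolding spherical_def by blast

lemma spherical_singleton_empty: "spherical 0 {{}}"
  unfolding spherical_def simplicial_complex_def using void by auto

lemma simplicial_complexD:
  assumes "simplicial_complex K" "s \<in> K"
  shows "finite s" "t \<subseteq> s \<Longrightarrow> t \<in> K"
  using assms unfolding simplicial_complex_def by auto

text \<open>An expansion of \<open>L\<close> by \<open>s\<close> and \<open>w\<close> becomes one by
  \<open>s \<union> t\<close> and \<open>w\<close>: a facet that drops a vertex of \<open>s\<close>
  comes from an earlier simplex of \<open>L\<close>, and one that drops a vertex of \<open>t\<close>
  lies in \<open>X\<close>.\<close>

lemma collapsible_add_join_simplex:
  assumes "collapsible L" "collapsible X" "finite t"
    and "\<And>s. s \<in> L \<Longrightarrow> s \<inter> t = {}"
    and "\<And>s. s \<in> L \<Longrightarrow> s \<union> t \<notin> X"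
    and "\<And>s u. s \<in> L \<Longrightarrow> u \<subset> t \<Longrightarrow> s \<union> u \<in> X"
  shows "collapsible (X \<union> (\<lambda>s. s \<union> t) ` L)"
  using assms(1,4-6)
proof induction
  case void
  then show ?case using assms(2) by simp
next
  case (expand L s w)
  let ?M = "X \<union> (\<lambda>s. s \<union> t) ` L"
  have M: "collapsible ?M"
    using expand.prems by (intro expand.IH) auto
  have dis: "s \<inter> t = {}" "w \<notin> t"
    using expand.prems(1) by blast+
  have "s \<union> t \<notin> ?M"
  proof
    assume "s \<union> t \<in> ?M"
    moreover have "s \<union> t \<notin> X"
      by (rule expand.prems(2)) simp
    ultimately obtain s' where "s' \<in> L" "s \<union> t = s' \<union> t"
      by blast
    moreover from this have "s' \<inter> t = {}"
      using expand.prems(1) by simp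
    ultimately have "s = s'"
      using dis by blast
    then show False
      using \<open>s \<notin> L\<close> \<open>s' \<in> L\<close> by simp
  qed
  moreover have "insert w (s \<union> t - {x}) \<in> ?M" if "x \<in> s \<union> t" for x
  proof (cases "x \<in> s")
    case True
    then have "insert w (s \<union> t - {x}) = insert w (s - {x}) \<union> t"
      using dis by blast
    then show ?thesis
      using expand.hyps True by blast
  next
    case False
    then have "insert w (s \<union> t - {x}) = insert w s \<union> (t - {x})" "t - {x} \<subset> t"
      using that by blast+
    then show ?thesis
      using expand.prems(3)[of "insert w s" "t - {x}"] by simp
  qed
  ultimately have "collapsible (insert (s \<union> t) (insert (insert w (s \<union> t)) ?M))"
    using M dis expand.hyps \<open>finite t\<close> by (intro collapsible.expand) auto
  also have "insert (s \<union> t) (insert (insert w (s \<union> t)) ?M)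
      = X \<union> (\<lambda>s. s \<union> t) ` insert s (insert (insert w s) L)"
    by auto
  finally show ?case .
qed

section \<open>Joins and cones\<close>

definition join :: "'a set set \<Rightarrow> 'a set set \<Rightarrow> 'a set set" where
  "join K L = {s \<union> t | s t. s \<in> K \<and> t \<in> L}"

lemma joinI: "s \<in> K \<Longrightarrow> t \<in> L \<Longrightarrow> s \<union> t \<in> join K L"
  unfolding join_def by blast

lemma joinE:
  assumes "u \<in> join K L"
  obtains s t where "u = s \<union> t" "s \<in> K" "t \<in> L"
  using assms unfolding join_def by blast

text \<open>\<open>K0\<close> is the part of \<open>K\<close> whose join with \<open>L\<close> is
  present from the start. The other simplices of \<open>K\<close> follow one at a time, faces first,
  so that removing a maximal one leaves a complex to which the induction applies.\<close>

lemma collapsible_add_join: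
  assumes "simplicial_complex K" "collapsible L" "collapsible X"
    and "\<And>s t. s \<in> L \<Longrightarrow> t \<in> K \<Longrightarrow> s \<inter> t = {}"
    and "\<And>s t. s \<in> L \<Longrightarrow> t \<in> K - K0 \<Longrightarrow> s \<union> t \<notin> X"
    and "\<And>s t. s \<in> L \<Longrightarrow> t \<in> K0 \<Longrightarrow> s \<union> t \<in> X"
    and "K0 \<subseteq> K" "simplicial_complex K0"
  shows "collapsible (X \<union> join L K)"
proof -
  have "finite K"
    using assms(1) by (simp add: simplicial_complex_def)
  then show ?thesis
    using assms unfolding join_def
  proof (induction "card (K - K0)" arbitrary: K)
    case 0
    then have "K = K0" by auto
    then have "X \<union> {s \<union> t | s t. s \<in> L \<and> t \<in> K} = X"
      using "0.prems"(7) by auto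
    then show ?case using 0 by simp
  next
    case (Suc k)
    obtain t where t: "t \<in> K - K0" "\<And>s. s \<in> K - K0 \<Longrightarrow> t \<subseteq> s \<Longrightarrow> t = s"
      using finite_has_maximal[of "K - K0"] Suc.hyps(2) Suc.prems(1)
      by (metis card.empty finite_Diff nat.distinct(1))
    let ?X = "X \<union> {s \<union> u | s u. s \<in> L \<and> u \<in> K - {t}}"
    have cK: "simplicial_complex (K - {t})"
      using Suc.prems(2,9) t unfolding simplicial_complex_def
      by (metis (no_types, lifting) Diff_iff finite_Diff insert_iff insertI1 empty_iff)
    have "card (K - {t} - K0) = k"
      using Suc.hyps(2) t Suc.prems(1) by (metis Diff_insert Diff_insert2 card_Diff_singleton diff_Suc_1)
    then have X: "collapsible ?X"
      using Suc.prems t cK by (intro Suc.hyps(1)) auto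
    have "collapsible (?X \<union> (\<lambda>s. s \<union> t) ` L)"
    proof (rule collapsible_add_join_simplex[OF Suc.prems(3) X])
      show "finite t"
        using Suc.prems(2) t unfolding simplicial_complex_def by blast
      show "s \<inter> t = {}" if "s \<in> L" for s
        using Suc.prems(5) t that by blast
      show "s \<union> u \<in> ?X" if "s \<in> L" "u \<subset> t" for s u
      proof -
        have "u \<in> K - {t}"
          using that t Suc.prems(2) unfolding simplicial_complex_def by blast
        then show ?thesis using that by blast
      qed
      show "s \<union> t \<notin> ?X" if "s \<in> L" for s
      proof
        assume "s \<union> t \<in> ?X"
        then obtain s' u where u: "s' \<in> L" "u \<in> K - {t}" "s \<union> t = s' \<union> u"
          using Suc.prems(6) t \<open>s \<in> L\<close> by blast
        have "s' \<inter> t = {}" "s \<inter> u = {}"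
          using Suc.prems(5) t(1) u(1,2) \<open>s \<in> L\<close> by auto
        then have "t = u"
          using u(3) by blast
        then show False
          using u by blast
      qed
    qed
    moreover have "?X \<union> (\<lambda>s. s \<union> t) ` L = X \<union> {s \<union> t | s t. s \<in> L \<and> t \<in> K}"
      using t by blast
    ultimately show ?case by simp
  qed
qed

lemma simplicial_complex_join:
  assumes "simplicial_complex K" "simplicial_complex L"
  shows "simplicial_complex (join K L)"
proof -
  have "join K L = (\<lambda>(s, t). s \<union> t) ` (K \<times> L)"
    by (auto simp: join_def)
  then have "finite (join K L)"
    using assms by (simp add: simplicial_complex_def)
  moreover have "u \<in> join K L" if "u \<subseteq> s \<union> t" "s \<in> K" "t \<in> L" for u s t
  proof -
    have "u = (u \<inter> s) \<union> (u \<inter> t)" "u \<inter> s \<in> K" "u \<inter> t \<in> L"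
      using that assms simplicial_complexD(2)[of _ _ "u \<inter> _"] by auto
    then show ?thesis
      unfolding join_def by blast
  qed
  ultimately show ?thesis
    using assms unfolding simplicial_complex_def by (auto simp: join_def)
qed

lemma collapsible_join:
  assumes "collapsible L" "simplicial_complex K" "\<And>s t. s \<in> L \<Longrightarrow> t \<in> K \<Longrightarrow> s \<inter> t = {}"
  shows "collapsible (join L K)"
  using collapsible_add_join[OF assms(2,1) void, of "{}"] assms(3)
  by (simp add: join_def simplicial_complex_def)

text \<open>The collapsible part is the union of the joins of \<open>K'\<close> with
  \<open>L\<close> and of \<open>L'\<close> with \<open>K\<close>; the second is glued to the first
  along the join of \<open>L'\<close> with \<open>K'\<close>. A simplex outside both is a union of
  two top simplices, so the sizes add up.\<close>

lemma spherical_join: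
  assumes "spherical a K" "spherical b L"
    and dis: "\<And>s t. s \<in> K \<Longrightarrow> t \<in> L \<Longrightarrow> s \<inter> t = {}"
  shows "spherical (a + b) (join K L)"
proof -
  obtain K' where K': "K' \<subseteq> K" "collapsible K'" "\<And>s. s \<in> K - K' \<Longrightarrow> card s = a"
    using assms(1) unfolding spherical_def by blast
  obtain L' where L': "L' \<subseteq> L" "collapsible L'" "\<And>s. s \<in> L - L' \<Longrightarrow> card s = b"
    using assms(2) unfolding spherical_def by blast
  note cx = spherical_complex[OF assms(1)] spherical_complex[OF assms(2)]
  have 1: "collapsible (join K' L)"
    by (rule collapsible_join[OF K'(2) cx(2)]) (use dis K'(1) in blast)
  have "collapsible (join K' L \<union> join L' K)"
  proof (rule collapsible_add_join[OF cx(1) L'(2) 1, where ?K0.0 = K'])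
    show "s \<union> t \<notin> join K' L" if "s \<in> L'" "t \<in> K - K'" for s t
    proof
      assume "s \<union> t \<in> join K' L"
      then obtain s' t' where *: "s \<union> t = s' \<union> t'" "s' \<in> K'" "t' \<in> L"
        unfolding join_def by blast
      then have m: "s' \<in> K" "s \<in> L" "t \<in> K"
        using that K'(1) L'(1) by auto
      have "t = s'"
        using *(1) dis[OF m(1,2)] dis[OF m(3,2)] dis[OF m(1) *(3)] dis[OF m(3) *(3)] by blast
      then show False using * that by blast
    qed
    show "s \<inter> t = {}" if "s \<in> L'" "t \<in> K" for s t
      using dis[OF that(2), of s] that L'(1) by blast
    show "s \<union> t \<in> join K' L" if "s \<in> L'" "t \<in> K'" for s t
      using that L'(1) unfolding join_def by blast
  qed (use K' collapsible_closed in auto)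
  moreover have "card u = a + b"
    if J: "u \<in> join K L - (join K' L \<union> join L' K)" for u
  proof -
    obtain s t where u: "u = s \<union> t" "s \<in> K" "t \<in> L"
      using J by (auto elim: joinE)
    then have "s \<in> K - K'" "t \<in> L - L'"
      using J joinI[of s K' t L] joinI[of t L' s K] by (auto simp: Un_commute)
    then have "card s = a" "card t = b"
      using K'(3) L'(3) by auto
    then show ?thesis
      using card_Un_disjoint[of s t] simplicial_complexD(1)[OF cx(1) u(2)]
        simplicial_complexD(1)[OF cx(2) u(3)] dis[OF u(2,3)] u(1) by simp
  qed
  moreover have "join K' L \<union> join L' K \<subseteq> join K L"
    using K'(1) L'(1) by (auto simp: join_def)
  moreover have "card u \<le> a + b" if u: "u \<in> join K L" for u
  proof -
    obtain s t where "u = s \<union> t" "s \<in> K" "t \<in> L"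
      using u unfolding join_def by blast
    then show ?thesis
      using card_Un_le[of s t] spherical_card_le[OF assms(1)] spherical_card_le[OF assms(2)]
      by (meson add_mono le_trans)
  qed
  ultimately show ?thesis
    using simplicial_complex_join[OF cx] unfolding spherical_def by (meson Diff_iff)
qed

lemma collapsible_cone:
  assumes "simplicial_complex K" "\<And>s. s \<in> K \<Longrightarrow> z \<notin> s"
  shows "collapsible (K \<union> insert z ` K)"
proof -
  have "collapsible (insert {} (insert (insert z {}) {}))"
    by (rule expand[OF void]) auto
  then have "collapsible (join {{}, {z}} K)"
    using assms by (intro collapsible_join) auto
  moreover have "join {{}, {z}} K = K \<union> insert z ` K"
    unfolding join_def by auto
  ultimately show ?thesis by simp
qed

text \<open>Simplices of \<open>L\<close> have at most \<open>m\<close> vertices and thus avoid the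
  top simplices of \<open>K\<close>, so \<open>L\<close> lies in the collapsible part. Coning off
  the collapsible part of \<open>L\<close> is then a sequence of expansions, and the cones over the
  rest of \<open>L\<close> are new top simplices.\<close>

lemma spherical_extend:
  assumes K: "spherical (Suc m) K" and L: "spherical m L" "L \<subseteq> K" and v: "\<And>s. s \<in> K \<Longrightarrow> v \<notin> s"
  shows "spherical (Suc m) (K \<union> insert v ` L)"
proof -
  obtain K' where K': "K' \<subseteq> K" "collapsible K'" "\<And>s. s \<in> K - K' \<Longrightarrow> card s = Suc m"
    using K unfolding spherical_def by blast
  obtain L' where L': "L' \<subseteq> L" "collapsible L'" "\<And>s. s \<in> L - L' \<Longrightarrow> card s = m"
    using L(1) unfolding spherical_def by blast
  note cx = spherical_complex[OF K] spherical_complex[OF L(1)]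
  have LK: "L \<subseteq> K'"
  proof
    fix s
    assume "s \<in> L"
    then show "s \<in> K'"
      using K'(3)[of s] spherical_card_le[OF L(1)] L(2) by force
  qed
  have "collapsible (K' \<union> (\<lambda>s. s \<union> {v}) ` L')"
  proof (rule collapsible_add_join_simplex[OF L'(2) K'(2)])
    show "s \<inter> {v} = {}" if "s \<in> L'" for s
      using v that L' L(2) by auto
    show "s \<union> {v} \<notin> K'" for s
      using v K'(1) by auto
    show "s \<union> u \<in> K'" if "s \<in> L'" "u \<subset> {v}" for s u
    proof -
      have "u = {}" using that(2) by blast
      then show ?thesis using that LK L'(1) by auto
    qed
  qed simp
  then have "collapsible (K' \<union> insert v ` L')"
    by simp
  moreover have "card u = Suc m" if u: "u \<in> K \<union> insert v ` L - (K' \<union> insert v ` L')" for u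
  proof (cases "u \<in> K")
    case True
    then show ?thesis using K'(3) u by blast
  next
    case False
    then obtain s where "u = insert v s" "s \<in> L - L'"
      using u by blast
    then show ?thesis
      using L'(3) v L(2) simplicial_complexD(1)[OF cx(2)] by (auto simp: subset_iff)
  qed
  moreover have "card u \<le> Suc m" if u: "u \<in> K \<union> insert v ` L" for u
  proof (cases "u \<in> K")
    case True
    then show ?thesis using spherical_card_le[OF K] by blast
  next
    case False
    then obtain s where "u = insert v s" "s \<in> L"
      using u by blast
    then show ?thesis
      using spherical_card_le[OF L(1)] card_insert_le_m1[of "Suc m" s v] by auto
  qed
  moreover have "simplicial_complex (K \<union> insert v ` L)"
  proof -
    have "t \<in> K \<union> insert v ` L" if "t \<subseteq> insert v s" "s \<in> L" for t s
    proof (cases "v \<in> t")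
      case True
      have "t - {v} \<in> L"
        using that simplicial_complexD(2)[OF cx(2) that(2)] by blast
      then show ?thesis
        using True by (metis UnI2 image_eqI insert_Diff)
    next
      case False
      then have "t \<in> L"
        using that simplicial_complexD(2)[OF cx(2) that(2)] by blast
      then show ?thesis using L(2) by blast
    qed
    then show ?thesis
      using cx unfolding simplicial_complex_def by auto
  qed
  moreover have "K' \<union> insert v ` L' \<subseteq> K \<union> insert v ` L"
    using K' L' by blast
  ultimately show ?thesis
    unfolding spherical_def by (meson Diff_iff)
qed

lemma collapsible_image:
  assumes "inj f" "collapsible K"
  shows "collapsible ((`) f ` K)"
  using assms(2)
proof induction
  case void
  then show ?case using collapsible.void by simp
next
  case (expand K s w)
  have "collapsible (insert (f ` s) (insert (insert (f w) (f ` s)) ((`) f ` K)))"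
  proof (rule collapsible.expand)
    show "f ` s \<notin> (`) f ` K"
      using expand.hyps(4) inj_image_eq_iff[OF assms(1)] by auto
    show "\<forall>x\<in>f ` s. insert (f w) (f ` s - {x}) \<in> (`) f ` K"
    proof
      fix y
      assume "y \<in> f ` s"
      then obtain x where x: "x \<in> s" "y = f x" by blast
      then have "insert (f w) (f ` s - {y}) = f ` insert w (s - {x})"
        using assms(1) by (auto simp: inj_eq)
      then show "insert (f w) (f ` s - {y}) \<in> (`) f ` K"
        using expand.hyps(5) x(1) by (metis image_eqI)
    qed
  qed (use expand assms(1) in \<open>auto simp: inj_eq\<close>)
  then show ?case by simp
qed

lemma spherical_image:
  assumes "inj f" "spherical m K"
  shows "spherical m ((`) f ` K)"
proof -
  obtain K' where K': "K' \<subseteq> K" "collapsible K'" "\<And>s. s \<in> K - K' \<Longrightarrow> card s = m"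
    using assms(2) unfolding spherical_def by blast
  have card: "card (f ` s) = card s" for s
    by (meson assms(1) card_image inj_on_subset subset_UNIV)
  have "(`) f ` K' \<subseteq> (`) f ` K"
    using K' by blast
  moreover have "card s = m" if "s \<in> (`) f ` K - (`) f ` K'" for s
    using that K'(3) card by blast
  moreover have "card s \<le> m" if "s \<in> (`) f ` K" for s
    using that spherical_card_le[OF assms(2)] card by auto
  moreover have "simplicial_complex ((`) f ` K)"
    using spherical_complex[OF assms(2)] unfolding simplicial_complex_def
    by (auto simp: subset_image_iff)
  ultimately show ?thesis
    using collapsible_image[OF assms(1) K'(2)] unfolding spherical_def
    by (intro conjI exI[of _ "(`) f ` K'"]) auto
qed


section \<open>Geometric realizations\<close>

definition realization_points :: "'a set set \<Rightarrow> ('a \<Rightarrow> real) set" where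
  "realization_points K = {\<alpha>. (\<forall>v. 0 \<le> \<alpha> v) \<and> {v. \<alpha> v \<noteq> 0} \<in> K \<and> (\<Sum>v | \<alpha> v \<noteq> 0. \<alpha> v) = 1}"

lemma geometric_realization_eq:
  "geometric_realization K = subtopology (powertop_real UNIV) (realization_points K)"
  by (simp add: geometric_realization_def realization_points_def)

lemma topspace_geometric_realization [simp]:
  "topspace (geometric_realization K) = realization_points K"
  by (simp add: geometric_realization_eq)

lemma realization_points_mono: "K \<subseteq> L \<Longrightarrow> realization_points K \<subseteq> realization_points L"
  by (auto simp: realization_points_def)

lemma realization_pointsI:
  assumes "\<And>v. 0 \<le> \<alpha> v" "{v. \<alpha> v \<noteq> 0} \<in> K" "finite S" "\<And>v. v \<notin> S \<Longrightarrow> \<alpha> v = 0" "sum \<alpha> S = 1"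
  shows "\<alpha> \<in> realization_points K"
proof -
  have "(\<Sum>v | \<alpha> v \<noteq> 0. \<alpha> v) = sum \<alpha> S"
    using assms by (intro sum.mono_neutral_left) auto
  then show ?thesis
    using assms by (simp add: realization_points_def)
qed

lemma realization_points_sum:
  assumes "\<alpha> \<in> realization_points K" "finite S" "\<And>v. v \<notin> S \<Longrightarrow> \<alpha> v = 0"
  shows "sum \<alpha> S = 1"
proof -
  have "(\<Sum>v | \<alpha> v \<noteq> 0. \<alpha> v) = sum \<alpha> S"
    using assms(2,3) by (intro sum.mono_neutral_left) auto
  then show ?thesis
    using assms(1) by (simp add: realization_points_def)
qed

lemma realization_points_nonneg: "\<alpha> \<in> realization_points K \<Longrightarrow> 0 \<le> \<alpha> v"
  by (simp add: realization_points_def)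

lemma realization_points_supp: "\<alpha> \<in> realization_points K \<Longrightarrow> {v. \<alpha> v \<noteq> 0} \<in> K"
  by (simp add: realization_points_def)

lemma realization_points_Pow:
  assumes "finite s"
  shows "realization_points (Pow s) =
    {\<alpha>. (\<forall>v. 0 \<le> \<alpha> v) \<and> (\<forall>v. v \<notin> s \<longrightarrow> \<alpha> v = 0) \<and> sum \<alpha> s = 1}"
proof (intro set_eqI iffI)
  fix \<alpha> :: "'a \<Rightarrow> real"
  assume *: "\<alpha> \<in> realization_points (Pow s)"
  then have "\<forall>v. v \<notin> s \<longrightarrow> \<alpha> v = 0"
    using realization_points_supp[OF *] by auto
  then show "\<alpha> \<in> {\<alpha>. (\<forall>v. 0 \<le> \<alpha> v) \<and> (\<forall>v. v \<notin> s \<longrightarrow> \<alpha> v = 0) \<and> sum \<alpha> s = 1}"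
    using realization_points_sum[OF * assms] realization_points_nonneg[OF *] by blast
next
  fix \<alpha> :: "'a \<Rightarrow> real"
  assume *: "\<alpha> \<in> {\<alpha>. (\<forall>v. 0 \<le> \<alpha> v) \<and> (\<forall>v. v \<notin> s \<longrightarrow> \<alpha> v = 0) \<and> sum \<alpha> s = 1}"
  show "\<alpha> \<in> realization_points (Pow s)"
    by (rule realization_pointsI[OF _ _ assms]) (use * in auto)
qed

lemma realization_points_eq_UN:
  assumes "simplicial_complex K"
  shows "realization_points K = (\<Union>s\<in>K. realization_points (Pow s))"
  using assms by (auto simp: realization_points_def simplicial_complex_def)

lemma continuous_map_geometric_realization_iff:
  "continuous_map X (geometric_realization K) f \<longleftrightarrow>
     (\<forall>v. continuous_map X euclideanreal (\<lambda>x. f x v)) \<and> f \<in> topspace X \<rightarrow> realization_points K"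
  by (simp add: geometric_realization_eq continuous_map_in_subtopology
      continuous_map_componentwise_UNIV)

lemma continuous_map_barycentric [continuous_intros]:
  "continuous_map (geometric_realization K) euclideanreal (\<lambda>\<alpha>. \<alpha> v)"
  using continuous_map_geometric_realization_iff[of "geometric_realization K" K id]
  by (simp add: continuous_map_from_subtopology)

text \<open>Each closed simplex is a closed subset of the cube of all functions into the unit
  interval, which is compact by Tychonoff; the realization is a finite union of such sets.\<close>

lemma compactin_realization_points:
  assumes "simplicial_complex K"
  shows "compactin (powertop_real UNIV) (realization_points K)"
proof -
  have proj: "continuous_map (powertop_real UNIV) euclideanreal (\<lambda>\<alpha>. \<alpha> v)" for v :: 'a
    using continuous_map_product_projection[of v UNIV "\<lambda>_. euclideanreal"] by simp
  have "compactin (powertop_real UNIV) (realization_points (Pow s))" if s: "finite s" for s :: "'a set"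
  proof (rule closed_compactin)
    show "compactin (powertop_real UNIV) (\<Pi>\<^sub>E v\<in>UNIV. {0..1::real})"
      unfolding compactin_PiE by simp
    show "realization_points (Pow s) \<subseteq> (\<Pi>\<^sub>E v\<in>UNIV. {0..1})"
    proof
      fix \<alpha> :: "'a \<Rightarrow> real"
      assume "\<alpha> \<in> realization_points (Pow s)"
      then have *: "\<forall>v. 0 \<le> \<alpha> v" "\<forall>v. v \<notin> s \<longrightarrow> \<alpha> v = 0" "sum \<alpha> s = 1"
        by (auto simp: realization_points_Pow[OF s])
      have "\<alpha> v \<le> 1" for v
      proof (cases "v \<in> s")
        case True
        then show ?thesis
          using member_le_sum[of v s \<alpha>] * s by auto
      qed (use * in auto)
      then show "\<alpha> \<in> (\<Pi>\<^sub>E v\<in>UNIV. {0..1})"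
        using * by auto
    qed
    have "realization_points (Pow s) =
        (\<Inter>v. {\<alpha> \<in> topspace (powertop_real UNIV). \<alpha> v \<in> {0..}}) \<inter>
        (\<Inter>v. {\<alpha> \<in> topspace (powertop_real UNIV). \<alpha> v \<in> (if v \<in> s then UNIV else {0})}) \<inter>
        {\<alpha> \<in> topspace (powertop_real UNIV). sum \<alpha> s \<in> {1}}"
      by (auto simp: realization_points_Pow[OF s] split: if_splits)
    also have "closedin (powertop_real UNIV) \<dots>"
      using s proj
      by (intro closedin_Int closedin_INT closedin_continuous_map_preimage[where Y = euclideanreal]
          continuous_map_sum) auto
    finally show "closedin (powertop_real UNIV) (realization_points (Pow s))" .
  qed
  then show ?thesis
    unfolding realization_points_eq_UN[OF assms]
    using assms by (intro compactin_Union) (auto simp: simplicial_complex_def)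
qed

lemma Hausdorff_space_powertop_real: "Hausdorff_space (powertop_real I)"
  by (simp add: Hausdorff_space_product_topology)

lemma Hausdorff_space_nsphere: "Hausdorff_space (nsphere d)"
  unfolding nsphere by (intro Hausdorff_space_subtopology Hausdorff_space_powertop_real)

lemma closedin_realization_points:
  assumes "simplicial_complex L" "L \<subseteq> K"
  shows "closedin (geometric_realization K) (realization_points L)"
  using compactin_imp_closedin[OF Hausdorff_space_powertop_real compactin_realization_points[OF assms(1)]]
    realization_points_mono[OF assms(2)]
  unfolding geometric_realization_eq by (rule closedin_subset_topspace)

lemma compact_space_geometric_realization:
  "simplicial_complex K \<Longrightarrow> compact_space (geometric_realization K)"
  unfolding geometric_realization_eq
  by (rule compact_space_subtopology[OF compactin_realization_points])

lemma subtopology_geometric_realization: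
  "L \<subseteq> K \<Longrightarrow> subtopology (geometric_realization K) (realization_points L) = geometric_realization L"
  using realization_points_mono[of L K]
  by (simp add: geometric_realization_eq subtopology_subtopology Int_absorb1)

lemma continuous_map_Min:
  assumes "finite s" "s \<noteq> {}" "\<And>v. v \<in> s \<Longrightarrow> continuous_map X euclideanreal (f v)"
  shows "continuous_map X euclideanreal (\<lambda>x. Min ((\<lambda>v. f v x) ` s))"
  using assms
proof (induction s rule: finite_ne_induct)
  case (insert v s)
  have "(\<lambda>x. Min ((\<lambda>v. f v x) ` insert v s)) = (\<lambda>x. min (f v x) (Min ((\<lambda>v. f v x) ` s)))"
    using insert by simp
  then show ?case
    using insert by (auto intro!: continuous_map_real_min)
qed simp

section \<open>Collapsible complexes are contractible\<close>

text \<open>The point moves in the direction from the barycenter of \<open>s\<close> to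
  \<open>w\<close>, until at time 1 its least coordinate on \<open>s\<close> vanishes. That minimum
  is zero unless the support contains \<open>s\<close>, so the points of the smaller complex do not
  move.\<close>

definition push_free_face :: "'a set \<Rightarrow> 'a \<Rightarrow> real \<Rightarrow> ('a \<Rightarrow> real) \<Rightarrow> 'a \<Rightarrow> real" where
  "push_free_face s w t \<alpha> v =
     (if v \<in> s then \<alpha> v - t * Min (\<alpha> ` s)
      else if v = w then \<alpha> w + t * (real (card s) * Min (\<alpha> ` s)) else \<alpha> v)"

lemma push_free_face_0: "push_free_face s w 0 \<alpha> = \<alpha>"
  by (auto simp: push_free_face_def)

lemma Min_eq_0_of_not_subset:
  assumes "\<alpha> \<in> realization_points K" "finite s" "\<not> s \<subseteq> {v. \<alpha> v \<noteq> 0}"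
  shows "Min (\<alpha> ` s) = 0"
proof -
  obtain v where "v \<in> s" "\<alpha> v = 0"
    using assms(3) by blast
  then show ?thesis
    using realization_points_nonneg[OF assms(1)] assms(2)
    by (intro Min_eqI) (auto simp: image_iff intro: sym)
qed

lemma push_free_face_points:
  assumes K: "simplicial_complex K" and s: "finite s" "s \<noteq> {}" "w \<notin> s" "s \<notin> K"
    and facets: "\<forall>x\<in>s. insert w (s - {x}) \<in> K"
    and \<alpha>: "\<alpha> \<in> realization_points (insert s (insert (insert w s) K))"
    and t: "0 \<le> t" "t \<le> 1"
  shows "push_free_face s w t \<alpha> \<in> realization_points (insert s (insert (insert w s) K))"
    and "push_free_face s w 1 \<alpha> \<in> realization_points K"
    and "\<alpha> \<in> realization_points K \<Longrightarrow> push_free_face s w t \<alpha> = \<alpha>"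
proof -
  let ?e = "Min (\<alpha> ` s)"
  let ?L = "insert s (insert (insert w s) K)"
  note nonneg = realization_points_nonneg[OF \<alpha>]
  have fixed: "push_free_face s w u \<alpha> = \<alpha>" if "{v. \<alpha> v \<noteq> 0} \<in> K" for u
  proof -
    have "\<not> s \<subseteq> {v. \<alpha> v \<noteq> 0}"
      using that s(4) simplicial_complexD(2)[OF K that] by blast
    then have "?e = 0"
      using Min_eq_0_of_not_subset[OF \<alpha> s(1)] by blast
    then show ?thesis
      by (auto simp: push_free_face_def)
  qed
  then show "\<alpha> \<in> realization_points K \<Longrightarrow> push_free_face s w t \<alpha> = \<alpha>"
    using realization_points_supp by blast
  have e: "0 \<le> ?e" "\<And>v. v \<in> s \<Longrightarrow> ?e \<le> \<alpha> v"
    using s nonneg by auto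
  obtain x where x: "x \<in> s" "\<alpha> x = ?e"
    using Min_in[of "\<alpha> ` s"] s by fastforce
  have L: "u \<in> ?L" if "u \<subseteq> insert w s" for u
  proof (cases "u = s \<or> u = insert w s")
    case False
    then obtain y where "y \<in> s" "u \<subseteq> insert w (s - {y})"
      using subset_insert_facet[OF \<open>u \<subseteq> insert w s\<close>] by blast
    then show ?thesis
      using facets simplicial_complexD(2)[OF K] by blast
  qed auto
  have main: "push_free_face s w u \<alpha> \<in> realization_points L'"
    if \<alpha>s: "{v. \<alpha> v \<noteq> 0} \<subseteq> insert w s" and u: "0 \<le> u" "u \<le> 1"
      and L': "{v. push_free_face s w u \<alpha> v \<noteq> 0} \<in> L'" for u L'
  proof (rule realization_pointsI[OF _ L'])
    have "u * ?e \<le> \<alpha> v" if "v \<in> s" for v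
      using e(2)[OF that] e(1) u mult_left_le_one_le[of ?e u] by linarith
    then show "0 \<le> push_free_face s w u \<alpha> v" for v
      using nonneg e u by (auto simp: push_free_face_def)
    show "finite (insert w s)"
      using s by simp
    show "push_free_face s w u \<alpha> v = 0" if "v \<notin> insert w s" for v
      using that \<alpha>s by (auto simp: push_free_face_def)
    have "sum (push_free_face s w u \<alpha>) (insert w s)
        = \<alpha> w + u * (real (card s) * ?e) + (\<Sum>v\<in>s. \<alpha> v - u * ?e)"
      using s by (simp add: push_free_face_def)
    also have "\<dots> = sum \<alpha> (insert w s)"
      using s by (simp add: sum_subtractf)
    also have "\<dots> = 1"
      using \<alpha>s s by (intro realization_points_sum[OF \<alpha>]) auto
    finally show "sum (push_free_face s w u \<alpha>) (insert w s) = 1" .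
  qed
  have supp: "{v. \<alpha> v \<noteq> 0} \<in> K \<or> {v. \<alpha> v \<noteq> 0} \<subseteq> insert w s"
    using realization_points_supp[OF \<alpha>] by auto
  have sub: "{v. push_free_face s w u \<alpha> v \<noteq> 0} \<subseteq> insert w s"
    if "{v. \<alpha> v \<noteq> 0} \<subseteq> insert w s" for u
    using that by (auto simp: push_free_face_def)
  show "push_free_face s w t \<alpha> \<in> realization_points ?L"
  proof (cases "{v. \<alpha> v \<noteq> 0} \<in> K")
    case True
    then show ?thesis using fixed \<alpha> by simp
  next
    case False
    then have "{v. \<alpha> v \<noteq> 0} \<subseteq> insert w s"
      using supp by blast
    then show ?thesis
      using main[OF _ t L[OF sub]] by blast
  qed
  show "push_free_face s w 1 \<alpha> \<in> realization_points K"
  proof (cases "{v. \<alpha> v \<noteq> 0} \<in> K")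
    case True
    then have "\<alpha> \<in> realization_points K"
      using \<alpha> by (simp add: realization_points_def)
    then show ?thesis using fixed True by simp
  next
    case False
    have "push_free_face s w 1 \<alpha> x = 0"
      using x by (simp add: push_free_face_def)
    then have "{v. push_free_face s w 1 \<alpha> v \<noteq> 0} \<subseteq> insert w (s - {x})"
      using sub[of 1] False supp by auto
    then have "{v. push_free_face s w 1 \<alpha> v \<noteq> 0} \<in> K"
      using facets x simplicial_complexD(2)[OF K] by blast
    then show ?thesis
      using main[of 1] False supp by auto
  qed
qed

lemma continuous_map_push_free_face:
  assumes "finite s" "s \<noteq> {}"
  shows "continuous_map (prod_topology (top_of_set {0..1}) (geometric_realization K)) euclideanreal
    (\<lambda>x. push_free_face s w (fst x) (snd x) v)"
proof -
  let ?X = "prod_topology (top_of_set {0..1::real}) (geometric_realization K)"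
  have c: "continuous_map ?X euclideanreal (\<lambda>x. snd x u)" for u
    using continuous_map_compose[OF continuous_map_snd continuous_map_barycentric]
    by (simp add: o_def)
  have t: "continuous_map ?X euclideanreal fst"
    using continuous_map_fst continuous_map_into_fulltopology by fastforce
  have "continuous_map ?X euclideanreal (\<lambda>x. Min ((\<lambda>v. snd x v) ` s))"
    by (rule continuous_map_Min[OF assms c])
  then show ?thesis
    unfolding push_free_face_def using c t
    by (cases "v \<in> s"; cases "v = w")
      (simp_all add: continuous_map_add continuous_map_diff continuous_map_real_mult
        continuous_map_real_mult_left)
qed

lemma homotopy_equivalent_expansion:
  assumes K: "simplicial_complex K" and s: "finite s" "s \<noteq> {}" "w \<notin> s" "s \<notin> K"
    and facets: "\<forall>x\<in>s. insert w (s - {x}) \<in> K"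
  shows "geometric_realization (insert s (insert (insert w s) K)) homotopy_equivalent_space
    geometric_realization K"
proof (rule deformation_retract_imp_homotopy_equivalent_space)
  let ?L = "insert s (insert (insert w s) K)"
  let ?r = "push_free_face s w"
  note pt = push_free_face_points[OF K s facets]
  have cont: "continuous_map (prod_topology (top_of_set {0..1}) (geometric_realization ?L))
      (geometric_realization ?L) (\<lambda>x. ?r (fst x) (snd x))"
    unfolding continuous_map_geometric_realization_iff
    using continuous_map_push_free_face[OF s(1,2)] pt(1) by (auto simp: Pi_iff)
  have "homotopic_with (\<lambda>x. True) (geometric_realization ?L) (geometric_realization ?L) id (?r 1)"
    unfolding homotopic_with_def
    using cont by (intro exI[of _ "\<lambda>x. ?r (fst x) (snd x)"]) (simp add: push_free_face_0)
  then show "homotopic_with (\<lambda>x. True) (geometric_realization ?L) (geometric_realization ?L) (?r 1) id"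
    by (rule homotopic_with_symD)
  have "continuous_map (geometric_realization ?L) (geometric_realization ?L)
      ((\<lambda>x. ?r (fst x) (snd x)) \<circ> (\<lambda>x. (1, x)))"
    by (rule continuous_map_compose[OF _ cont]) (auto simp: continuous_map_pairwise o_def)
  then have "continuous_map (geometric_realization ?L) (geometric_realization K) (?r 1)"
    using pt(2)[where t = 1] by (auto simp: continuous_map_geometric_realization_iff o_def Pi_iff)
  moreover have "continuous_map (geometric_realization K) (geometric_realization ?L) id"
    using realization_points_mono[OF subset_insertI2[OF subset_insertI], of K s "insert w s"]
    by (auto simp: continuous_map_geometric_realization_iff continuous_map_barycentric)
  moreover have "\<forall>x\<in>realization_points K. ?r 1 x = x"
    using pt(3)[of _ 1] realization_points_mono[of K ?L] by auto
  ultimately show "retraction_maps (geometric_realization ?L) (geometric_realization K) (?r 1) id"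
    by (simp add: retraction_maps_def)
qed

lemma contractible_space_collapsible:
  assumes "collapsible K"
  shows "contractible_space (geometric_realization K)"
  using assms
proof induction
  case void
  have "realization_points {} = ({} :: ('a \<Rightarrow> real) set)"
    by (simp add: realization_points_def)
  then show ?case
    by (intro contractible_space_subset_singleton[where a = undefined]) simp
next
  case (expand K s w)
  show ?case
  proof (cases "s = {}")
    case True
    \<comment> \<open>A complex without the empty simplex has no simplices, so this is the first
      expansion, from the void complex to a point.\<close>
    then have "K = {}"
      using expand collapsible_closed[OF expand(1)] simplicial_complexD(2) by blast
    have "\<alpha> = (\<lambda>v. if v = w then 1 else 0)" if "\<alpha> \<in> realization_points {{}, {w}}" for \<alpha> :: "'a \<Rightarrow> real"
    proof -
      have "\<alpha> v = 0" if "v \<noteq> w" for v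
        using realization_points_supp[OF \<open>\<alpha> \<in> _\<close>] that by auto
      moreover have "sum \<alpha> {w} = 1"
        using calculation by (intro realization_points_sum[OF that]) auto
      ultimately show ?thesis by auto
    qed
    then show ?thesis
      unfolding \<open>s = {}\<close> \<open>K = {}\<close>
      by (intro contractible_space_subset_singleton[where a = "\<lambda>v. if v = w then 1 else 0"]) auto
  next
    case False
    then show ?thesis
      using homotopy_equivalent_space_contractibility[OF homotopy_equivalent_expansion[OF
            collapsible_closed[OF expand.hyps(1)] expand.hyps(2) False expand.hyps(3-5)]]
        expand.IH by blast
  qed
qed

section \<open>Quotients by contractible subspaces\<close>

text \<open>The end \<open>H (1, _)\<close> is constant on \<open>S\<close> and thus factors through
  \<open>f\<close>; this gives the homotopy inverse. As \<open>H\<close> keeps \<open>S\<close>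
  inside itself, \<open>f \<circ> H\<close> descends to a homotopy on the quotient: the unit
  interval is locally compact Hausdorff, so the product of \<open>f\<close> with it is again a
  quotient map.\<close>

lemma homotopy_equivalent_quotient:
  assumes f: "quotient_map X W f"
    and H: "continuous_map (prod_topology (top_of_set {0..1::real}) X) X H"
    and H0: "\<And>x. x \<in> topspace X \<Longrightarrow> H (0, x) = x"
    and HS: "\<And>t x. t \<in> {0..1} \<Longrightarrow> x \<in> S \<Longrightarrow> H (t, x) \<in> S"
    and H1: "\<And>x. x \<in> S \<Longrightarrow> H (1, x) = a"
    and S: "\<And>x. x \<in> S \<Longrightarrow> f x = b"
    and inj: "\<And>x y. x \<in> topspace X \<Longrightarrow> y \<in> topspace X \<Longrightarrow> f x = f y \<Longrightarrow> x = y \<or> x \<in> S \<and> y \<in> S"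
  shows "X homotopy_equivalent_space W"
proof -
  let ?I = "top_of_set {0..1::real}"
  note fc = quotient_imp_continuous_map[OF f]
  have H1c: "continuous_map X X (\<lambda>x. H (1, x))"
    using continuous_map_compose[OF _ H, of X "\<lambda>x. (1, x)"]
    by (simp add: continuous_map_pairwise o_def)
  obtain g where g: "continuous_map W X g" "\<And>x. x \<in> topspace X \<Longrightarrow> g (f x) = H (1, x)"
  proof (rule quotient_map_lift_exists[OF f H1c])
    show "H (1, x) = H (1, y)" if "x \<in> topspace X" "y \<in> topspace X" "f x = f y" for x y
      using inj[OF that] H1 by auto
  qed auto
  have q: "quotient_map (prod_topology ?I X) (prod_topology ?I W) (\<lambda>(t, x). (t, f x))"
    by (intro quotient_map_prod_right f)
      (auto simp: compact_imp_locally_compact_space compact_space_subtopology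
        Hausdorff_space_subtopology)
  have fH: "continuous_map (prod_topology ?I X) W (f \<circ> H)"
    by (rule continuous_map_compose[OF H fc])
  obtain G where G: "continuous_map (prod_topology ?I W) W G"
    "\<And>z. z \<in> topspace (prod_topology ?I X) \<Longrightarrow> G ((\<lambda>(t, x). (t, f x)) z) = (f \<circ> H) z"
  proof (rule quotient_map_lift_exists[OF q fH])
    show "(f \<circ> H) z = (f \<circ> H) z'"
      if "z \<in> topspace (prod_topology ?I X)" "z' \<in> topspace (prod_topology ?I X)"
        "(\<lambda>(t, x). (t, f x)) z = (\<lambda>(t, x). (t, f x)) z'" for z z'
    proof -
      obtain t x t' x' where z: "z = (t, x)" "z' = (t', x')"
        by (metis surj_pair)
      then have t: "t' = t" "t \<in> {0..1}" "x \<in> topspace X" "x' \<in> topspace X" "f x = f x'"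
        using that by auto
      show ?thesis
        using inj[OF t(3-5)] HS[OF t(2)] S unfolding z t(1) by auto
    qed
  qed auto
  have G': "G (t, f x) = f (H (t, x))" if "t \<in> {0..1}" "x \<in> topspace X" for t x
    using G(2)[of "(t, x)"] that by simp
  have surj: "\<exists>x\<in>topspace X. f x = y" if "y \<in> topspace W" for y
    using quotient_imp_surjective_map[OF f] that by (metis imageE)
  have "homotopic_with (\<lambda>x. True) X X id (g \<circ> f)"
    using homotopic_with[of X "\<lambda>x. True" X id "g \<circ> f"] H H0 g(2)
    by (auto intro!: exI[of _ H])
  moreover have "homotopic_with (\<lambda>x. True) W W id (f \<circ> g)"
  proof -
    have "G (0, y) = y \<and> G (1, y) = f (g y)" if "y \<in> topspace W" for y
    proof -
      obtain x where "x \<in> topspace X" "f x = y"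
        using surj[OF \<open>y \<in> topspace W\<close>] by blast
      then show ?thesis
        using G'[of 0 x] G'[of 1 x] H0 g(2) by auto
    qed
    then show ?thesis
      using homotopic_with[of W "\<lambda>x. True" W id "f \<circ> g"] G(1) by (auto intro!: exI[of _ G])
  qed
  ultimately show ?thesis
    unfolding homotopy_equivalent_space_def using fc g(1) by (metis homotopic_with_sym)
qed


section \<open>The simplex modulo its boundary\<close>

text \<open>The factor makes the depth 1 at the barycenter of the standard simplex; it is 0 on the
  boundary.\<close>

definition depth :: "nat \<Rightarrow> (nat \<Rightarrow> real) \<Rightarrow> real" where
  "depth d a = real (Suc d) * Min (a ` {..d})"

text \<open>The interior of the simplex is mapped to \<open>\<real>\<^sup>d\<close> by \<open>a \<mapsto> ((a j - a 0) / depth d a)\<^sub>j\<close>;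
  \<open>simplex_sphere\<close> is its composition with the inverse stereographic projection, written without
  a division by the depth, so that it extends continuously to the boundary.\<close>

definition simplex_sphere :: "nat \<Rightarrow> (nat \<Rightarrow> real) \<Rightarrow> nat \<Rightarrow> real" where
  "simplex_sphere d a j =
     (let \<mu> = depth d a; N = (\<Sum>i\<le>d. (a i - a 0)\<^sup>2)
      in if j = 0 then (N - \<mu>\<^sup>2) / (N + \<mu>\<^sup>2)
         else if j \<le> d then 2 * (a j - a 0) * \<mu> / (N + \<mu>\<^sup>2) else 0)"

definition std_simplex :: "nat \<Rightarrow> (nat \<Rightarrow> real) set" where
  "std_simplex d = {a. (\<forall>i\<le>d. 0 \<le> a i) \<and> sum a {..d} = 1}"

abbreviation nsphere_base :: "nat \<Rightarrow> real" where
  "nsphere_base \<equiv> \<lambda>n. if n = 0 then 1 else 0"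

text \<open>All differences of coordinates vanish only at the barycenter, and there the depth is
  1.\<close>

lemma simplex_sphere_denom_pos:
  assumes "a \<in> std_simplex d"
  shows "(\<Sum>i\<le>d. (a i - a 0)\<^sup>2) + (depth d a)\<^sup>2 > 0"
proof (cases "(\<Sum>i\<le>d. (a i - a 0)\<^sup>2) = 0")
  case True
  then have sq: "\<forall>i\<in>{..d}. (a i - a 0)\<^sup>2 = 0"
    by (subst (asm) sum_nonneg_eq_0_iff) (simp_all only: finite_atMost zero_le_power2)
  then have eq: "a i = a 0" if "i \<in> {..d}" for i
  proof -
    have "(a i - a 0)\<^sup>2 = 0"
      by (rule bspec[OF sq that])
    then show ?thesis by simp
  qed
  have "a ` {..d} = (\<lambda>_. a 0) ` {..d}"
    by (rule image_cong[OF refl eq])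
  moreover have "sum a {..d} = (\<Sum>i\<le>d. a 0)"
    by (rule sum.cong[OF refl eq])
  ultimately have "depth d a = 1"
    using assms by (simp add: depth_def std_simplex_def)
  then show ?thesis
    by (simp add: sum_nonneg add_nonneg_pos)
next
  case False
  moreover have "0 \<le> (\<Sum>i\<le>d. (a i - a 0)\<^sup>2)"
    by (simp add: sum_nonneg)
  ultimately show ?thesis
    using zero_le_power2[of "depth d a"] by linarith
qed

lemma simplex_sphere_in_nsphere:
  assumes "a \<in> std_simplex d"
  shows "simplex_sphere d a \<in> topspace (nsphere d)"
proof -
  define \<mu> where "\<mu> = depth d a"
  define N where "N = (\<Sum>i\<le>d. (a i - a 0)\<^sup>2)"
  have D: "N + \<mu>\<^sup>2 > 0"
    using simplex_sphere_denom_pos[OF assms] by (simp add: N_def \<mu>_def)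
  have "(simplex_sphere d a i)\<^sup>2 =
      (if i = 0 then ((N - \<mu>\<^sup>2) / (N + \<mu>\<^sup>2))\<^sup>2 else 0) + (2 * \<mu> / (N + \<mu>\<^sup>2))\<^sup>2 * (a i - a 0)\<^sup>2"
    if "i \<le> d" for i
    using that by (cases "i = 0")
      (simp_all add: simplex_sphere_def Let_def N_def \<mu>_def mult_ac
        flip: power_mult_distrib del: right_diff_distrib_numeral left_diff_distrib_numeral)
  then have "(\<Sum>i\<le>d. (simplex_sphere d a i)\<^sup>2)
      = ((N - \<mu>\<^sup>2) / (N + \<mu>\<^sup>2))\<^sup>2 + (2 * \<mu> / (N + \<mu>\<^sup>2))\<^sup>2 * N"
    by (simp add: sum.distrib N_def flip: sum_distrib_left)
  also have "\<dots> = ((N - \<mu>\<^sup>2)\<^sup>2 + 4 * \<mu>\<^sup>2 * N) / (N + \<mu>\<^sup>2)\<^sup>2"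
    by (simp add: power_divide power_mult_distrib add_divide_distrib)
  also have "(N - \<mu>\<^sup>2)\<^sup>2 + 4 * \<mu>\<^sup>2 * N = (N + \<mu>\<^sup>2)\<^sup>2"
    by (simp add: power2_eq_square algebra_simps)
  finally have "(\<Sum>i\<le>d. (simplex_sphere d a i)\<^sup>2) = 1"
    using D by simp
  then show ?thesis
    by (simp add: nsphere simplex_sphere_def Let_def)
qed

lemma simplex_sphere_base_iff:
  assumes "a \<in> std_simplex d"
  shows "simplex_sphere d a = nsphere_base \<longleftrightarrow> depth d a = 0"
proof
  have D: "(\<Sum>i\<le>d. (a i - a 0)\<^sup>2) + (depth d a)\<^sup>2 > 0"
    by (rule simplex_sphere_denom_pos[OF assms])
  show "depth d a = 0" if "simplex_sphere d a = nsphere_base"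
    using fun_cong[OF that, of 0] D by (simp add: simplex_sphere_def Let_def field_simps)
  show "simplex_sphere d a = nsphere_base" if "depth d a = 0"
    using that D by (auto simp: simplex_sphere_def Let_def fun_eq_iff)
qed

lemma Min_affine:
  fixes y :: "nat \<Rightarrow> real"
  assumes "finite A" "A \<noteq> {}" "0 \<le> m"
  shows "Min ((\<lambda>j. c + m * y j) ` A) = c + m * Min (y ` A)"
proof -
  have "mono (\<lambda>x. c + m * x)"
    using assms(3) by (simp add: mono_def mult_left_mono)
  then have "c + m * Min (y ` A) = Min ((\<lambda>x. c + m * x) ` (y ` A))"
    using assms by (intro mono_Min_commute) auto
  then show ?thesis
    by (simp add: image_image)
qed

text \<open>The depth is a multiple of the least coordinate, which expresses \<open>a 0\<close>
  through the depth and \<open>y\<close>; that the coordinates sum to 1 then determines the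
  depth.\<close>

lemma simplex_coordinates:
  assumes a: "a \<in> std_simplex d" "depth d a > 0"
    and y: "\<And>j. j \<le> d \<Longrightarrow> a j - a 0 = depth d a * y j"
  shows "depth d a * ((\<Sum>j\<le>d. y j - Min (y ` {..d})) + 1) = 1"
    and "j \<le> d \<Longrightarrow> a j = depth d a * (y j - Min (y ` {..d}) + 1 / (Suc d))"
proof -
  let ?m = "Min (y ` {..d})"
  have y': "a j = a 0 + depth d a * y j" if "j \<in> {..d}" for j
    using y[of j] that by simp
  have "a ` {..d} = (\<lambda>j. a 0 + depth d a * y j) ` {..d}"
    by (rule image_cong[OF refl y'])
  then have "Min (a ` {..d}) = a 0 + depth d a * ?m"
    using a by (simp add: Min_affine)
  then have "depth d a = real (Suc d) * (a 0 + depth d a * ?m)"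
    by (simp add: depth_def)
  then have a0: "a 0 = depth d a / Suc d - depth d a * ?m"
    by (simp add: field_simps del: of_nat_Suc)
  show *: "a j = depth d a * (y j - ?m + 1 / (Suc d))" if "j \<le> d" for j
    using y[OF that] a0 by (simp add: algebra_simps)
  have "1 = (\<Sum>j\<le>d. depth d a * (y j - ?m + 1 / (Suc d)))"
    using a(1) * by (simp add: std_simplex_def)
  also have "\<dots> = depth d a * (\<Sum>j\<le>d. y j - ?m + 1 / (Suc d))"
    by (simp add: sum_distrib_left)
  also have "(\<Sum>j\<le>d. y j - ?m + 1 / (Suc d)) = (\<Sum>j\<le>d. y j - ?m) + 1"
    by (simp add: sum.distrib)
  finally show "depth d a * ((\<Sum>j\<le>d. y j - ?m) + 1) = 1"
    by simp
qed

text \<open>The quotient on the right is the stereographic projection from the base point; it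
  recovers the coordinates in Euclidean space from which the map was built.\<close>

lemma simplex_sphere_stereographic:
  assumes "a \<in> std_simplex d" "depth d a > 0" "j \<le> d"
  shows "a j - a 0 = depth d a * (if j = 0 then 0 else simplex_sphere d a j / (1 - simplex_sphere d a 0))"
proof (cases "j = 0")
  case False
  define D where "D = (\<Sum>i\<le>d. (a i - a 0)\<^sup>2) + (depth d a)\<^sup>2"
  have D: "D > 0"
    using simplex_sphere_denom_pos[OF assms(1)] by (simp add: D_def)
  have "1 - simplex_sphere d a 0 = (D - (D - 2 * (depth d a)\<^sup>2)) / D"
    using D unfolding simplex_sphere_def Let_def D_def by (simp add: field_simps)
  then have "1 - simplex_sphere d a 0 = 2 * (depth d a)\<^sup>2 / D"
    by simp
  moreover have "simplex_sphere d a j = 2 * (a j - a 0) * depth d a / D"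
    using False assms(3) unfolding simplex_sphere_def Let_def D_def by simp
  ultimately have "depth d a * (simplex_sphere d a j / (1 - simplex_sphere d a 0))
      = depth d a * ((2 * (a j - a 0) * depth d a / D) / (2 * (depth d a)\<^sup>2 / D))"
    by simp
  also have "\<dots> = a j - a 0"
    using D assms(2) by (simp add: power2_eq_square)
  finally show ?thesis
    using False by simp
qed simp

lemma simplex_sphere_inj:
  assumes a: "a \<in> std_simplex d" "depth d a > 0" and b: "b \<in> std_simplex d" "depth d b > 0"
    and eq: "simplex_sphere d a = simplex_sphere d b" and j: "j \<le> d"
  shows "a j = b j"
proof -
  define y where "y j = (if j = 0 then 0 else simplex_sphere d a j / (1 - simplex_sphere d a 0))" for j
  have ya: "a j - a 0 = depth d a * y j" if "j \<le> d" for j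
    using simplex_sphere_stereographic[OF a that] by (simp add: y_def)
  have yb: "b j - b 0 = depth d b * y j" if "j \<le> d" for j
    using simplex_sphere_stereographic[OF b that] eq by (simp add: y_def)
  note sa = simplex_coordinates[OF a ya]
  note sb = simplex_coordinates[OF b yb]
  have "depth d a * ((\<Sum>j\<le>d. y j - Min (y ` {..d})) + 1)
      = depth d b * ((\<Sum>j\<le>d. y j - Min (y ` {..d})) + 1)"
    using sa(1) sb(1) by simp
  then have "depth d a = depth d b"
    using sa(1) by (metis mult_cancel_right mult_zero_right zero_neq_one)
  then show ?thesis
    using sa(2)[OF _ j] sb(2)[OF _ j] by simp
qed

lemma simplex_sphere_surj:
  assumes x: "x \<in> topspace (nsphere d)" "x \<noteq> nsphere_base"
  obtains a where "a \<in> std_simplex d" "depth d a > 0" "simplex_sphere d a = x"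
proof -
  have xs: "(\<Sum>i\<le>d. (x i)\<^sup>2) = 1" "\<And>i. i > d \<Longrightarrow> x i = 0"
    using x(1) by (auto simp: nsphere)
  have split: "(\<Sum>i\<le>d. f i) = f 0 + (\<Sum>i\<in>{1..d}. f i)" for f :: "nat \<Rightarrow> real"
    by (simp add: sum.atMost_shift sum.atLeast1_atMost_eq lessThan_Suc_atMost)
  have x0: "x 0 \<noteq> 1"
  proof
    assume 1: "x 0 = 1"
    then have "(\<Sum>i\<in>{1..d}. (x i)\<^sup>2) = 0"
      using xs(1) split[of "\<lambda>i. (x i)\<^sup>2"] by simp
    then have "\<forall>i\<in>{1..d}. x i = 0"
      by (simp add: sum_nonneg_eq_0_iff)
    then have "x = nsphere_base"
      using 1 xs(2) by (auto simp: fun_eq_iff Suc_le_eq not_less[symmetric])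
    then show False using x(2) by simp
  qed
  \<comment> \<open>This is the stereographic projection of \<open>x\<close> from the base point. By
    \<open>simplex_coordinates\<close>, a preimage must then have depth \<open>1 / Q\<close> and the
    coordinates \<open>a\<close> defined here.\<close>
  define y where "y j = (if j = 0 then 0 else x j / (1 - x 0))" for j
  define m where "m = Min (y ` {..d})"
  define Q where "Q = (\<Sum>j\<le>d. y j - m) + 1"
  define a where "a j = (y j - m + 1 / (Suc d)) / Q" for j
  have ym: "m \<le> y j" if "j \<le> d" for j
    using that by (simp add: m_def)
  then have Q: "Q > 0"
    unfolding Q_def by (intro add_nonneg_pos sum_nonneg) auto
  have "(\<Sum>j\<le>d. y j - m + 1 / (Suc d)) = Q"
    by (simp add: sum.distrib Q_def)
  then have "sum a {..d} = 1"
    using Q by (simp add: a_def flip: sum_divide_distrib)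
  moreover have "0 \<le> a j" if "j \<le> d" for j
    using ym[OF that] Q by (simp add: a_def)
  ultimately have a: "a \<in> std_simplex d"
    by (simp add: std_simplex_def)
  have "a = (\<lambda>j. (1 / (Suc d) - m) / Q + (1 / Q) * y j)"
    by (auto simp: a_def fun_eq_iff add_divide_distrib diff_divide_distrib)
  then have "Min (a ` {..d}) = (1 / (Suc d) - m) / Q + (1 / Q) * m"
    using Q Min_affine[of "{..d}" "1 / Q" "(1 / (Suc d) - m) / Q" y] by (simp add: m_def)
  also have "\<dots> = (1 / Suc d) / Q"
    using Q by (simp add: field_simps del: of_nat_Suc)
  finally have da: "depth d a = 1 / Q"
    by (simp add: depth_def del: of_nat_Suc)
  have w: "a j - a 0 = y j / Q" for j
    by (simp add: a_def y_def add_divide_distrib diff_divide_distrib)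
  define N where "N = (\<Sum>i\<le>d. (y i)\<^sup>2)"
  have N: "(\<Sum>i\<le>d. (a i - a 0)\<^sup>2) = N / Q\<^sup>2"
    by (simp add: w N_def power_divide sum_divide_distrib)
  have "N = (\<Sum>i\<in>{1..d}. (x i / (1 - x 0))\<^sup>2)"
    unfolding N_def split by (simp add: y_def)
  also have "\<dots> = (\<Sum>i\<in>{1..d}. (x i)\<^sup>2) / (1 - x 0)\<^sup>2"
    by (simp add: power_divide sum_divide_distrib)
  also have "(\<Sum>i\<in>{1..d}. (x i)\<^sup>2) = (1 + x 0) * (1 - x 0)"
    using xs(1) split[of "\<lambda>i. (x i)\<^sup>2"] by (simp add: power2_eq_square algebra_simps)
  finally have N': "N = (1 + x 0) / (1 - x 0)"
    using x0 by (simp add: power2_eq_square)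
  have N'1: "N + 1 = 2 / (1 - x 0)" "N - 1 = 2 * x 0 / (1 - x 0)"
    using x0 unfolding N' by (simp_all add: field_simps)
  have den: "N / Q\<^sup>2 + (1 / Q)\<^sup>2 = (2 / (1 - x 0)) / Q\<^sup>2"
    using x0 N'1(1) by (simp add: power_divide flip: add_divide_distrib)
  have num: "N / Q\<^sup>2 - (1 / Q)\<^sup>2 = (2 * x 0 / (1 - x 0)) / Q\<^sup>2"
    using x0 N'1(2) by (simp add: power_divide flip: diff_divide_distrib)
  have "simplex_sphere d a j = x j" for j
  proof -
    consider "j = 0" | "j \<noteq> 0" "j \<le> d" | "j > d" by linarith
    then show ?thesis
    proof cases
      case 1
      then have "simplex_sphere d a j = ((2 * x 0 / (1 - x 0)) / Q\<^sup>2) / ((2 / (1 - x 0)) / Q\<^sup>2)"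
        by (simp add: simplex_sphere_def Let_def N da den num)
      also have "\<dots> = x 0"
        using x0 Q by simp
      finally show ?thesis using 1 by simp
    next
      case 2
      then have "simplex_sphere d a j = (2 * (y j / Q) * (1 / Q)) / ((2 / (1 - x 0)) / Q\<^sup>2)"
        by (simp add: simplex_sphere_def Let_def N[unfolded w] da den w)
      also have "\<dots> = y j * (1 - x 0)"
        using x0 Q by (simp add: power2_eq_square)
      finally show ?thesis using 2 x0 by (simp add: y_def)
    next
      case 3
      then show ?thesis using xs(2) by (simp add: simplex_sphere_def Let_def)
    qed
  qed
  then show thesis
    using that[OF a] da Q by (simp add: fun_eq_iff)
qed

lemma continuous_map_simplex_sphere:
  assumes "\<And>x. x \<in> topspace X \<Longrightarrow> f x \<in> std_simplex d"
    and "\<And>j. continuous_map X euclideanreal (\<lambda>x. f x j)"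
  shows "continuous_map X (nsphere d) (\<lambda>x. simplex_sphere d (f x))"
proof -
  have \<mu>: "continuous_map X euclideanreal (\<lambda>x. depth d (f x))"
    unfolding depth_def
    by (intro continuous_map_real_mult_left continuous_map_Min[where f = "\<lambda>j x. f x j"] assms) auto
  have N: "continuous_map X euclideanreal (\<lambda>x. (\<Sum>i\<le>d. (f x i - f x 0)\<^sup>2))"
    by (intro continuous_map_sum continuous_map_real_pow continuous_map_diff assms) auto
  have "(\<Sum>i\<le>d. (f x i - f x 0)\<^sup>2) + (depth d (f x))\<^sup>2 \<noteq> 0" if "x \<in> topspace X" for x
    using simplex_sphere_denom_pos[OF assms(1)[OF that]] by simp
  then have "continuous_map X euclideanreal (\<lambda>x. simplex_sphere d (f x) j)" for j
    unfolding simplex_sphere_def Let_def using \<mu> N assms(2)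
    by (cases "j = 0"; cases "j \<le> d")
      (auto intro!: continuous_map_real_divide continuous_map_add continuous_map_diff
        continuous_map_real_pow continuous_map_real_mult continuous_map_real_mult_left)
  then show ?thesis
    using simplex_sphere_in_nsphere[OF assms(1)]
    by (auto simp: nsphere continuous_map_in_subtopology continuous_map_componentwise_UNIV)
qed


section \<open>Spherical complexes are wedges of spheres\<close>

lemma homotopy_equivalent_contractible_spaces:
  assumes "contractible_space X" "topspace X \<noteq> {}" "contractible_space Y" "topspace Y \<noteq> {}"
  shows "X homotopy_equivalent_space Y"
proof -
  obtain a b where "a \<in> topspace X" "b \<in> topspace Y"
    using assms by blast
  then show ?thesis
    unfolding homotopy_equivalent_space_def
    using assms
    by (intro exI[of _ "\<lambda>_. b"] exI[of _ "\<lambda>_. a"] conjI homotopic_into_contractible_space) (auto simp: o_def)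
qed

lemma simplicial_complex_Pow: "finite s \<Longrightarrow> simplicial_complex (Pow s)"
  by (auto simp: simplicial_complex_def intro: finite_subset)

lemma collapsible_vertex:
  assumes "collapsible K" "K \<noteq> {}"
  shows "\<exists>w. {w} \<in> K"
  using assms
proof cases
  case (expand L s w)
  then show ?thesis
    using simplicial_complexD(2)[OF collapsible_closed[OF assms(1)], of "insert w s" "{w}"] by blast
qed simp

section \<open>Cells of one dimension attached to a collapsible complex\<close>

locale top_cells =
  fixes K C :: "'a set set" and d :: nat
  assumes K: "simplicial_complex K" and C: "collapsible C" and CK: "C \<subseteq> K"
    and dim: "\<And>s. s \<in> K - C \<Longrightarrow> card s = Suc d"
begin

lemma complex_C: "simplicial_complex C"
  using C by (rule collapsible_closed)

lemma finite_cells: "finite (K - C)"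
  using K by (simp add: simplicial_complex_def)

lemma cell_finite: "s \<in> K - C \<Longrightarrow> finite s \<and> s \<noteq> {}"
  using dim[of s] simplicial_complexD(1)[OF K] by (metis DiffD1 card.empty nat.distinct(1))

lemma points_C_K: "realization_points C \<subseteq> realization_points K"
  by (rule realization_points_mono[OF CK])

text \<open>A support that contains a cell lies outside \<open>C\<close>, hence is a cell itself;
  all cells have the same size. Consequently the least coordinate on a cell is non-zero only in the
  interior of that cell.\<close>

lemma supp_cell:
  assumes \<alpha>: "\<alpha> \<in> realization_points K" and s: "s \<in> K - C" "s \<subseteq> {v. \<alpha> v \<noteq> 0}"
  shows "{v. \<alpha> v \<noteq> 0} = s"
proof -
  have 1: "{v. \<alpha> v \<noteq> 0} \<in> K"
    by (rule realization_points_supp[OF \<alpha>])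
  then have "{v. \<alpha> v \<noteq> 0} \<in> K - C"
    using s simplicial_complexD(2)[OF complex_C] by blast
  then show ?thesis
    using dim s card_subset_eq[OF simplicial_complexD(1)[OF K 1] s(2)] by metis
qed

lemma Min_cell_eq_0:
  "\<lbrakk>\<alpha> \<in> realization_points K; s \<in> K - C; {v. \<alpha> v \<noteq> 0} \<noteq> s\<rbrakk> \<Longrightarrow> Min (\<alpha> ` s) = 0"
  using Min_eq_0_of_not_subset[of \<alpha> K s] supp_cell cell_finite by blast

lemma Min_cell_pos:
  assumes "\<alpha> \<in> realization_points K" "s \<in> K - C" "{v. \<alpha> v \<noteq> 0} = s"
  shows "Min (\<alpha> ` s) > 0"
proof -
  have "0 < \<alpha> v" if "v \<in> s" for v
    using that assms(3) realization_points_nonneg[OF assms(1), of v] by auto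
  then show ?thesis
    using cell_finite[OF assms(2)] by simp
qed

text \<open>At most one summand is non-zero at a point of the realization, namely that of the cell
  with the point in its interior. Summing over all cells makes continuity evident.\<close>

definition total_depth :: "('a \<Rightarrow> real) \<Rightarrow> real" where
  "total_depth \<alpha> = real (Suc d) * (\<Sum>s\<in>K - C. Min (\<alpha> ` s))"

text \<open>Divided by \<open>1 - total_depth \<alpha>\<close>, this is the point where the ray from
  the barycenter of the cell through \<alpha> leaves the cell.\<close>

definition core :: "('a \<Rightarrow> real) \<Rightarrow> 'a \<Rightarrow> real" where
  "core \<alpha> v = \<alpha> v - (\<Sum>s\<in>{s \<in> K - C. v \<in> s}. Min (\<alpha> ` s))"

text \<open>At time \<open>t\<close> the points of depth \<open>t / 2\<close> have reached the
  boundary, and the deeper ones are stretched over the whole cell. Halving the time keeps the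
  denominator positive and the barycenter in place. The \<open>max\<close> silences the cells on
  which the least coordinate is zero.\<close>

definition push_out :: "real \<Rightarrow> ('a \<Rightarrow> real) \<Rightarrow> 'a \<Rightarrow> real" where
  "push_out t \<alpha> v =
     (core \<alpha> v + (\<Sum>s\<in>{s \<in> K - C. v \<in> s}. max 0 (Min (\<alpha> ` s) - t / (2 * real (Suc d))))) / (1 - t / 2)"

text \<open>The homotopy extends a contraction \<open>h\<close> of \<open>C\<close>: every cell is blown up radially from its
  barycenter, and what is pushed across the boundary follows \<open>h\<close>.\<close>

definition extend_homotopy ::
    "(real \<times> ('a \<Rightarrow> real) \<Rightarrow> 'a \<Rightarrow> real) \<Rightarrow> real \<times> ('a \<Rightarrow> real) \<Rightarrow> 'a \<Rightarrow> real" where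
  "extend_homotopy h = (\<lambda>x. if total_depth (snd x) \<le> fst x / 2
     then h (fst x - 2 * total_depth (snd x), \<lambda>v. core (snd x) v / (1 - total_depth (snd x)))
     else push_out (fst x) (snd x))"

lemma in_C:
  assumes \<alpha>: "\<alpha> \<in> realization_points C"
  shows "total_depth \<alpha> = 0" "core \<alpha> = \<alpha>" "push_out 0 \<alpha> = \<alpha>"
proof -
  have "Min (\<alpha> ` s) = 0" if "s \<in> K - C" for s
    using that \<alpha> realization_points_supp[OF \<alpha>] points_C_K
    by (intro Min_cell_eq_0) auto
  then show "total_depth \<alpha> = 0" "core \<alpha> = \<alpha>" "push_out 0 \<alpha> = \<alpha>"
    by (auto simp: total_depth_def core_def push_out_def intro!: sum.neutral)
qed

lemma sum_cells_single:
  assumes "s \<in> K - C" "\<And>s'. s' \<in> K - C \<Longrightarrow> s' \<noteq> s \<Longrightarrow> f s' = 0"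
  shows "(\<Sum>s'\<in>K - C. f s') = (f s :: real)"
    and "(\<Sum>s'\<in>{s' \<in> K - C. v \<in> s'}. f s') = (if v \<in> s then f s else 0)"
proof -
  have "(\<Sum>s'\<in>K - C. f s') = (\<Sum>s'\<in>{s}. f s')"
    using assms finite_cells by (intro sum.mono_neutral_right) auto
  then show "(\<Sum>s'\<in>K - C. f s') = f s" by simp
  have "(\<Sum>s'\<in>{s' \<in> K - C. v \<in> s'}. f s') = (\<Sum>s'\<in>(if v \<in> s then {s} else {}). f s')"
    using assms finite_subset[OF _ finite_cells, of "{s' \<in> K - C. v \<in> s'}"]
    by (intro sum.mono_neutral_right) auto
  then show "(\<Sum>s'\<in>{s' \<in> K - C. v \<in> s'}. f s') = (if v \<in> s then f s else 0)" by simp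
qed

lemma in_cell:
  assumes \<alpha>: "\<alpha> \<in> realization_points K" and s: "{v. \<alpha> v \<noteq> 0} = s" "s \<in> K - C"
    and t: "0 \<le> t"
  shows "total_depth \<alpha> = real (Suc d) * Min (\<alpha> ` s)"
    and "core \<alpha> v = (if v \<in> s then \<alpha> v - Min (\<alpha> ` s) else 0)"
    and "push_out t \<alpha> v =
      (core \<alpha> v + (if v \<in> s then max 0 (Min (\<alpha> ` s) - t / (2 * real (Suc d))) else 0)) / (1 - t / 2)"
proof -
  have z: "Min (\<alpha> ` s') = 0" if "s' \<in> K - C" "s' \<noteq> s" for s'
    using that s \<alpha> by (intro Min_cell_eq_0) auto
  have z': "max 0 (Min (\<alpha> ` s') - t / (2 * real (Suc d))) = 0" if "s' \<in> K - C" "s' \<noteq> s" for s'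
    using z[OF that] t by simp
  have "(\<Sum>s\<in>K - C. Min (\<alpha> ` s)) = Min (\<alpha> ` s)"
    by (rule sum_cells_single(1)[OF s(2)]) (rule z)
  then show "total_depth \<alpha> = real (Suc d) * Min (\<alpha> ` s)"
    by (simp add: total_depth_def)
  have "(\<Sum>s\<in>{s \<in> K - C. v \<in> s}. Min (\<alpha> ` s)) = (if v \<in> s then Min (\<alpha> ` s) else 0)"
    by (rule sum_cells_single(2)[OF s(2)]) (rule z)
  moreover have "\<alpha> v = 0" if "v \<notin> s"
    using s that by auto
  ultimately show "core \<alpha> v = (if v \<in> s then \<alpha> v - Min (\<alpha> ` s) else 0)"
    unfolding core_def by simp
  have "(\<Sum>s\<in>{s \<in> K - C. v \<in> s}. max 0 (Min (\<alpha> ` s) - t / (2 * real (Suc d))))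
      = (if v \<in> s then max 0 (Min (\<alpha> ` s) - t / (2 * real (Suc d))) else 0)"
    by (rule sum_cells_single(2)[OF s(2)]) (rule z')
  then show "push_out t \<alpha> v =
      (core \<alpha> v + (if v \<in> s then max 0 (Min (\<alpha> ` s) - t / (2 * real (Suc d))) else 0)) / (1 - t / 2)"
    unfolding push_out_def by (simp only:)
qed

lemma points_cases:
  assumes "\<alpha> \<in> realization_points K"
  obtains (C) "\<alpha> \<in> realization_points C"
  | (cell) s where "s \<in> K - C" "{v. \<alpha> v \<noteq> 0} = s" "Min (\<alpha> ` s) > 0"
      "sum \<alpha> s = 1" "\<And>v. v \<notin> s \<Longrightarrow> \<alpha> v = 0" "\<And>v. v \<in> s \<Longrightarrow> Min (\<alpha> ` s) \<le> \<alpha> v"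
proof (cases "{v. \<alpha> v \<noteq> 0} \<in> C")
  case True
  then show thesis
    using assms by (intro C) (simp add: realization_points_def)
next
  case False
  define s where "s = {v. \<alpha> v \<noteq> 0}"
  have s: "s \<in> K - C"
    using False realization_points_supp[OF assms] by (simp add: s_def)
  have "sum \<alpha> s = 1"
    using cell_finite[OF s] by (intro realization_points_sum[OF assms]) (auto simp: s_def)
  then show thesis
    using cell_finite[OF s] Min_cell_pos[OF assms s] s by (intro cell[of s]) (auto simp: s_def)
qed

lemma total_depth_nonneg:
  assumes "\<alpha> \<in> realization_points K"
  shows "0 \<le> total_depth \<alpha>"
  using assms
proof (cases rule: points_cases)
  case (cell s)
  then show ?thesis
    by (simp add: in_cell(1)[OF assms cell(2,1) order_refl])
qed (simp add: in_C)

lemma core_in_C: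
  assumes \<alpha>: "\<alpha> \<in> realization_points K" "total_depth \<alpha> < 1"
  shows "(\<lambda>v. core \<alpha> v / (1 - total_depth \<alpha>)) \<in> realization_points C"
  using \<alpha>(1)
proof (cases rule: points_cases)
  case C
  then show ?thesis by (simp add: in_C)
next
  case (cell s)
  let ?e = "Min (\<alpha> ` s)"
  note cell' = in_cell[OF \<alpha>(1) cell(2,1) order_refl]
  have fs: "finite s" "s \<noteq> {}" "card s = Suc d"
    using cell_finite[OF cell(1)] dim[OF cell(1)] by auto
  obtain x where x: "x \<in> s" "\<alpha> x = ?e"
    using Min_in[of "\<alpha> ` s"] fs by fastforce
  have "{v. core \<alpha> v / (1 - total_depth \<alpha>) \<noteq> 0} \<subseteq> s - {x}"
    using x by (auto simp: cell'(2))
  \<comment> \<open>A facet of a cell has one vertex too few to be a cell.\<close>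
  moreover have "s - {x} \<in> C"
  proof (rule ccontr)
    assume "s - {x} \<notin> C"
    then have "s - {x} \<in> K - C"
      using simplicial_complexD(2)[OF K] cell(1) by blast
    then show False
      using dim[of "s - {x}"] fs x by simp
  qed
  ultimately have supp: "{v. core \<alpha> v / (1 - total_depth \<alpha>) \<noteq> 0} \<in> C"
    using simplicial_complexD(2)[OF complex_C] by blast
  show ?thesis
  proof (rule realization_pointsI[OF _ supp fs(1)])
    show "0 \<le> core \<alpha> v / (1 - total_depth \<alpha>)" for v
      using cell(6) \<alpha>(2) by (simp add: cell'(2))
    show "core \<alpha> v / (1 - total_depth \<alpha>) = 0" if "v \<notin> s" for v
      using that by (simp add: cell'(2))
    have "(\<Sum>v\<in>s. core \<alpha> v) = (\<Sum>v\<in>s. \<alpha> v - ?e)"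
      by (intro sum.cong) (simp_all add: cell'(2))
    also have "\<dots> = 1 - total_depth \<alpha>"
      using cell(4) fs by (simp add: sum_subtractf cell'(1))
    finally show "(\<Sum>v\<in>s. core \<alpha> v / (1 - total_depth \<alpha>)) = 1"
      using \<alpha>(2) by (simp flip: sum_divide_distrib)
  qed
qed

lemma push_out_in_K:
  assumes \<alpha>: "\<alpha> \<in> realization_points K" and t: "0 \<le> t" "t \<le> 1" "t / 2 \<le> total_depth \<alpha>"
  shows "push_out t \<alpha> \<in> realization_points K"
    and "total_depth \<alpha> = t / 2 \<Longrightarrow> push_out t \<alpha> = (\<lambda>v. core \<alpha> v / (1 - total_depth \<alpha>))"
    and "push_out 0 \<alpha> = \<alpha>"
proof -
  show "push_out 0 \<alpha> = \<alpha>"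
    using \<alpha>(1)
  proof (cases rule: points_cases)
    case (cell s)
    then show ?thesis
      by (auto simp: fun_eq_iff in_cell[OF \<alpha>(1) cell(2,1) order_refl])
  qed (simp add: in_C)
  show "push_out t \<alpha> \<in> realization_points K"
    using \<alpha>(1)
  proof (cases rule: points_cases)
    case C
    then have "t = 0"
      using t in_C(1)[OF C] by simp
    then show ?thesis
      using \<open>push_out 0 \<alpha> = \<alpha>\<close> \<alpha> by simp
  next
    case (cell s)
    let ?e = "Min (\<alpha> ` s)"
    note cell' = in_cell[OF \<alpha>(1) cell(2,1) t(1)]
    have fs: "finite s" "s \<noteq> {}" "card s = Suc d"
      using cell_finite[OF cell(1)] dim[OF cell(1)] by auto
    have e: "t / (2 * real (Suc d)) \<le> ?e"
      using t(3) by (simp add: cell'(1) field_simps del: of_nat_Suc)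
    have v: "push_out t \<alpha> v = (if v \<in> s then (\<alpha> v - t / (2 * real (Suc d))) / (1 - t / 2) else 0)" for v
      using e by (simp add: cell' del: of_nat_Suc)
    have "{v. push_out t \<alpha> v \<noteq> 0} \<subseteq> s"
      by (auto simp: v)
    then have supp: "{v. push_out t \<alpha> v \<noteq> 0} \<in> K"
      using simplicial_complexD(2)[OF K] cell(1) by blast
    show ?thesis
    proof (rule realization_pointsI[OF _ supp fs(1)])
      show "0 \<le> push_out t \<alpha> u" for u
        using cell(6)[of u] e t by (auto simp: v simp del: of_nat_Suc intro!: divide_nonneg_nonneg)
      show "push_out t \<alpha> u = 0" if "u \<notin> s" for u
        using that by (simp add: v)
      have "sum (push_out t \<alpha>) s = (\<Sum>v\<in>s. (\<alpha> v - t / (2 * real (Suc d))) / (1 - t / 2))"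
        by (intro sum.cong) (simp_all add: v)
      also have "\<dots> = (1 - real (Suc d) * (t / (2 * real (Suc d)))) / (1 - t / 2)"
        using cell(4) fs by (simp add: sum_subtractf flip: sum_divide_distrib del: of_nat_Suc)
      also have "\<dots> = 1"
        using t by (simp del: of_nat_Suc)
      finally show "sum (push_out t \<alpha>) s = 1" .
    qed
  qed
  show "push_out t \<alpha> = (\<lambda>v. core \<alpha> v / (1 - total_depth \<alpha>))" if eq: "total_depth \<alpha> = t / 2"
    using \<alpha>(1)
  proof (cases rule: points_cases)
    case C
    then have "t = 0"
      using eq in_C(1)[OF C] by simp
    then show ?thesis
      using \<open>push_out 0 \<alpha> = \<alpha>\<close> in_C[OF C] by simp
  next
    case (cell s)
    note cell' = in_cell[OF \<alpha>(1) cell(2,1) t(1)]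
    have "Min (\<alpha> ` s) = t / (2 * real (Suc d))"
      using eq by (simp add: cell'(1) field_simps del: of_nat_Suc)
    then have "push_out t \<alpha> v = core \<alpha> v / (1 - t / 2)" for v
      by (simp add: cell'(3) del: of_nat_Suc)
    then show ?thesis
      by (simp add: eq fun_eq_iff)
  qed
qed

text \<open>The two formulas live on closed sets that meet where the depth is \<open>t / 2\<close>.
  There \<open>h\<close> is taken at time 0, where it is the identity, and \<open>push_out\<close>
  is the radial projection to the boundary, so they agree.\<close>

lemma continuous_map_extend_homotopy:
  assumes h: "continuous_map (prod_topology (top_of_set {0..1}) (geometric_realization C))
    (geometric_realization C) h" and h0: "\<And>x. x \<in> realization_points C \<Longrightarrow> h (0, x) = x"
  shows "continuous_map (prod_topology (top_of_set {0..1}) (geometric_realization K))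
    (geometric_realization K) (extend_homotopy h)"
proof -
  let ?X = "prod_topology (top_of_set {0..1::real}) (geometric_realization K)"
  have c: "continuous_map ?X euclideanreal (\<lambda>x. snd x v)" for v
    using continuous_map_compose[OF continuous_map_snd continuous_map_barycentric]
    by (simp add: o_def)
  have t: "continuous_map ?X euclideanreal fst"
    using continuous_map_fst continuous_map_into_fulltopology by fastforce
  have M: "continuous_map ?X euclideanreal (\<lambda>x. Min (snd x ` s))" if "s \<in> K - C" for s
    using cell_finite[OF that] continuous_map_Min[of s ?X "\<lambda>v x. snd x v"] c by auto
  have \<mu>: "continuous_map ?X euclideanreal (\<lambda>x. total_depth (snd x))"
    unfolding total_depth_def
    by (intro continuous_map_real_mult_left continuous_map_sum finite_cells M)
  have \<gamma>: "continuous_map ?X euclideanreal (\<lambda>x. core (snd x) v)" for v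
    unfolding core_def
    using finite_subset[OF _ finite_cells, of "{s \<in> K - C. v \<in> s}"] M
    by (intro continuous_map_diff continuous_map_sum c) auto
  have p: "continuous_map ?X euclideanreal (\<lambda>x. push_out (fst x) (snd x) v)" for v
    unfolding push_out_def
    using finite_subset[OF _ finite_cells, of "{s \<in> K - C. v \<in> s}"] M t
    by (intro continuous_map_real_divide continuous_map_add continuous_map_diff continuous_map_sum
        continuous_map_real_max \<gamma> t) (auto simp del: of_nat_Suc)
  note sub = continuous_map_from_subtopology
  show ?thesis
    unfolding extend_homotopy_def
  proof (rule continuous_map_cases_le[OF \<mu>])
    show "continuous_map ?X euclideanreal (\<lambda>x. fst x / 2)"
      by (intro continuous_map_real_divide t) auto
    let ?A = "{x \<in> topspace ?X. total_depth (snd x) \<le> fst x / 2}"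
    let ?g = "\<lambda>x. (fst x - 2 * total_depth (snd x), \<lambda>v. core (snd x) v / (1 - total_depth (snd x)))"
    have le: "total_depth (snd x) < 1" if "x \<in> topspace (subtopology ?X ?A)" for x
      using that by auto
    have "continuous_map (subtopology ?X ?A) (prod_topology (top_of_set {0..1}) (geometric_realization C)) ?g"
      unfolding continuous_map_pairwise o_def fst_conv snd_conv continuous_map_in_subtopology
        continuous_map_geometric_realization_iff
    proof (intro conjI allI)
      show "continuous_map (subtopology ?X ?A) euclideanreal (\<lambda>x. fst x - 2 * total_depth (snd x))"
        by (intro sub continuous_map_diff t continuous_map_real_mult_left \<mu>)
      show "(\<lambda>x. fst x - 2 * total_depth (snd x)) \<in> topspace (subtopology ?X ?A) \<rightarrow> {0..1}"
        using total_depth_nonneg by fastforce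
      show "continuous_map (subtopology ?X ?A) euclideanreal
          (\<lambda>x. core (snd x) v / (1 - total_depth (snd x)))" for v
        using le by (intro continuous_map_real_divide continuous_map_diff sub \<gamma> \<mu>) fastforce+
      show "(\<lambda>x v. core (snd x) v / (1 - total_depth (snd x)))
          \<in> topspace (subtopology ?X ?A) \<rightarrow> realization_points C"
        using core_in_C le by fastforce
    qed
    then have "continuous_map (subtopology ?X ?A) (geometric_realization C) (h \<circ> ?g)"
      using continuous_map_compose h by blast
    then show "continuous_map (subtopology ?X ?A) (geometric_realization K) (\<lambda>x. h (?g x))"
      using points_C_K by (auto simp: continuous_map_geometric_realization_iff o_def)
    show "continuous_map (subtopology ?X {x \<in> topspace ?X. fst x / 2 \<le> total_depth (snd x)})
        (geometric_realization K) (\<lambda>x. push_out (fst x) (snd x))"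
      unfolding continuous_map_geometric_realization_iff
      using p push_out_in_K(1) by (auto intro: sub)
    show "h (?g x) = push_out (fst x) (snd x)"
      if "x \<in> topspace ?X" "total_depth (snd x) = fst x / 2" for x
      using that push_out_in_K(2)[of "snd x" "fst x"] core_in_C[of "snd x"] h0 by auto
  qed
qed

section \<open>The quotient by the collapsible part\<close>

definition cell_enum :: "'a set \<Rightarrow> nat \<Rightarrow> 'a" where
  "cell_enum s = (SOME g. bij_betw g {..d} s)"

lemma cell_enum:
  assumes "s \<in> K - C"
  shows "bij_betw (cell_enum s) {..d} s"
proof -
  have "\<exists>g. bij_betw g {..d} s"
    using dim[OF assms] cell_finite[OF assms] by (intro finite_same_card_bij) auto
  then show ?thesis
    unfolding cell_enum_def by (rule someI_ex)
qed

definition cell_sphere :: "'a set \<Rightarrow> ('a \<Rightarrow> real) \<Rightarrow> nat \<Rightarrow> real" where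
  "cell_sphere s \<alpha> = simplex_sphere d (\<alpha> \<circ> cell_enum s)"

lemma cell_coordinates:
  assumes s: "s \<in> K - C" and \<alpha>: "\<alpha> \<in> realization_points (Pow s)"
  shows "\<alpha> \<circ> cell_enum s \<in> std_simplex d"
    and "depth d (\<alpha> \<circ> cell_enum s) = real (Suc d) * Min (\<alpha> ` s)"
proof -
  have "sum (\<alpha> \<circ> cell_enum s) {..d} = sum \<alpha> s"
    using sum.reindex_bij_betw[OF cell_enum[OF s], of \<alpha>] by simp
  then show "\<alpha> \<circ> cell_enum s \<in> std_simplex d"
    using \<alpha> cell_finite[OF s] by (simp add: std_simplex_def realization_points_Pow)
  show "depth d (\<alpha> \<circ> cell_enum s) = real (Suc d) * Min (\<alpha> ` s)"
    unfolding depth_def image_comp[symmetric] bij_betw_imp_surj_on[OF cell_enum[OF s]] ..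
qed

lemma continuous_map_cell_sphere:
  assumes "s \<in> K - C"
  shows "continuous_map (geometric_realization (Pow s)) (nsphere d) (cell_sphere s)"
  unfolding cell_sphere_def
  by (rule continuous_map_simplex_sphere)
    (use cell_coordinates(1)[OF assms] continuous_map_barycentric in auto)

lemma cell_subset: "s \<in> K - C \<Longrightarrow> Pow s \<subseteq> K"
  using simplicial_complexD(2)[OF K] by blast

lemma cell_sphere_base_iff:
  assumes s: "s \<in> K - C" and \<alpha>: "\<alpha> \<in> realization_points (Pow s)"
  shows "cell_sphere s \<alpha> = nsphere_base \<longleftrightarrow> {v. \<alpha> v \<noteq> 0} \<noteq> s"
proof -
  have "\<alpha> \<in> realization_points K"
    using realization_points_mono[OF cell_subset[OF s]] \<alpha> by blast
  then show ?thesis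
    using Min_cell_eq_0[OF _ s, of \<alpha>] Min_cell_pos[OF _ s, of \<alpha>]
      simplex_sphere_base_iff[OF cell_coordinates(1)[OF s \<alpha>]] cell_coordinates(2)[OF s \<alpha>]
    by (auto simp: cell_sphere_def)
qed

lemma cell_sphere_inj:
  assumes s: "s \<in> K - C" and \<alpha>: "\<alpha> \<in> realization_points (Pow s)" "{v. \<alpha> v \<noteq> 0} = s"
    and \<beta>: "\<beta> \<in> realization_points (Pow s)" "{v. \<beta> v \<noteq> 0} = s"
    and eq: "cell_sphere s \<alpha> = cell_sphere s \<beta>"
  shows "\<alpha> = \<beta>"
proof
  fix v
  have K': "\<alpha> \<in> realization_points K" "\<beta> \<in> realization_points K"
    using realization_points_mono[OF cell_subset[OF s]] \<alpha> \<beta> by auto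
  have pos: "depth d (\<alpha> \<circ> cell_enum s) > 0" "depth d (\<beta> \<circ> cell_enum s) > 0"
    using cell_coordinates(2)[OF s] \<alpha> \<beta> Min_cell_pos[OF K'(1) s] Min_cell_pos[OF K'(2) s] by auto
  show "\<alpha> v = \<beta> v"
  proof (cases "v \<in> s")
    case True
    then obtain j where "j \<le> d" "v = cell_enum s j"
      using bij_betw_imp_surj_on[OF cell_enum[OF s]] by auto
    then show ?thesis
      using simplex_sphere_inj[OF cell_coordinates(1)[OF s \<alpha>(1)] pos(1)
          cell_coordinates(1)[OF s \<beta>(1)] pos(2), of j] eq by (simp add: cell_sphere_def)
  next
    case False
    then have "\<alpha> v = 0" "\<beta> v = 0"
      using \<alpha>(2) \<beta>(2) by auto
    then show ?thesis by simp
  qed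
qed

lemma cell_sphere_surj:
  assumes s: "s \<in> K - C" and x: "x \<in> topspace (nsphere d)" "x \<noteq> nsphere_base"
  obtains \<alpha> where "\<alpha> \<in> realization_points (Pow s)" "cell_sphere s \<alpha> = x"
proof -
  obtain a where a: "a \<in> std_simplex d" "depth d a > 0" "simplex_sphere d a = x"
    using simplex_sphere_surj[OF x] .
  define \<alpha> where "\<alpha> v = (if v \<in> s then a (inv_into {..d} (cell_enum s) v) else 0)" for v
  note bij = cell_enum[OF s]
  have eq: "(\<alpha> \<circ> cell_enum s) j = a j" if "j \<in> {..d}" for j
    using that bij bij_betwE[OF bij] inv_into_f_f[OF bij_betw_imp_inj_on[OF bij]]
    by (simp add: \<alpha>_def)
  have "sum (\<alpha> \<circ> cell_enum s) {..d} = sum a {..d}"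
    by (rule sum.cong[OF refl eq])
  then have "sum \<alpha> s = sum a {..d}"
    using sum.reindex_bij_betw[OF bij, of \<alpha>] by (simp add: o_def)
  moreover have "0 \<le> \<alpha> v" for v
    using a(1) bij_betwE[OF bij_betw_inv_into[OF bij]] by (auto simp: \<alpha>_def std_simplex_def)
  ultimately have "\<alpha> \<in> realization_points (Pow s)"
    using a(1) cell_finite[OF s] by (simp add: realization_points_Pow std_simplex_def \<alpha>_def)
  moreover have "simplex_sphere d (\<alpha> \<circ> cell_enum s) = simplex_sphere d a"
  proof -
    have im: "(\<alpha> \<circ> cell_enum s) ` {..d} = a ` {..d}"
      by (rule image_cong[OF refl eq])
    have "(\<Sum>i\<le>d. ((\<alpha> \<circ> cell_enum s) i - (\<alpha> \<circ> cell_enum s) 0)\<^sup>2) = (\<Sum>i\<le>d. (a i - a 0)\<^sup>2)"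
      by (intro sum.cong refl) (simp add: eq del: o_apply)
    then show ?thesis
      unfolding simplex_sphere_def depth_def im Let_def by (auto simp: fun_eq_iff eq simp del: o_apply)
  qed
  ultimately show thesis
    using that[of \<alpha>] a(3) by (simp add: cell_sphere_def)
qed

lemma supp_proper_face:
  assumes s: "s \<in> K - C" and \<alpha>: "\<alpha> \<in> realization_points (Pow s)" "{v. \<alpha> v \<noteq> 0} \<noteq> s"
  shows "{v. \<alpha> v \<noteq> 0} \<in> C"
proof (rule ccontr)
  assume "{v. \<alpha> v \<noteq> 0} \<notin> C"
  moreover have sub: "{v. \<alpha> v \<noteq> 0} \<subset> s"
    using realization_points_supp[OF \<alpha>(1)] \<alpha>(2) by blast
  ultimately have "{v. \<alpha> v \<noteq> 0} \<in> K - C"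
    using cell_subset[OF s] by blast
  then have "card {v. \<alpha> v \<noteq> 0} = card s"
    using dim s by metis
  then show False
    using psubset_card_mono[OF _ sub] cell_finite[OF s] by simp
qed

abbreviation cell_wedge :: "nat \<Rightarrow> (nat \<times> (nat \<Rightarrow> real)) option topology" where
  "cell_wedge k \<equiv> wedge (\<lambda>_. nsphere d) (\<lambda>_. nsphere_base) {..<k}"

definition collapse_map ::
    "nat \<Rightarrow> (nat \<Rightarrow> 'a set) \<Rightarrow> ('a \<Rightarrow> real) \<Rightarrow> (nat \<times> (nat \<Rightarrow> real)) option" where
  "collapse_map k e \<alpha> = (if {v. \<alpha> v \<noteq> 0} \<in> C then None
     else wedge_map (\<lambda>_. nsphere_base)
       (inv_into {..<k} e {v. \<alpha> v \<noteq> 0}, cell_sphere {v. \<alpha> v \<noteq> 0} \<alpha>))"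

text \<open>The formula extends from the open to the closed cell, since both sides are the base
  point on proper faces. Continuity can therefore be checked on closed cells.\<close>

lemma collapse_map_cell:
  assumes e: "bij_betw e {..<k} (K - C)" and i: "i < k"
    and \<alpha>: "\<alpha> \<in> realization_points (Pow (e i))"
  shows "collapse_map k e \<alpha> = wedge_map (\<lambda>_. nsphere_base) (i, cell_sphere (e i) \<alpha>)"
proof -
  have s: "e i \<in> K - C"
    using bij_betwE[OF e] i by simp
  show ?thesis
  proof (cases "{v. \<alpha> v \<noteq> 0} = e i")
    case True
    have "inv_into {..<k} e (e i) = i"
      using inv_into_f_f[OF bij_betw_imp_inj_on[OF e]] i by simp
    then show ?thesis
      using s by (simp add: collapse_map_def True)
  next
    case False
    then have "cell_sphere (e i) \<alpha> = nsphere_base"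
      using cell_sphere_base_iff[OF s \<alpha>] by simp
    then show ?thesis
      using supp_proper_face[OF s \<alpha> False] by (simp add: collapse_map_def wedge_map_def)
  qed
qed

lemma collapse_map_C: "\<alpha> \<in> realization_points C \<Longrightarrow> collapse_map k e \<alpha> = None"
  using realization_points_supp[of \<alpha> C] by (simp add: collapse_map_def)

text \<open>For \<open>k = 0\<close> the base point has no preimage in the disjoint union; for
  positive \<open>k\<close>, \<open>wedge_map\<close> is a quotient map and closedness can be tested
  on each sphere.\<close>

lemma closedin_cell_wedge:
  assumes "0 < k"
  shows "closedin (cell_wedge k) D \<longleftrightarrow> D \<subseteq> topspace (cell_wedge k) \<and>
    (\<forall>i<k. closedin (nsphere d) {x \<in> topspace (nsphere d). wedge_map (\<lambda>_. nsphere_base) (i, x) \<in> D})"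
proof -
  have q: "quotient_map (sum_topology (\<lambda>_. nsphere d) {..<k}) (cell_wedge k) (wedge_map (\<lambda>_. nsphere_base))"
    using assms in_topspace_nsphere by (intro quotient_map_wedge[where i = 0]) auto
  let ?P = "{z \<in> topspace (sum_topology (\<lambda>_. nsphere d) {..<k}). wedge_map (\<lambda>_. nsphere_base) z \<in> D}"
  have "closedin (cell_wedge k) D \<longleftrightarrow>
      D \<subseteq> topspace (cell_wedge k) \<and> closedin (sum_topology (\<lambda>_. nsphere d) {..<k}) ?P"
    using q closedin_subset[of "cell_wedge k" D] unfolding quotient_map_closedin by blast
  also have "closedin (sum_topology (\<lambda>_. nsphere d) {..<k}) ?P \<longleftrightarrow>
      (\<forall>i<k. closedin (nsphere d) {x \<in> topspace (nsphere d). wedge_map (\<lambda>_. nsphere_base) (i, x) \<in> D})"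
    unfolding closedin_sum_topology
    by (auto simp: lessThan_iff Ball_def intro!: arg_cong2[where f = closedin])
  finally show ?thesis .
qed

text \<open>The map is a closed continuous surjection. The image of a closed set meets each sphere
  in the image of a compact part of the closed cell and, possibly, in the base point.\<close>

lemma quotient_map_collapse:
  assumes e: "bij_betw e {..<k} (K - C)" and k: "0 < k" and C0: "realization_points C \<noteq> {}"
  shows "quotient_map (geometric_realization K) (cell_wedge k) (collapse_map k e)"
proof (rule continuous_closed_imp_quotient_map)
  have e': "e i \<in> K - C" if "i < k" for i
    using bij_betwE[OF e] that by simp
  have q: "quotient_map (sum_topology (\<lambda>_. nsphere d) {..<k}) (cell_wedge k) (wedge_map (\<lambda>_. nsphere_base))"
    using k in_topspace_nsphere by (intro quotient_map_wedge[where i = 0]) auto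
  \<comment> \<open>The finite closed cover used for pasting: \<open>None\<close> stands for the
    collapsible part and \<open>Some i\<close> for the closed cell with number
    \<open>i\<close>.\<close>
  define T where "T j = (case j of None \<Rightarrow> realization_points C | Some i \<Rightarrow> realization_points (Pow (e i)))" for j
  have cover: "\<exists>j\<in>insert None (Some ` {..<k}). \<alpha> \<in> T j" if "\<alpha> \<in> realization_points K" for \<alpha>
    using that
  proof (cases rule: points_cases)
    case C
    then show ?thesis by (intro bexI[of _ None]) (auto simp: T_def)
  next
    case (cell s)
    then obtain i where i: "i < k" "s = e i"
      using bij_betw_imp_surj_on[OF e] by (metis imageE lessThan_iff)
    have "\<alpha> \<in> realization_points (Pow s)"
      using cell(2) that by (auto simp: realization_points_def)
    then show ?thesis
      using i by (intro bexI[of _ "Some i"]) (auto simp: T_def)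
  qed
  have contT: "continuous_map (subtopology (geometric_realization K) (T j)) (cell_wedge k) (collapse_map k e)"
    if j: "j \<in> insert None (Some ` {..<k})" for j
  proof (cases j)
    case None
    have "continuous_map (geometric_realization C) (cell_wedge k) (\<lambda>_. None)"
      by (simp add: topspace_wedge)
    then have "continuous_map (geometric_realization C) (cell_wedge k) (collapse_map k e)"
      by (rule continuous_map_eq) (simp add: collapse_map_C)
    then show ?thesis
      by (simp add: None T_def subtopology_geometric_realization[OF CK])
  next
    case (Some i)
    then have i: "i < k" using j by auto
    have "continuous_map (nsphere d) (sum_topology (\<lambda>_. nsphere d) {..<k}) (\<lambda>x. (i, x))"
      using continuous_map_component_injection[of i "{..<k}" "\<lambda>_. nsphere d"] i by simp
    then have "continuous_map (geometric_realization (Pow (e i))) (cell_wedge k)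
        (wedge_map (\<lambda>_. nsphere_base) \<circ> ((\<lambda>x. (i, x)) \<circ> cell_sphere (e i)))"
      using continuous_map_cell_sphere[OF e'[OF i]] quotient_imp_continuous_map[OF q]
      by (meson continuous_map_compose)
    then have "continuous_map (geometric_realization (Pow (e i))) (cell_wedge k) (collapse_map k e)"
      by (rule continuous_map_eq) (simp add: collapse_map_cell[OF e i])
    then show ?thesis
      by (simp add: Some T_def subtopology_geometric_realization[OF cell_subset[OF e'[OF i]]])
  qed
  have cloT: "closedin (geometric_realization K) (T j)"
    if j: "j \<in> insert None (Some ` {..<k})" for j
  proof (cases j)
    case None
    then show ?thesis
      by (simp add: T_def closedin_realization_points[OF complex_C CK])
  next
    case (Some i)
    then have "e i \<in> K - C"
      using j e' by auto
    then show ?thesis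
      using closedin_realization_points[OF simplicial_complex_Pow cell_subset] cell_finite
      by (simp add: T_def Some)
  qed
  have cont: "continuous_map (geometric_realization K) (cell_wedge k) (collapse_map k e)"
    by (rule pasting_lemma_closed[where I = "insert None (Some ` {..<k})" and T = T
          and f = "\<lambda>_. collapse_map k e", OF _ cloT contT]) (use cover in auto)
  then show "continuous_map (geometric_realization K) (cell_wedge k) (collapse_map k e)" .
  show "closed_map (geometric_realization K) (cell_wedge k) (collapse_map k e)"
    unfolding closed_map_def
  proof (intro allI impI)
    fix D
    assume D: "closedin (geometric_realization K) D"
    have DK: "D \<subseteq> realization_points K"
      using closedin_subset[OF D] by simp
    have im: "collapse_map k e ` D \<subseteq> topspace (cell_wedge k)"
      using cont DK continuous_map_image_subset_topspace by fastforce
    have "closedin (nsphere d) {x \<in> topspace (nsphere d).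
        wedge_map (\<lambda>_. nsphere_base) (i, x) \<in> collapse_map k e ` D}" if i: "i < k" for i
    proof -
      note s = e'[OF i]
      let ?E = "D \<inter> realization_points (Pow (e i))"
      let ?B = "if None \<in> collapse_map k e ` D then {nsphere_base} else {}"
      have "{x \<in> topspace (nsphere d). wedge_map (\<lambda>_. nsphere_base) (i, x) \<in> collapse_map k e ` D}
          = cell_sphere (e i) ` ?E \<union> ?B" (is "?L = _")
      proof (intro set_eqI iffI)
        fix x
        assume x: "x \<in> ?L"
        then obtain \<alpha> where \<alpha>: "\<alpha> \<in> D" "wedge_map (\<lambda>_. nsphere_base) (i, x) = collapse_map k e \<alpha>"
          by blast
        show "x \<in> cell_sphere (e i) ` ?E \<union> ?B"
        proof (cases "x = nsphere_base")
          case True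
          then have "None = collapse_map k e \<alpha>"
            using \<alpha>(2) by (simp add: wedge_map_def)
          then show ?thesis using \<alpha>(1) True by auto
        next
          case False
          then have *: "collapse_map k e \<alpha> = Some (i, x)"
            using \<alpha>(2) by (simp add: wedge_map_def)
          then have n: "{v. \<alpha> v \<noteq> 0} \<notin> C"
            by (auto simp: collapse_map_def)
          have "{v. \<alpha> v \<noteq> 0} \<in> K - C"
            using n realization_points_supp DK \<alpha>(1) by blast
          then obtain i' where i': "i' < k" "e i' = {v. \<alpha> v \<noteq> 0}"
            using bij_betw_imp_surj_on[OF e] by (metis imageE lessThan_iff)
          have \<alpha>': "\<alpha> \<in> realization_points (Pow (e i'))"
            using i'(2) DK \<alpha>(1) by (auto simp: realization_points_def)
          have "i' = i" "cell_sphere (e i') \<alpha> = x"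
            using * collapse_map_cell[OF e i'(1) \<alpha>'] by (auto simp: wedge_map_def split: if_splits)
          then show ?thesis using \<alpha>(1) \<alpha>' by auto
        qed
      next
        fix x
        assume "x \<in> cell_sphere (e i) ` ?E \<union> ?B"
        then consider \<alpha> where "\<alpha> \<in> ?E" "x = cell_sphere (e i) \<alpha>"
          | "x = nsphere_base" "None \<in> collapse_map k e ` D"
          by (auto split: if_splits)
        then show "x \<in> ?L"
        proof cases
          case 1
          then have "wedge_map (\<lambda>_. nsphere_base) (i, x) = collapse_map k e \<alpha>"
            using collapse_map_cell[OF e i] by simp
          moreover have "x \<in> topspace (nsphere d)"
            using 1 continuous_map_image_subset_topspace[OF continuous_map_cell_sphere[OF s]] by auto
          ultimately show ?thesis using 1 by auto
        next
          case 2
          then show ?thesis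
            using in_topspace_nsphere by (simp add: wedge_map_def)
        qed
      qed
      moreover have "closedin (nsphere d) (cell_sphere (e i) ` ?E)"
      proof (rule compactin_imp_closedin[OF Hausdorff_space_nsphere])
        have "closedin (geometric_realization (Pow (e i))) ?E"
          using closedin_subtopology_Int_closed[OF D, of "realization_points (Pow (e i))"]
          by (simp add: subtopology_geometric_realization[OF cell_subset[OF s]] Int_commute)
        moreover have "compact_space (geometric_realization (Pow (e i)))"
          using cell_finite[OF s]
          by (intro compact_space_geometric_realization) (auto simp: simplicial_complex_def finite_subset)
        ultimately have "compactin (geometric_realization (Pow (e i))) ?E"
          using closedin_compact_space by blast
        then show "compactin (nsphere d) (cell_sphere (e i) ` ?E)"
          using continuous_map_cell_sphere[OF s] image_compactin by blast
      qed
      moreover have "closedin (nsphere d) ?B"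
        using closedin_Hausdorff_singleton[OF Hausdorff_space_nsphere in_topspace_nsphere] by simp
      ultimately show ?thesis by (simp add: closedin_Un)
    qed
    then show "closedin (cell_wedge k) (collapse_map k e ` D)"
      using im unfolding closedin_cell_wedge[OF k] by blast
  qed
  show "collapse_map k e ` topspace (geometric_realization K) = topspace (cell_wedge k)"
  proof
    show "collapse_map k e ` topspace (geometric_realization K) \<subseteq> topspace (cell_wedge k)"
      using cont continuous_map_image_subset_topspace by fastforce
    have None: "None \<in> collapse_map k e ` realization_points K"
      using C0 points_C_K collapse_map_C by (metis (no_types, lifting) equals0I image_eqI subsetD)
    show "topspace (cell_wedge k) \<subseteq> collapse_map k e ` topspace (geometric_realization K)"
    proof
      fix z
      assume z: "z \<in> topspace (cell_wedge k)"
      show "z \<in> collapse_map k e ` topspace (geometric_realization K)"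
      proof (cases z)
        case (Some p)
        then obtain i x where ix: "i < k" "x \<in> topspace (nsphere d)"
          "z = wedge_map (\<lambda>_. nsphere_base) (i, x)"
          using z by (auto simp: topspace_wedge)
        then have "x \<noteq> nsphere_base"
          using Some by (auto simp: wedge_map_def)
        then obtain \<alpha> where \<alpha>: "\<alpha> \<in> realization_points (Pow (e i))" "cell_sphere (e i) \<alpha> = x"
          using cell_sphere_surj[OF e'[OF ix(1)] ix(2)] by blast
        then have "z = collapse_map k e \<alpha>"
          using collapse_map_cell[OF e ix(1)] ix(3) by simp
        then show ?thesis
          using \<alpha>(1) realization_points_mono[OF cell_subset[OF e'[OF ix(1)]]] by auto
      qed (use None in simp)
    qed
  qed
qed

lemma collapse_map_eqD:
  assumes e: "bij_betw e {..<k} (K - C)"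
    and \<alpha>: "\<alpha> \<in> realization_points K" and \<beta>: "\<beta> \<in> realization_points K"
    and eq: "collapse_map k e \<alpha> = collapse_map k e \<beta>"
  shows "\<alpha> = \<beta> \<or> \<alpha> \<in> realization_points C \<and> \<beta> \<in> realization_points C"
proof -
  have char: "\<alpha> \<in> realization_points C \<and> collapse_map k e \<alpha> = None \<or>
      (\<exists>i<k. \<alpha> \<in> realization_points (Pow (e i)) \<and> {v. \<alpha> v \<noteq> 0} = e i \<and>
        collapse_map k e \<alpha> = Some (i, cell_sphere (e i) \<alpha>))"
    if \<alpha>: "\<alpha> \<in> realization_points K" for \<alpha>
    using \<alpha>
  proof (cases rule: points_cases)
    case C
    then show ?thesis by (simp add: collapse_map_C)
  next
    case (cell s)
    then obtain i where i: "i < k" "s = e i"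
      using bij_betw_imp_surj_on[OF e] by (metis imageE lessThan_iff)
    have p: "\<alpha> \<in> realization_points (Pow (e i))"
      using cell(2) \<alpha> i by (auto simp: realization_points_def)
    have "cell_sphere (e i) \<alpha> \<noteq> nsphere_base"
      using cell_sphere_base_iff[OF _ p] cell(1,2) i by simp
    then show ?thesis
      using collapse_map_cell[OF e i(1) p] i p cell(2) by (auto simp: wedge_map_def)
  qed
  show ?thesis
  proof (cases "collapse_map k e \<alpha> = None")
    case True
    then show ?thesis
      using char[OF \<alpha>] char[OF \<beta>] eq by auto
  next
    case False
    then obtain i where i: "i < k" "\<alpha> \<in> realization_points (Pow (e i))" "{v. \<alpha> v \<noteq> 0} = e i"
      "collapse_map k e \<alpha> = Some (i, cell_sphere (e i) \<alpha>)"
      using char[OF \<alpha>] by auto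
    then obtain j where j: "\<beta> \<in> realization_points (Pow (e j))" "{v. \<beta> v \<noteq> 0} = e j"
      "collapse_map k e \<beta> = Some (j, cell_sphere (e j) \<beta>)"
      using char[OF \<beta>] eq by auto
    have "j = i" "cell_sphere (e i) \<alpha> = cell_sphere (e i) \<beta>"
      using i(4) j(3) eq by auto
    then have "\<alpha> = \<beta>"
      using cell_sphere_inj[OF _ i(2,3)] j(1,2) i(1) bij_betwE[OF e] by simp
    then show ?thesis ..
  qed
qed

theorem homotopy_equivalent_cell_wedge:
  assumes e: "bij_betw e {..<k} (K - C)" and k: "0 < k" and C0: "realization_points C \<noteq> {}"
  shows "geometric_realization K homotopy_equivalent_space cell_wedge k"
proof -
  obtain a where "homotopic_with (\<lambda>x. True) (geometric_realization C) (geometric_realization C) id (\<lambda>x. a)"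
    using contractible_space_collapsible[OF C] unfolding contractible_space_def by blast
  then obtain h where h: "continuous_map (prod_topology (top_of_set {0..1::real}) (geometric_realization C))
      (geometric_realization C) h" "\<And>x. h (0, x) = x" "\<And>x. h (1, x) = a"
    unfolding homotopic_with_def by auto
  have hC: "h (t, x) \<in> realization_points C" if "t \<in> {0..1}" "x \<in> realization_points C" for t x
    using continuous_map_image_subset_topspace[OF h(1)] that by (auto simp: image_subset_iff)
  have C: "extend_homotopy h (t, x) = h (t, x)" if "t \<in> {0..1}" "x \<in> realization_points C" for t x
    using that in_C by (simp add: extend_homotopy_def)
  have zero: "extend_homotopy h (0, x) = x" if x: "x \<in> realization_points K" for x
  proof (cases "total_depth x \<le> 0")
    case True
    then have 0: "total_depth x = 0"
      using total_depth_nonneg[OF x] by simp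
    show ?thesis
      using x
    proof (cases rule: points_cases)
      case (cell s)
      then show ?thesis
        using 0 in_cell(1)[OF x cell(2,1) order_refl] by simp
    qed (use C h(2) in simp)
  next
    case False
    then show ?thesis
      using push_out_in_K(3)[OF x, of 0] by (simp add: extend_homotopy_def)
  qed
  show ?thesis
    by (rule homotopy_equivalent_quotient[OF quotient_map_collapse[OF e k C0]
          continuous_map_extend_homotopy[OF h(1)], where S = "realization_points C" and a = a and b = None])
      (use h zero C hC collapse_map_C collapse_map_eqD[OF e] in auto)
qed

end

text \<open>There are three cases. The complex \<open>{{}}\<close> has empty realization, a
  (-1)-sphere. If everything collapses, the realization is contractible and equivalent to a wedge of
  no spheres, a point in every dimension from 0 on. Otherwise some simplex has \<open>m\<close>
  vertices, which identifies the dimension as \<open>m - 1\<close>.\<close>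

theorem spherical_imp_homotopy_equivalent:
  assumes K: "spherical m K" and "{} \<in> K"
  shows "\<exists>k. geometric_realization K homotopy_equivalent_space sphere_wedge (complex_dim K) k"
proof -
  note cx = spherical_complex[OF K]
  then have fin: "finite K" by (simp add: simplicial_complex_def)
  obtain C where C: "C \<subseteq> K" "collapsible C" "\<And>s. s \<in> K - C \<Longrightarrow> card s = m"
    using K unfolding spherical_def by blast
  have Max: "Max (card ` K) \<le> m"
    using K fin \<open>{} \<in> K\<close> by (subst Max_le_iff) (auto simp: spherical_def)
  show ?thesis
  proof (cases "K = {{}}")
    case True
    then have "topspace (geometric_realization K) = {}"
      by (auto simp: realization_points_def)
    then have "geometric_realization K = trivial_topology"
      using null_topspace_iff_trivial by blast
    then show ?thesis
      by (simp add: sphere_wedge_def complex_dim_def True homeomorphic_empty_space_eq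
          homeomorphic_imp_homotopy_equivalent_space)
  next
    case False
    then obtain s v where "s \<in> K" "v \<in> s"
      using \<open>{} \<in> K\<close> by blast
    then have v: "{v} \<in> K"
      using simplicial_complexD(2)[OF cx, of s "{v}"] by simp
    then have "card {v} \<le> Max (card ` K)"
      using Max_ge[OF finite_imageI[OF fin] imageI] by blast
    then have pos: "0 < Max (card ` K)" by simp
    \<comment> \<open>Simplices outside \<open>C\<close> have \<open>m\<close> vertices, and
      \<open>m\<close> is positive. So \<open>C\<close> is not void, which provides a vertex and
      thereby a point of its realization.\<close>
    then have "{} \<in> C"
      using C(3)[of "{}"] \<open>{} \<in> K\<close> Max by auto
    then obtain w where w: "{w} \<in> C"
      using collapsible_vertex[OF C(2)] by blast
    have C0: "realization_points C \<noteq> {}"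
    proof -
      have "(\<lambda>v. if v = w then 1 else 0) \<in> realization_points C"
        by (rule realization_pointsI[where S = "{w}"]) (use w in auto)
      then show ?thesis by blast
    qed
    show ?thesis
    proof (cases "K = C")
      case True
      have d: "\<not> complex_dim K < 0"
        using pos by (simp add: complex_dim_def)
      have "contractible_space (sphere_wedge (complex_dim K) 0)"
        using d by (intro contractible_space_subset_singleton[where a = None])
          (simp add: sphere_wedge_def topspace_wedge)
      moreover have "contractible_space (geometric_realization K)"
        using contractible_space_collapsible[OF C(2)] True by simp
      moreover have "topspace (sphere_wedge (complex_dim K) 0) \<noteq> {}"
        using d by (simp add: sphere_wedge_def topspace_wedge)
      moreover have "topspace (geometric_realization K) \<noteq> {}"
        using C0 True by simp
      ultimately show ?thesis
        using homotopy_equivalent_contractible_spaces by blast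
    next
      case False
      then obtain s where s: "s \<in> K - C" using C(1) by blast
      then have "m \<le> Max (card ` K)"
        using C(3)[OF s] fin by (intro Max_ge) auto
      then have m: "Max (card ` K) = m" using Max by simp
      obtain d where d: "m = Suc d"
        using m pos by (cases m) auto
      interpret top_cells K C d
        using cx C d by unfold_locales auto
      obtain e where e: "bij_betw e {..<card (K - C)} (K - C)"
        using ex_bij_betw_nat_finite[of "K - C"] fin by (auto simp: lessThan_atLeast0)
      have "0 < card (K - C)"
        using s fin by (auto simp: card_gt_0_iff)
      then have "geometric_realization K homotopy_equivalent_space cell_wedge (card (K - C))"
        by (rule homotopy_equivalent_cell_wedge[OF e _ C0])
      moreover have "complex_dim K = int d"
        by (simp add: complex_dim_def m d)
      ultimately show ?thesis
        by (auto simp: sphere_wedge_def)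
    qed
  qed
qed


section \<open>Order complexes\<close>

lemma order_complex_mono: "Q \<subseteq> Q' \<Longrightarrow> order_complex r Q \<subseteq> order_complex r Q'"
  by (auto simp: order_complex_def)

lemma order_complex_converse: "order_complex (r\<inverse>) Q = order_complex r Q"
  by (auto simp: order_complex_def Chains_def)

lemma simplicial_complex_order_complex:
  assumes "finite Q"
  shows "simplicial_complex (order_complex r Q)"
proof -
  have "finite (order_complex r Q)"
    by (rule finite_subset[of _ "Pow Q"]) (use assms in \<open>auto simp: order_complex_def\<close>)
  then show ?thesis
    by (auto simp: simplicial_complex_def order_complex_def Chains_def intro: finite_subset)
qed

lemma order_complex_insert:
  assumes "v \<notin> Q" "(v, v) \<in> r"
  shows "order_complex r (insert v Q) =
    order_complex r Q \<union> insert v ` order_complex r {q \<in> Q. (q, v) \<in> r \<or> (v, q) \<in> r}"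
proof (intro equalityI subsetI)
  fix X
  assume X: "X \<in> order_complex r (insert v Q)"
  show "X \<in> order_complex r Q \<union> insert v ` order_complex r {q \<in> Q. (q, v) \<in> r \<or> (v, q) \<in> r}"
  proof (cases "v \<in> X")
    case True
    then have "X - {v} \<in> order_complex r {q \<in> Q. (q, v) \<in> r \<or> (v, q) \<in> r}"
      using X by (auto simp: order_complex_def Chains_def)
    then have "insert v (X - {v}) \<in> insert v ` order_complex r {q \<in> Q. (q, v) \<in> r \<or> (v, q) \<in> r}"
      by (rule imageI)
    then show ?thesis
      using insert_Diff[OF True] by simp
  qed (use X in \<open>auto simp: order_complex_def\<close>)
next
  fix X
  assume "X \<in> order_complex r Q \<union> insert v ` order_complex r {q \<in> Q. (q, v) \<in> r \<or> (v, q) \<in> r}"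
  then show "X \<in> order_complex r (insert v Q)"
  proof
    assume "X \<in> order_complex r Q"
    then show ?thesis by (auto simp: order_complex_def)
  next
    assume "X \<in> insert v ` order_complex r {q \<in> Q. (q, v) \<in> r \<or> (v, q) \<in> r}"
    then obtain Y where "X = insert v Y" "finite Y" "Y \<subseteq> Q" "Y \<in> Chains r"
      "\<forall>q\<in>Y. (q, v) \<in> r \<or> (v, q) \<in> r"
      by (auto simp: order_complex_def)
    then show ?thesis
      using assms(2) by (auto simp: order_complex_def Chains_def)
  qed
qed

section \<open>Building a poset element by element\<close>

lemma spherical_insert_element:
  assumes "v \<notin> Q" "(v, v) \<in> r" "spherical (Suc m) (order_complex r Q)"
    and "spherical m (order_complex r {q \<in> Q. (q, v) \<in> r \<or> (v, q) \<in> r})"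
  shows "spherical (Suc m) (order_complex r (insert v Q))"
  unfolding order_complex_insert[OF assms(1,2)]
  using assms by (intro spherical_extend order_complex_mono) (auto simp: order_complex_def)

lemma spherical_order_cone:
  assumes "finite Q" "z \<in> Q" "\<And>q. q \<in> Q \<Longrightarrow> (q, z) \<in> r \<or> (z, q) \<in> r"
    and "\<And>X. X \<in> order_complex r Q \<Longrightarrow> card X \<le> m"
  shows "spherical m (order_complex r Q)"
proof -
  have Q: "insert z (Q - {z}) = Q"
    using assms(2) by blast
  have z: "(z, z) \<in> r"
    using assms(2,3) by blast
  have "{q \<in> Q - {z}. (q, z) \<in> r \<or> (z, q) \<in> r} = Q - {z}"
    using assms(3) by blast
  then have "order_complex r Q =
      order_complex r (Q - {z}) \<union> insert z ` order_complex r (Q - {z})"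
    using order_complex_insert[OF _ z, of "Q - {z}"] Q by simp
  moreover have "collapsible (order_complex r (Q - {z}) \<union> insert z ` order_complex r (Q - {z}))"
    using assms(1)
    by (intro collapsible_cone simplicial_complex_order_complex) (auto simp: order_complex_def)
  ultimately show ?thesis
    using assms(4) by (intro spherical_collapsible) simp_all
qed

text \<open>The link of \<open>v\<close> is a cone with apex \<open>z\<close>, hence collapsible.
  Its chains have at most \<open>m\<close> elements because they remain chains when \<open>v\<close>
  is added.\<close>

lemma spherical_insert_cone:
  assumes "finite Q" "v \<notin> Q" "(v, v) \<in> r" "spherical (Suc m) (order_complex r Q)"
    and "z \<in> Q" "(z, z) \<in> r" "(z, v) \<in> r \<or> (v, z) \<in> r"
    and "\<And>q. q \<in> Q \<Longrightarrow> (q, v) \<in> r \<or> (v, q) \<in> r \<Longrightarrow> (q, z) \<in> r \<or> (z, q) \<in> r"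
    and bound: "\<And>X. X \<in> order_complex r (insert v Q) \<Longrightarrow> card X \<le> Suc m"
  shows "spherical (Suc m) (order_complex r (insert v Q))"
proof (rule spherical_insert_element[OF assms(2-4)], rule spherical_order_cone[where z = z])
  fix X
  assume X: "X \<in> order_complex r {q \<in> Q. (q, v) \<in> r \<or> (v, q) \<in> r}"
  then have "insert v X \<in> order_complex r (insert v Q)"
    unfolding order_complex_insert[OF assms(2,3)] by blast
  then have "card (insert v X) \<le> Suc m"
    by (rule bound)
  moreover have "finite X" "v \<notin> X"
    using X assms(2) by (auto simp: order_complex_def)
  ultimately show "card X \<le> m"
    by simp
qed (use assms in auto)

lemma finite_partial_order_minimal:
  assumes "finite A" "A \<noteq> {}" "trans r" "antisym r"
  shows "\<exists>v\<in>A. \<forall>u\<in>A. (u, v) \<in> r \<longrightarrow> u = v"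
  using assms(1,2)
proof (induction A rule: finite_ne_induct)
  case (insert x A)
  then obtain v where v: "v \<in> A" "\<forall>u\<in>A. (u, v) \<in> r \<longrightarrow> u = v"
    by blast
  show ?case
  proof (cases "(x, v) \<in> r")
    case True
    have "u = x" if "u \<in> A" "(u, x) \<in> r" for u
      using that v True assms(3,4) by (metis antisymD transD)
    then show ?thesis by blast
  next
    case False
    then show ?thesis using v by blast
  qed
qed simp

text \<open>An element of \<open>Q - Q0\<close> can be added, smaller ones later, if the part of \<open>Q0\<close> below it has a
  maximum: its link is then a cone.\<close>

lemma spherical_dismantle_down:
  assumes po: "partial_order_on P r" and Q: "finite Q" "Q \<subseteq> P" "Q0 \<subseteq> Q"
    and "spherical (Suc m) (order_complex r Q0)"
    and "\<And>X. X \<in> order_complex r Q \<Longrightarrow> card X \<le> Suc m"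
    and "\<And>v. v \<in> Q - Q0 \<Longrightarrow> \<exists>z\<in>Q0. (z, v) \<in> r \<and> (\<forall>q\<in>Q0. (q, v) \<in> r \<longrightarrow> (q, z) \<in> r)"
  shows "spherical (Suc m) (order_complex r Q)"
  using assms
proof (induction "card (Q - Q0)" arbitrary: Q)
  case 0
  then have "Q = Q0" by auto
  then show ?case using 0 by simp
next
  case (Suc k)
  have tr: "trans r" "antisym r" "refl_on P r"
    using po by (auto simp: partial_order_on_def preorder_on_def)
  have "Q - Q0 \<noteq> {}"
    using Suc.hyps(2) by (metis card.empty nat.distinct(1))
  then have "\<exists>v\<in>Q - Q0. \<forall>u\<in>Q - Q0. (u, v) \<in> r \<longrightarrow> u = v"
    by (rule finite_partial_order_minimal[OF finite_Diff[OF Suc.prems(2)] _ tr(1,2)])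
  then obtain v where v: "v \<in> Q - Q0" "\<And>u. u \<in> Q - Q0 \<Longrightarrow> (u, v) \<in> r \<Longrightarrow> u = v"
    by meson
  obtain z where z: "z \<in> Q0" "(z, v) \<in> r" "\<And>q. q \<in> Q0 \<Longrightarrow> (q, v) \<in> r \<Longrightarrow> (q, z) \<in> r"
    using Suc.prems(7)[OF v(1)] by blast
  have iv: "insert v (Q - {v}) = Q"
    using v by blast
  have "Q - {v} - Q0 = Q - Q0 - {v}"
    by blast
  then have "card (Q - {v} - Q0) = k"
    using Suc.hyps(2) v(1) Suc.prems(2) by simp
  then have "spherical (Suc m) (order_complex r (Q - {v}))"
  proof (rule Suc.hyps(1)[OF sym po _ _ _ Suc.prems(5)])
    show "card X \<le> Suc m" if "X \<in> order_complex r (Q - {v})" for X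
      using that order_complex_mono[of "Q - {v}" Q r] Suc.prems(6) by blast
    show "\<exists>z\<in>Q0. (z, u) \<in> r \<and> (\<forall>q\<in>Q0. (q, u) \<in> r \<longrightarrow> (q, z) \<in> r)" if "u \<in> Q - {v} - Q0" for u
      by (rule Suc.prems(7)) (use that in simp)
  qed (use Suc.prems(2-4) v(1) in auto)
  then have "spherical (Suc m) (order_complex r (insert v (Q - {v})))"
  proof (rule spherical_insert_cone[rotated 3, where z = z])
    \<comment> \<open>By minimality of \<open>v\<close>, the elements below it belong to
      \<open>Q0\<close> and so lie below \<open>z\<close>; the elements above \<open>v\<close> lie
      above \<open>z\<close>.\<close>
    show "(q, z) \<in> r \<or> (z, q) \<in> r" if q: "q \<in> Q - {v}" "(q, v) \<in> r \<or> (v, q) \<in> r" for q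
      using q(2)
    proof
      assume "(q, v) \<in> r"
      then show ?thesis using v(2)[of q] z(3)[of q] q(1) by blast
    next
      assume "(v, q) \<in> r"
      then show ?thesis using z(2) tr(1) by (meson transD)
    qed
    show "card X \<le> Suc m" if "X \<in> order_complex r (insert v (Q - {v}))" for X
      using Suc.prems(6) that unfolding iv .
  qed (use Suc.prems v(1) z tr(3) in \<open>auto simp: refl_on_def\<close>)
  then show ?case
    unfolding iv .
qed

lemma spherical_dismantle_up:
  assumes "partial_order_on P r" "finite Q" "Q \<subseteq> P" "Q0 \<subseteq> Q"
    and "spherical (Suc m) (order_complex r Q0)"
    and "\<And>X. X \<in> order_complex r Q \<Longrightarrow> card X \<le> Suc m"
    and "\<And>v. v \<in> Q - Q0 \<Longrightarrow> \<exists>z\<in>Q0. (v, z) \<in> r \<and> (\<forall>q\<in>Q0. (v, q) \<in> r \<longrightarrow> (z, q) \<in> r)"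
  shows "spherical (Suc m) (order_complex r Q)"
  using spherical_dismantle_down[of P "r\<inverse>" Q Q0 m] assms
  by (simp add: order_complex_converse)

lemma order_complex_Un:
  assumes "\<And>l u. l \<in> L \<Longrightarrow> u \<in> U \<Longrightarrow> (l, u) \<in> r"
  shows "order_complex r (L \<union> U) = join (order_complex r L) (order_complex r U)"
proof (intro equalityI subsetI)
  fix X
  assume "X \<in> order_complex r (L \<union> U)"
  then have "X = (X \<inter> L) \<union> (X \<inter> U)" "X \<inter> L \<in> order_complex r L" "X \<inter> U \<in> order_complex r U"
    by (auto simp: order_complex_def Chains_def)
  then show "X \<in> join (order_complex r L) (order_complex r U)"
    using joinI by metis
next
  fix X
  assume "X \<in> join (order_complex r L) (order_complex r U)"
  then show "X \<in> order_complex r (L \<union> U)"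
    using assms by (auto elim!: joinE simp: order_complex_def Chains_def) blast+
qed

lemma spherical_order_join:
  assumes "\<And>l u. l \<in> L \<Longrightarrow> u \<in> U \<Longrightarrow> (l, u) \<in> r" "L \<inter> U = {}"
    and "spherical a (order_complex r L)" "spherical b (order_complex r U)"
  shows "spherical (a + b) (order_complex r (L \<union> U))"
proof -
  have "order_complex r (L \<union> U) = join (order_complex r L) (order_complex r U)"
    by (intro order_complex_Un assms(1))
  moreover have "spherical (a + b) (join (order_complex r L) (order_complex r U))"
    using assms(2) by (intro spherical_join assms(3,4)) (auto simp: order_complex_def)
  ultimately show ?thesis by simp
qed

lemma card_chain_le:
  assumes "X \<in> order_complex r Q" "\<And>q. q \<in> Q \<Longrightarrow> rk q \<in> {a..<a + m :: nat}"
    and "\<And>p q. p \<in> Q \<Longrightarrow> q \<in> Q \<Longrightarrow> (p, q) \<in> r \<Longrightarrow> p \<noteq> q \<Longrightarrow> rk p < rk q"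
  shows "card X \<le> m"
proof -
  have "inj_on rk X"
  proof (rule inj_onI, rule ccontr)
    fix p q
    assume "p \<in> X" "q \<in> X" "rk p = rk q" "p \<noteq> q"
    then show False
      using assms(1) assms(3)[of p q] assms(3)[of q p] by (auto simp: order_complex_def Chains_def)
  qed
  then have "card X = card (rk ` X)"
    by (simp add: card_image)
  also have "\<dots> \<le> card {a..<a + m}"
    using assms(1,2) by (intro card_mono) (auto simp: order_complex_def)
  finally show ?thesis by simp
qed

text \<open>The order complex is the barycentric subdivision of the simplex on \<open>G - R\<close>
  joined with the boundary of the simplex on \<open>R\<close>, which is a ball or, for
  \<open>R = G\<close>, a sphere. If \<open>e\<close> lies outside \<open>R\<close>, adding
  \<open>e\<close> retracts the poset upwards onto the sets that contain \<open>e\<close>, a cone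
  with apex \<open>{e}\<close>. If \<open>R = G\<close>, this fails only for \<open>G - {e}\<close>,
  which is inserted last; its link is the same poset for \<open>G - {e}\<close>.\<close>

lemma spherical_boolean:
  assumes po: "partial_order_on P r" and Q: "Q \<subseteq> P" and G: "finite G"
    and T: "bij_betw T Q {S. S \<subseteq> G \<and> S \<noteq> {} \<and> \<not> R \<subseteq> S}"
    and r: "\<And>p q. p \<in> Q \<Longrightarrow> q \<in> Q \<Longrightarrow> (p, q) \<in> r \<longleftrightarrow> T p \<subseteq> T q"
    and R: "R \<noteq> {}" "R \<subseteq> G"
  shows "spherical (card G - 1) (order_complex r Q)"
  using Q G T r R
proof (induction "card G" arbitrary: Q G R rule: less_induct)
  case less
  note Q = less.prems(1) and G = less.prems(2) and T = less.prems(3) and r = less.prems(4)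
    and R = less.prems(5,6)
  have TQ: "T q \<subseteq> G \<and> T q \<noteq> {} \<and> \<not> R \<subseteq> T q" if "q \<in> Q" for q
    using bij_betwE[OF T] that by blast
  have el: "\<exists>q\<in>Q. T q = S" if "S \<subseteq> G" "S \<noteq> {}" "\<not> R \<subseteq> S" for S
  proof -
    have "S \<in> T ` Q"
      using bij_betw_imp_surj_on[OF T] that by simp
    then show ?thesis by auto
  qed
  have inj: "p = q" if "p \<in> Q" "q \<in> Q" "T p = T q" for p q
    using bij_betw_imp_inj_on[OF T] that by (meson inj_onD)
  have finQ: "finite Q"
    using bij_betw_finite[OF T] G by simp
  have bound: "card X \<le> card G - 1" if "X \<in> order_complex r Q" for X
  proof (rule card_chain_le[OF that, where rk = "\<lambda>q. card (T q)" and a = 1])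
    fix q
    assume q: "q \<in> Q"
    then have "T q \<subset> G"
      using TQ R(2) by blast
    then have "card (T q) < card G" "card (T q) \<noteq> 0"
      using psubset_card_mono[OF G] TQ[OF q] finite_subset[OF _ G] by auto
    then show "card (T q) \<in> {1..<1 + (card G - 1)}"
      by simp
  next
    fix p q
    assume *: "p \<in> Q" "q \<in> Q" "(p, q) \<in> r" "p \<noteq> q"
    then have "T p \<subset> T q"
      using r inj by blast
    then show "card (T p) < card (T q)"
      using TQ[OF *(2)] finite_subset[OF _ G] by (intro psubset_card_mono) auto
  qed
  show ?case
  proof (cases "R = G")
    case False
    then obtain e where e: "e \<in> G" "e \<notin> R"
      using R by blast
    have "{e} \<subset> G"
      using e R by blast
    then have "card {e} < card G"
      by (rule psubset_card_mono[OF G])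
    then obtain m where m: "card G - 1 = Suc m"
      by (cases "card G - 1") auto
    have "\<not> R \<subseteq> {e}"
      using e(2) R(1) by blast
    then obtain z where z: "z \<in> Q" "T z = {e}"
      using el[of "{e}"] e by auto
    have "spherical (Suc m) (order_complex r {q \<in> Q. e \<in> T q})"
      using finQ z r bound order_complex_mono[of "{q \<in> Q. e \<in> T q}" Q r] m
      by (intro spherical_order_cone[of _ z]) auto
    then have "spherical (Suc m) (order_complex r Q)"
    proof (rule spherical_dismantle_up[OF po finQ Q, rotated])
      fix v
      assume v: "v \<in> Q - {q \<in> Q. e \<in> T q}"
      then obtain w where w: "w \<in> Q" "T w = insert e (T v)"
        using el[of "insert e (T v)"] TQ[of v] e by auto
      then show "\<exists>z\<in>{q \<in> Q. e \<in> T q}. (v, z) \<in> r \<and> (\<forall>q\<in>{q \<in> Q. e \<in> T q}. (v, q) \<in> r \<longrightarrow> (z, q) \<in> r)"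
        using v r by (intro bexI[of _ w]) auto
    qed (use bound m in auto)
    then show ?thesis using m by simp
  next
    case True
    then obtain e where e: "e \<in> G" using R by blast
    show ?thesis
    proof (cases "G = {e}")
      case True
      have "q \<notin> Q" for q
        using TQ[of q] \<open>R = G\<close> True by auto
      then have "Q = {}" by blast
      then have "order_complex r Q = {{}}"
        by (auto simp: order_complex_def Chains_def)
      then show ?thesis
        using spherical_singleton_empty True by simp
    next
      case False
      have "{e} \<subset> G"
        using e False by blast
      then have "card {e} < card G"
        by (rule psubset_card_mono[OF G])
      then obtain m where m: "card G - 1 = Suc m"
        by (cases "card G - 1") auto
      have "G \<subseteq> G - {e} \<longleftrightarrow> False" "G - {e} \<noteq> {}" "\<not> G \<subseteq> {e}"
        using e False by auto
      then obtain w where w: "w \<in> Q" "T w = G - {e}"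
        using el[of "G - {e}"] e \<open>R = G\<close> by auto
      obtain z where z: "z \<in> Q" "T z = {e}"
        using el[of "{e}"] e \<open>R = G\<close> \<open>\<not> G \<subseteq> {e}\<close> by auto
      have "spherical (Suc m) (order_complex r {q \<in> Q. e \<in> T q})"
        using finQ z r bound order_complex_mono[of "{q \<in> Q. e \<in> T q}" Q r] m
        by (intro spherical_order_cone[of _ z]) auto
      then have "spherical (Suc m) (order_complex r (Q - {w}))"
      proof (rule spherical_dismantle_up[OF po _ _ _, rotated 3])
        fix v
        assume v: "v \<in> Q - {w} - {q \<in> Q. e \<in> T q}"
        then have "T v \<noteq> G - {e}"
          using inj w by blast
        then have "\<not> R \<subseteq> insert e (T v)"
          using TQ[of v] v \<open>R = G\<close> by blast
        then obtain u where u: "u \<in> Q" "T u = insert e (T v)"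
          using el[of "insert e (T v)"] TQ[of v] v e by auto
        then show "\<exists>z\<in>{q \<in> Q. e \<in> T q}. (v, z) \<in> r \<and> (\<forall>q\<in>{q \<in> Q. e \<in> T q}. (v, q) \<in> r \<longrightarrow> (z, q) \<in> r)"
          using v r by (intro bexI[of _ u]) auto
      qed (use bound m finQ Q w order_complex_mono[of "Q - {w}" Q r] in auto)
      moreover have "spherical m (order_complex r {q \<in> Q - {w}. (q, w) \<in> r \<or> (w, q) \<in> r})"
      proof -
        have eq: "{q \<in> Q - {w}. (q, w) \<in> r \<or> (w, q) \<in> r} = {q \<in> Q. T q \<subseteq> G - {e} \<and> \<not> G - {e} \<subseteq> T q}"
        proof (intro set_eqI iffI)
          fix q
          assume q: "q \<in> {q \<in> Q - {w}. (q, w) \<in> r \<or> (w, q) \<in> r}"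
          then have "T q \<noteq> G - {e}" "T q \<subseteq> G - {e} \<or> G - {e} \<subseteq> T q"
            using inj w r by auto
          then show "q \<in> {q \<in> Q. T q \<subseteq> G - {e} \<and> \<not> G - {e} \<subseteq> T q}"
            using TQ[of q] q \<open>R = G\<close> by blast
        qed (use w r in auto)
        have "spherical (card (G - {e}) - 1) (order_complex r {q \<in> Q. T q \<subseteq> G - {e} \<and> \<not> G - {e} \<subseteq> T q})"
        proof (rule less.hyps)
          show "card (G - {e}) < card G"
            using e G by (intro psubset_card_mono) auto
          show "bij_betw T {q \<in> Q. T q \<subseteq> G - {e} \<and> \<not> G - {e} \<subseteq> T q}
              {S. S \<subseteq> G - {e} \<and> S \<noteq> {} \<and> \<not> G - {e} \<subseteq> S}"
          proof (rule bij_betw_subset[OF T])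
            show "T ` {q \<in> Q. T q \<subseteq> G - {e} \<and> \<not> G - {e} \<subseteq> T q}
                = {S. S \<subseteq> G - {e} \<and> S \<noteq> {} \<and> \<not> G - {e} \<subseteq> S}"
            proof (intro equalityI subsetI)
              fix S
              assume S: "S \<in> {S. S \<subseteq> G - {e} \<and> S \<noteq> {} \<and> \<not> G - {e} \<subseteq> S}"
              then have "S \<subseteq> G \<and> S \<noteq> {} \<and> \<not> R \<subseteq> S"
                using \<open>R = G\<close> by auto
              then obtain q where "q \<in> Q" "T q = S"
                using el[of S] by blast
              then show "S \<in> T ` {q \<in> Q. T q \<subseteq> G - {e} \<and> \<not> G - {e} \<subseteq> T q}"
                using S by blast
            qed (use TQ in auto)
          qed auto
        qed (use Q G r \<open>G - {e} \<noteq> {}\<close> in auto)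
        moreover have "card (G - {e}) - 1 = m"
          using m e G by simp
        ultimately show ?thesis
          unfolding eq by simp
      qed
      ultimately have "spherical (Suc m) (order_complex r (insert w (Q - {w})))"
        using w r by (intro spherical_insert_element) auto
      then show ?thesis
        using w m by (simp add: insert_absorb)
    qed
  qed
qed

text \<open>Lexicographic shellability in the form needed for words. The restriction of \<open>c \<in> F\<close> to
  \<open>S \<subseteq> G\<close> is \<open>res c S\<close>, so that the elements below \<open>c\<close> form a truncated Boolean lattice.\<close>

lemma spherical_shelling:
  fixes key :: "'a \<Rightarrow> nat"
  assumes po: "partial_order_on P r" and Q: "Q \<subseteq> P" "finite Q" and G: "finite G" "G \<noteq> {}"
    and F: "F \<subseteq> Q" "F \<noteq> {}" "inj_on key F"
    and res: "\<And>c S. \<lbrakk>c \<in> F; S \<subseteq> G; S \<noteq> {}\<rbrakk> \<Longrightarrow> res c S \<in> Q \<and> T (res c S) = S \<and> (res c S, c) \<in> r"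
    and below: "\<And>c p. \<lbrakk>c \<in> F; p \<in> Q; (p, c) \<in> r\<rbrakk> \<Longrightarrow> p = res c (T p) \<and> T p \<subseteq> G \<and> T p \<noteq> {}"
    and top: "\<And>c. c \<in> F \<Longrightarrow> T c = G"
    and mono: "\<And>c S S'. \<lbrakk>c \<in> F; S \<subseteq> G; S' \<subseteq> G; S \<noteq> {}; S' \<noteq> {}\<rbrakk> \<Longrightarrow>
      (res c S, res c S') \<in> r \<longleftrightarrow> S \<subseteq> S'"
    and cover: "\<And>p. p \<in> Q \<Longrightarrow> \<exists>c\<in>F. (p, c) \<in> r"
    and exchange: "\<And>c c' S. \<lbrakk>c \<in> F; c' \<in> F; key c' < key c; S \<subseteq> G; S = {} \<or> res c' S = res c S\<rbrakk> \<Longrightarrow>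
      \<exists>a\<in>G - S. \<exists>c''\<in>F. key c'' < key c \<and> (G - {a} = {} \<or> res c'' (G - {a}) = res c (G - {a}))"
  shows "spherical (card G) (order_complex r Q)"
proof -
  have tr: "trans r" "antisym r" "refl_on P r"
    using po by (auto simp: partial_order_on_def preorder_on_def)
  have refl: "(q, q) \<in> r" if "q \<in> Q" for q
    using that Q(1) tr(3) by (auto simp: refl_on_def)
  have resG: "res c G = c" if "c \<in> F" for c
    using below[OF that _ refl] top[OF that] F(1) that by auto
  have less: "T p \<subset> T q" if pq: "p \<in> Q" "q \<in> Q" "(p, q) \<in> r" "p \<noteq> q" for p q
  proof -
    obtain c where c: "c \<in> F" "(q, c) \<in> r"
      using cover[OF pq(2)] by blast
    then have "(p, c) \<in> r"
      using pq(3) tr(1) by (meson transD)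
    then show ?thesis
      using below[OF c(1) pq(1)] below[OF c(1) pq(2) c(2)] mono[OF c(1)] pq(3,4)
      by (metis psubsetI)
  qed
  have bound: "card X \<le> card G" if "X \<in> order_complex r Q" for X
  proof (rule card_chain_le[OF that, where rk = "\<lambda>q. card (T q)" and a = 1])
    fix q
    assume q: "q \<in> Q"
    then obtain c where "c \<in> F" "(q, c) \<in> r"
      using cover by blast
    then have "T q \<subseteq> G" "T q \<noteq> {}"
      using below q by auto
    then show "card (T q) \<in> {1..<1 + card G}"
      using card_mono[OF G(1)] finite_subset[OF _ G(1)] by (auto simp: Suc_le_eq card_gt_0_iff less_Suc_eq_le)
  next
    fix p q
    assume *: "p \<in> Q" "q \<in> Q" "(p, q) \<in> r" "p \<noteq> q"
    obtain c where "c \<in> F" "(q, c) \<in> r"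
      using cover *(2) by blast
    then have "finite (T q)"
      using below *(2) finite_subset[OF _ G(1)] by blast
    then show "card (T p) < card (T q)"
      using less[OF *] by (intro psubset_card_mono)
  qed
  obtain m where m: "card G = Suc m"
    using G by (metis card_gt_0_iff gr0_implies_Suc)
  \<comment> \<open>The lower set generated by the facets in \<open>A\<close>; the induction runs
    over the initial segments of \<open>F\<close> with respect to \<open>key\<close>.\<close>
  define D where "D A = {p \<in> Q. \<exists>c\<in>A. (p, c) \<in> r}" for A
  have finF: "finite F"
    using F(1) Q(2) finite_subset by blast
  have "spherical (Suc m) (order_complex r (D A))"
    if "A \<subseteq> F" "A \<noteq> {}" "\<And>c c'. c \<in> A \<Longrightarrow> c' \<in> F \<Longrightarrow> key c' < key c \<Longrightarrow> c' \<in> A" for A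
    using that
  proof (induction "card A" arbitrary: A)
    case 0
    then show ?case
      using finite_subset[OF _ finF] by auto
  next
    case (Suc k)
    have finA: "finite A"
      using Suc.prems(1) finF finite_subset by blast
    have "Max (key ` A) \<in> key ` A"
      using finA Suc.prems(2) by (intro Max_in) auto
    then obtain c where c: "c \<in> A" "Max (key ` A) = key c"
      by (rule imageE)
    have cmax: "key c' \<le> key c" if "c' \<in> A" for c'
      using Max_ge[OF finite_imageI[OF finA] imageI[OF that], of key] c(2) by simp
    have cF: "c \<in> F" "c \<in> Q"
      using c(1) Suc.prems(1) F(1) by auto
    let ?A = "A - {c}"
    have A: "c' \<in> ?A \<longleftrightarrow> c' \<in> F \<and> key c' < key c" for c'
    proof
      assume c': "c' \<in> ?A"
      then have "key c' \<noteq> key c"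
        using inj_onD[OF F(3), of c' c] cF(1) Suc.prems(1) by auto
      then show "c' \<in> F \<and> key c' < key c"
        using c' cmax[of c'] Suc.prems(1) by auto
    next
      assume "c' \<in> F \<and> key c' < key c"
      then show "c' \<in> ?A"
        using Suc.prems(3)[OF c(1), of c'] by auto
    qed
    have finD: "finite (D B)" "D B \<subseteq> Q" "D B \<subseteq> P" for B
      using Q by (auto simp: D_def)
    have boundD: "card X \<le> Suc m" if "X \<in> order_complex r (D B)" for X B
      using bound order_complex_mono[OF finD(2)[of B], of r] that m by auto
    show ?case
    proof (cases "?A = {}")
      case True
      then have "A = {c}" using c by blast
      then have DA: "D A = {p \<in> Q. (p, c) \<in> r}"
        by (auto simp: D_def)
      show ?thesis
      proof (rule spherical_order_cone[OF finD(1) _ _ boundD])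
        show "c \<in> D A"
          unfolding DA using cF(2) refl by simp
        show "(q, c) \<in> r \<or> (c, q) \<in> r" if "q \<in> D A" for q
          using that unfolding DA by simp
      qed
    next
      case False
      have IH: "spherical (Suc m) (order_complex r (D ?A))"
        using Suc.hyps(2) Suc.prems c False A finA by (intro Suc.hyps(1)) auto
      \<comment> \<open>These are the elements of \<open>G\<close> whose removal takes
        \<open>c\<close> into an earlier facet. By the exchange property, a restriction to
        \<open>S\<close> is already present exactly if \<open>S\<close> misses one of them, so the
        old part below \<open>c\<close> is a poset as in \<open>spherical_boolean\<close>. The empty
        restriction is not an element of the poset but counts as shared.\<close>
      define R where "R = {a \<in> G. \<exists>c''\<in>F. key c'' < key c \<and>
        (G - {a} = {} \<or> res c'' (G - {a}) = res c (G - {a}))}"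
      have R: "R \<subseteq> G"
        by (auto simp: R_def)
      obtain c' where "c' \<in> ?A" using False by blast
      then have "R \<noteq> {}"
        using exchange[OF cF(1), of c' "{}"] A by (auto simp: R_def)
      have key: "res c S \<in> D ?A \<longleftrightarrow> \<not> R \<subseteq> S" if S: "S \<subseteq> G" "S \<noteq> {}" for S
      proof
        assume "res c S \<in> D ?A"
        then obtain c' where c': "c' \<in> ?A" "(res c S, c') \<in> r"
          by (auto simp: D_def)
        then have "c' \<in> F" "key c' < key c"
          using A by auto
        then have "res c' S = res c S"
          using below[of c' "res c S"] c'(2) res[OF cF(1) S] by auto
        then show "\<not> R \<subseteq> S"
          using exchange[OF cF(1) \<open>c' \<in> F\<close> \<open>key c' < key c\<close> S(1)] by (auto simp: R_def)
      next
        assume "\<not> R \<subseteq> S"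
        then obtain a c'' where a: "a \<in> G" "a \<notin> S" "c'' \<in> F" "key c'' < key c"
          "G - {a} = {} \<or> res c'' (G - {a}) = res c (G - {a})"
          by (auto simp: R_def)
        have ne: "S \<subseteq> G - {a}" "G - {a} \<noteq> {}"
          using S a(2) by auto
        have "(res c S, res c (G - {a})) \<in> r"
          using mono[OF cF(1) S(1) _ S(2) ne(2)] ne(1) by blast
        moreover have "(res c (G - {a}), c'') \<in> r"
          using res[OF a(3) _ ne(2)] a(5) ne(2) by auto
        ultimately have "(res c S, c'') \<in> r"
          using tr(1) by (meson transD)
        then show "res c S \<in> D ?A"
          using res[OF cF(1) S] A a(3,4) by (auto simp: D_def)
      qed
      have down: "p \<in> D ?A" if "p \<in> Q" "(p, q) \<in> r" "q \<in> D ?A" for p q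
        using that tr(1) unfolding D_def by (auto dest: transD)
      have "c \<notin> D ?A"
        using key[OF order_refl G(2)] resG[OF cF(1)] R by auto
      let ?L = "{q \<in> D ?A. (q, c) \<in> r \<or> (c, q) \<in> r}"
      have L: "?L = {q \<in> D ?A. (q, c) \<in> r}"
        using down[OF cF(2)] \<open>c \<notin> D ?A\<close> by blast
      have TL: "q = res c (T q) \<and> T q \<subseteq> G \<and> T q \<noteq> {}" if "q \<in> ?L" for q
        using that below[OF cF(1)] finD(2) unfolding L by blast
      have "spherical (card G - 1) (order_complex r ?L)"
      proof (rule spherical_boolean[OF po _ G(1) _ _ \<open>R \<noteq> {}\<close> R, where T = T])
        show "bij_betw T ?L {S. S \<subseteq> G \<and> S \<noteq> {} \<and> \<not> R \<subseteq> S}"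
          unfolding bij_betw_def
        proof
          show "inj_on T ?L"
          proof (rule inj_onI)
            fix p q
            assume p: "p \<in> ?L" and q: "q \<in> ?L" and "T p = T q"
            then have "res c (T p) = res c (T q)"
              by (simp only:)
            then show "p = q"
              using conjunct1[OF TL[OF p]] conjunct1[OF TL[OF q]] by metis
          qed
          show "T ` ?L = {S. S \<subseteq> G \<and> S \<noteq> {} \<and> \<not> R \<subseteq> S}"
          proof (intro equalityI subsetI)
            fix S
            assume S: "S \<in> {S. S \<subseteq> G \<and> S \<noteq> {} \<and> \<not> R \<subseteq> S}"
            then have S': "res c S \<in> ?L" "T (res c S) = S"
              using key[of S] res[OF cF(1), of S] by auto
            show "S \<in> T ` ?L"
              using imageI[OF S'(1), of T] unfolding S'(2) .
          next
            fix S
            assume "S \<in> T ` ?L"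
            then obtain q where q: "q \<in> ?L" "S = T q" by blast
            then show "S \<in> {S. S \<subseteq> G \<and> S \<noteq> {} \<and> \<not> R \<subseteq> S}"
              using TL[OF q(1)] key[of "T q"] by auto
          qed
        qed
        show "(p, q) \<in> r \<longleftrightarrow> T p \<subseteq> T q" if "p \<in> ?L" "q \<in> ?L" for p q
          using mono[OF cF(1), of "T p" "T q"] TL[OF that(1)] TL[OF that(2)] by simp
      qed (use finD(3) in auto)
      then have 1: "spherical (Suc m) (order_complex r (insert c (D ?A)))"
        using IH \<open>c \<notin> D ?A\<close> refl[OF cF(2)] m by (intro spherical_insert_element) auto
      \<comment> \<open>With \<open>c\<close> in place, the remaining new elements lie below
        \<open>c\<close> and below no old element. Thus \<open>c\<close> is the only element above
        them so far, and they can be added by dismantling upwards.\<close>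
      have sub: "insert c (D ?A) \<subseteq> D A"
        using c cF refl by (auto simp: D_def)
      show ?thesis
      proof (rule spherical_dismantle_up[OF po finD(1,3) sub 1 boundD])
        fix v
        assume v: "v \<in> D A - insert c (D ?A)"
        then have "(v, c) \<in> r" "v \<in> Q"
          by (auto simp: D_def)
        moreover have "(v, q) \<notin> r" if "q \<in> D ?A" for q
          using v down[of v q] that \<open>v \<in> Q\<close> by blast
        ultimately show "\<exists>z\<in>insert c (D ?A). (v, z) \<in> r \<and> (\<forall>q\<in>insert c (D ?A). (v, q) \<in> r \<longrightarrow> (z, q) \<in> r)"
          using refl[OF cF(2)] by blast
      qed
    qed
  qed
  from this[OF order_refl F(2)] have "spherical (Suc m) (order_complex r (D F))"
    by blast
  moreover have "D F = Q"
    using cover by (auto simp: D_def)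
  ultimately show ?thesis
    using m by simp
qed

text \<open>A maximal element \<open>b\<close> of \<open>Q - A\<close> is added last. Below it lies
  nothing of \<open>A\<close>, and strictly above it nothing but elements of \<open>A\<close>; hence
  its link is the join of the two parts, with sizes adding up to \<open>m\<close>.\<close>

lemma spherical_extend_lower:
  assumes po: "partial_order_on P r" and "finite Q" "Q \<subseteq> P" "A \<subseteq> Q"
    and "\<And>b q. b \<in> Q - A \<Longrightarrow> q \<in> A \<Longrightarrow> (q, b) \<notin> r"
    and "spherical (Suc m) (order_complex r A)"
    and "\<And>b. b \<in> Q - A \<Longrightarrow> \<exists>i j. i + j = m \<and>
      spherical i (order_complex r {q \<in> Q. (q, b) \<in> r \<and> q \<noteq> b}) \<and>
      spherical j (order_complex r {q \<in> A. (b, q) \<in> r})"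
  shows "spherical (Suc m) (order_complex r Q)"
  using assms
proof (induction "card (Q - A)" arbitrary: Q)
  case 0
  then have "Q = A" by auto
  then show ?case using 0 by simp
next
  case (Suc k)
  have tr: "trans r" "antisym r" "refl_on P r"
    using po by (auto simp: partial_order_on_def preorder_on_def)
  have "Q - A \<noteq> {}"
    using Suc.hyps(2) by (metis card.empty nat.distinct(1))
  then have "\<exists>b\<in>Q - A. \<forall>u\<in>Q - A. (u, b) \<in> r\<inverse> \<longrightarrow> u = b"
    using tr(1,2) by (intro finite_partial_order_minimal finite_Diff Suc.prems(2)) auto
  then obtain b where b: "b \<in> Q - A" "\<And>u. u \<in> Q - A \<Longrightarrow> (b, u) \<in> r \<Longrightarrow> u = b"
    unfolding converse_iff by meson
  obtain i j where ij: "i + j = m"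
    "spherical i (order_complex r {q \<in> Q. (q, b) \<in> r \<and> q \<noteq> b})"
    "spherical j (order_complex r {q \<in> A. (b, q) \<in> r})"
    using Suc.prems(7)[OF b(1)] by blast
  have "Q - {b} - A = Q - A - {b}"
    by blast
  then have "card (Q - {b} - A) = k"
    using Suc.hyps(2) b(1) Suc.prems(2) by simp
  then have "spherical (Suc m) (order_complex r (Q - {b}))"
  proof (rule Suc.hyps(1)[OF sym po])
    fix b'
    assume b': "b' \<in> Q - {b} - A"
    then have "{q \<in> Q - {b}. (q, b') \<in> r \<and> q \<noteq> b'} = {q \<in> Q. (q, b') \<in> r \<and> q \<noteq> b'}"
      using b(2)[of b'] by blast
    then show "\<exists>i j. i + j = m \<and>
      spherical i (order_complex r {q \<in> Q - {b}. (q, b') \<in> r \<and> q \<noteq> b'}) \<and>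
      spherical j (order_complex r {q \<in> A. (b', q) \<in> r})"
      using Suc.prems(7)[of b'] b' by simp
  qed (use Suc.prems b in auto)
  moreover have "spherical m (order_complex r {q \<in> Q - {b}. (q, b) \<in> r \<or> (b, q) \<in> r})"
  proof -
    have "{q \<in> Q - {b}. (q, b) \<in> r \<or> (b, q) \<in> r}
        = {q \<in> Q. (q, b) \<in> r \<and> q \<noteq> b} \<union> {q \<in> A. (b, q) \<in> r}"
      using b Suc.prems(4) by blast
    moreover have "{q \<in> Q. (q, b) \<in> r \<and> q \<noteq> b} \<inter> {q \<in> A. (b, q) \<in> r} = {}"
      using Suc.prems(5)[OF b(1)] by blast
    ultimately show ?thesis
      using spherical_order_join[OF _ _ ij(2,3)] ij(1) tr(1) by (auto dest: transD)
  qed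
  ultimately have "spherical (Suc m) (order_complex r (insert b (Q - {b})))"
    using b(1) Suc.prems(3) tr(3) by (intro spherical_insert_element) (auto simp: refl_on_def)
  then show ?case
    using b(1) by (simp add: insert_absorb)
qed


section \<open>Shuffles of cyclic words\<close>

definition label_order :: "(nat \<Rightarrow> nat) \<Rightarrow> nat rel" where
  "label_order \<kappa> = {(x, y). \<kappa> x < \<kappa> y \<or> \<kappa> x = \<kappa> y \<and> x < y}"

lemma label_order_iff: "(x, y) \<in> label_order \<kappa> \<longleftrightarrow> \<kappa> x < \<kappa> y \<or> \<kappa> x = \<kappa> y \<and> x < y"
  by (simp add: label_order_def)

lemma rotate_hd_eq:
  assumes "distinct xs" "hd (rotate k xs) = hd xs"
  shows "rotate k xs = xs"
proof (cases "xs = []")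
  case False
  then have "xs ! (k mod length xs) = xs ! 0"
    using assms(2) hd_rotate_conv_nth[OF False, of k] hd_conv_nth[OF False] by simp
  then have "k mod length xs = 0"
    using assms(1) False by (simp add: nth_eq_iff_index_eq)
  then show ?thesis
    by (metis rotate0 rotate_conv_mod id_apply)
qed simp

lemma lexord_first_difference:
  assumes "(xs, ys) \<in> lexord r" "length xs = length ys"
  obtains p x u y v where "xs = p @ x # u" "ys = p @ y # v" "(x, y) \<in> r"
proof -
  from assms(1) consider a v where "ys = xs @ a # v"
    | p x y u v where "(x, y) \<in> r" "xs = p @ x # u" "ys = p @ y # v"
    unfolding lexord_def by blast
  then show thesis
  proof cases
    case 1
    then show ?thesis using assms(2) by simp
  next
    case 2
    then show ?thesis using that by blast
  qed
qed

text \<open>\<open>A a\<close> is the cycle with label \<open>a\<close>, written from its least element. Only the labels in \<open>G\<close>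
  may be moved.\<close>

locale cyclic_words =
  fixes \<kappa> :: "nat \<Rightarrow> nat" and A :: "nat \<Rightarrow> nat list" and G :: "nat set"
  assumes A: "\<And>a. a \<in> G \<Longrightarrow> distinct (A a) \<and> A a \<noteq> []"
    and A_label: "\<And>a x. a \<in> G \<Longrightarrow> x \<in> set (A a) \<Longrightarrow> \<kappa> x = a"
    and A_least: "\<And>a x. a \<in> G \<Longrightarrow> x \<in> set (A a) \<Longrightarrow> hd (A a) \<le> x"
begin

text \<open>\<open>move a c\<close> is the lexicographically least word in which the cycle \<open>A a\<close> is removed from \<open>c\<close> and
  shuffled in again.\<close>

definition move :: "nat \<Rightarrow> nat list \<Rightarrow> nat list" where
  "move a c = takeWhile (\<lambda>x. \<kappa> x < a) (filter (\<lambda>x. \<kappa> x \<noteq> a) c) @ A a @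
     dropWhile (\<lambda>x. \<kappa> x < a) (filter (\<lambda>x. \<kappa> x \<noteq> a) c)"

lemma hd_A: "a \<in> G \<Longrightarrow> \<kappa> (hd (A a)) = a"
  using A A_label by (meson list.set_sel(1))

lemma filter_A: "a \<in> G \<Longrightarrow> filter (\<lambda>x. \<kappa> x = a) (A a) = A a" "a \<in> G \<Longrightarrow> filter (\<lambda>x. \<kappa> x \<noteq> a) (A a) = []"
  using A_label by (auto simp: filter_id_conv filter_empty_conv)

lemma filter_move_other:
  assumes "a \<in> G" "\<And>x. \<kappa> x = a \<Longrightarrow> \<not> Q x"
  shows "filter Q (move a c) = filter Q c"
proof -
  have "filter Q (A a) = []"
    using A_label[OF assms(1)] assms(2) by (auto simp: filter_empty_conv)
  then have "filter Q (move a c) = filter Q (filter (\<lambda>x. \<kappa> x \<noteq> a) c)"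
    unfolding move_def by (metis append_Nil filter_append takeWhile_dropWhile_id)
  also have "\<dots> = filter Q c"
    using assms(2) by (auto intro!: filter_cong)
  finally show ?thesis .
qed

lemma filter_move_same: "a \<in> G \<Longrightarrow> filter (\<lambda>x. \<kappa> x = a) (move a c) = A a"
proof -
  assume a: "a \<in> G"
  have "filter (\<lambda>x. \<kappa> x = a) (takeWhile Q (filter (\<lambda>x. \<kappa> x \<noteq> a) c)) = []"
    "filter (\<lambda>x. \<kappa> x = a) (dropWhile Q (filter (\<lambda>x. \<kappa> x \<noteq> a) c)) = []" for Q
    by (auto simp: filter_empty_conv dest!: set_takeWhileD set_dropWhileD)
  then show ?thesis
    by (simp add: move_def filter_A(1)[OF a])
qed

lemma move_form:
  assumes "a \<in> G" "move a c = c"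
  obtains l m where "c = l @ A a @ m" "\<And>z. z \<in> set l \<Longrightarrow> \<kappa> z < a" "m = [] \<or> a < \<kappa> (hd m)"
    "\<And>z. z \<in> set m \<Longrightarrow> \<kappa> z \<noteq> a"
proof
  let ?w = "filter (\<lambda>x. \<kappa> x \<noteq> a) c"
  let ?m = "dropWhile (\<lambda>x. \<kappa> x < a) ?w"
  show "c = takeWhile (\<lambda>x. \<kappa> x < a) ?w @ A a @ ?m"
    using assms(2) by (simp add: move_def)
  show ne: "\<kappa> z \<noteq> a" if "z \<in> set ?m" for z
    using set_dropWhileD[OF that] by simp
  show "?m = [] \<or> a < \<kappa> (hd ?m)"
    using hd_dropWhile[of "\<lambda>x. \<kappa> x < a" ?w] ne[of "hd ?m"] by force
  show "\<kappa> z < a" if "z \<in> set (takeWhile (\<lambda>x. \<kappa> x < a) ?w)" for z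
    using set_takeWhileD[OF that] by simp
qed

text \<open>The words first differ, if at all, at the first letter of \<open>zs\<close> whose label
  is not \<open>a\<close>. By assumption this letter has a larger label, while the rearranged word
  still has a letter labelled \<open>a\<close> there.\<close>

lemma block_first_le:
  assumes "filter (\<lambda>x. \<kappa> x \<noteq> a) zs = [] \<or> a < \<kappa> (hd (filter (\<lambda>x. \<kappa> x \<noteq> a) zs))"
  shows "filter (\<lambda>x. \<kappa> x = a) zs @ filter (\<lambda>x. \<kappa> x \<noteq> a) zs = zs \<or>
    (filter (\<lambda>x. \<kappa> x = a) zs @ filter (\<lambda>x. \<kappa> x \<noteq> a) zs, zs) \<in> lexord (label_order \<kappa>)"
  using assms
proof (induction zs)
  case (Cons z zs)
  show ?case
  proof (cases "\<kappa> z = a")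
    case True
    then show ?thesis using Cons by auto
  next
    case False
    then have "a < \<kappa> z" using Cons.prems by simp
    show ?thesis
    proof (cases "filter (\<lambda>x. \<kappa> x = a) zs")
      case Nil
      then have "filter (\<lambda>x. \<kappa> x \<noteq> a) zs = zs"
        by (auto simp: filter_empty_conv filter_id_conv)
      then show ?thesis using Nil False by simp
    next
      case (Cons y ys)
      then have "\<kappa> y = a"
        by (auto simp: filter_eq_Cons_iff)
      then show ?thesis
        using Cons False \<open>a < \<kappa> z\<close> by (simp add: label_order_iff)
    qed
  qed
qed simp

text \<open>Leading letters with labels below \<open>a\<close> stay in place. At the first other
  letter \<open>x\<close>, the new word has a smaller label, or the same label and
  \<open>hd (A a)\<close>, the least letter of its cycle. If \<open>x\<close> is that letter as
  well, the rotation is trivial and \<open>block_first_le\<close> compares the rest.\<close>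

lemma move_le:
  assumes a: "a \<in> G" and "filter (\<lambda>x. \<kappa> x = a) c = rotate k (A a)"
  shows "move a c = c \<or> (move a c, c) \<in> lexord (label_order \<kappa>)"
  using assms(2)
proof (induction c)
  case Nil
  then show ?case using A[OF a] by (metis filter.simps(1) rotate_is_Nil_conv)
next
  case (Cons x xs)
  obtain h t where ht: "A a = h # t"
    using A[OF a] by (cases "A a") auto
  then have h: "\<kappa> h = a"
    using hd_A[OF a] by simp
  consider "\<kappa> x < a" | "a < \<kappa> x" | "\<kappa> x = a" by linarith
  then show ?case
  proof cases
    case 1
    then show ?thesis
      using Cons by (auto simp: move_def)
  next
    case 2
    then show ?thesis
      using h by (simp add: move_def ht label_order_iff)
  next
    case 3
    let ?w = "filter (\<lambda>x. \<kappa> x \<noteq> a) xs"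
    show ?thesis
    proof (cases "takeWhile (\<lambda>x. \<kappa> x < a) ?w")
      case (Cons y ys)
      then have "\<kappa> y < a"
        by (metis list.set_intros(1) set_takeWhileD)
      then show ?thesis
        using Cons 3 by (simp add: move_def label_order_iff)
    next
      case Nil
      then have w: "dropWhile (\<lambda>x. \<kappa> x < a) ?w = ?w" "?w = [] \<or> \<not> \<kappa> (hd ?w) < a"
        by (cases ?w; auto split: if_splits)+
      have "?w = [] \<or> \<kappa> (hd ?w) \<noteq> a"
        using hd_in_set[of ?w] by auto
      then have w': "filter (\<lambda>y. \<kappa> y \<noteq> a) (x # xs) = [] \<or> a < \<kappa> (hd (filter (\<lambda>y. \<kappa> y \<noteq> a) (x # xs)))"
        using w(2) 3 by auto
      have m: "move a (x # xs) = A a @ filter (\<lambda>y. \<kappa> y \<noteq> a) (x # xs)"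
        using Nil w(1) 3 by (simp add: move_def)
      show ?thesis
      proof (cases "x = h")
        case True
        have "x # filter (\<lambda>x. \<kappa> x = a) xs = rotate k (A a)"
          using Cons.prems 3 by simp
        then have "hd (rotate k (A a)) = hd (A a)"
          using True ht by (metis list.sel(1))
        then have "filter (\<lambda>y. \<kappa> y = a) (x # xs) = A a"
          using rotate_hd_eq A[OF a] Cons.prems by metis
        then show ?thesis
          using block_first_le[OF w'] m by simp
      next
        case False
        have "x \<in> set (rotate k (A a))"
          using Cons.prems 3 by (metis (mono_tags, lifting) filter.simps(2) list.set_intros(1))
        then have "h < x"
          using A_least[OF a, of x] ht False by simp
        then show ?thesis
          using m ht h 3 by (simp add: label_order_iff)
      qed
    qed
  qed
qed

text \<open>In a word fixed by \<open>move g\<close>, the letters labelled \<open>g\<close> form one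
  block. The successor of such a letter is in the block or is the first letter after it, whose label
  is larger.\<close>

lemma no_descent:
  assumes g: "g \<in> G" "move g c = c" and c: "c = p @ z # z' # q" and z: "\<kappa> z = g"
  shows "g \<le> \<kappa> z'"
proof -
  obtain l m where lm: "c = l @ A g @ m" "\<And>z. z \<in> set l \<Longrightarrow> \<kappa> z < g" "m = [] \<or> g < \<kappa> (hd m)"
    "\<And>z. z \<in> set m \<Longrightarrow> \<kappa> z \<noteq> g"
    using move_form[OF g] by blast
  have eq: "p @ z # z' # q = l @ A g @ m"
    using c lm(1) by simp
  obtain us where us: "A g @ m = us @ z # z' # q"
  proof -
    from eq consider us where "p = l @ us" "us @ z # z' # q = A g @ m"
      | us where "p @ us = l" "z # z' # q = us @ A g @ m"
      by (auto simp: append_eq_append_conv2)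
    then show thesis
    proof cases
      case 1
      then show ?thesis using that by metis
    next
      case 2
      then have "us = []"
        using lm(2)[of z] z by (cases us) auto
      then show ?thesis using 2 that[of "[]"] by simp
    qed
  qed
  then consider vs where "A g = us @ vs" "vs @ m = z # z' # q"
    | vs where "A g @ vs = us" "m = vs @ z # z' # q"
    by (auto simp: append_eq_append_conv2)
  then show ?thesis
  proof cases
    case 1
    show ?thesis
    proof (cases vs)
      case Nil
      then show ?thesis using 1 lm(4)[of z] z by simp
    next
      case (Cons v vs')
      show ?thesis
      proof (cases vs')
        case Nil
        then have "hd m = z'" "m \<noteq> []" using 1 Cons by auto
        then show ?thesis using lm(3) by auto
      next
        case (Cons v' vs'')
        then have "z' \<in> set (A g)"
          using 1 \<open>vs = v # vs'\<close> by auto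
        then show ?thesis using A_label[OF g(1)] by simp
      qed
    qed
  next
    case 2
    then show ?thesis using lm(4)[of z] z by simp
  qed
qed

lemma ascending:
  assumes "\<And>z. z \<in> set (x # q) \<Longrightarrow> \<kappa> z \<in> G \<and> move (\<kappa> z) c = c" "c = p @ x # q @ y # v"
  shows "\<kappa> x \<le> \<kappa> y"
  using assms
proof (induction q arbitrary: p x)
  case Nil
  then show ?case
    using no_descent[of "\<kappa> x" c p x y v] by simp
next
  case (Cons z q)
  have "\<kappa> x \<le> \<kappa> z"
    using no_descent[of "\<kappa> x" c p x z "q @ y # v"] Cons.prems by simp
  also have "\<kappa> z \<le> \<kappa> y"
    using Cons.IH[of z "p @ [x]"] Cons.prems by simp
  finally show ?case .
qed

text \<open>If \<open>c\<close> is fixed by all \<open>move a\<close> with \<open>a \<in> G - S\<close>, then each of these cycles is a contiguous block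
  that follows smaller and precedes larger labels, which makes \<open>c\<close> the least word with its restriction
  to the remaining letters.\<close>

lemma exchange:
  assumes c: "distinct c" and c': "distinct c'" "set c' = set c"
    and rot: "\<And>a. a \<in> G \<Longrightarrow> \<exists>k. filter (\<lambda>x. \<kappa> x = a) c' = rotate k (A a)"
    and less: "(c', c) \<in> lexord (label_order \<kappa>)"
    and keep: "filter (\<lambda>x. \<kappa> x \<notin> G - S) c' = filter (\<lambda>x. \<kappa> x \<notin> G - S) c"
  shows "\<exists>a\<in>G - S. move a c \<noteq> c"
proof (rule ccontr)
  assume "\<not> ?thesis"
  then have fixed: "move a c = c" if "a \<in> G - S" for a
    using that by blast
  have "length c' = length c"
    using c c' distinct_card by metis
  then obtain p y v x u where d: "c' = p @ y # v" "c = p @ x # u" "(y, x) \<in> label_order \<kappa>"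
    using lexord_first_difference[OF less] by metis
  have "x \<noteq> y"
    using d(3) by (auto simp: label_order_iff)
  have "y \<notin> set p"
    using c'(1) d(1) by simp
  have keep': "filter (\<lambda>x. \<kappa> x \<notin> G - S) (y # v) = filter (\<lambda>x. \<kappa> x \<notin> G - S) (x # u)"
    using keep d(1,2) by simp
  have le: "\<kappa> y \<le> \<kappa> x"
    using d(3) by (auto simp: label_order_iff)
  show False
  proof (cases "\<kappa> y \<in> G - S")
    case True
    note fy = fixed[OF True]
    have yG: "\<kappa> y \<in> G"
      using True by simp
    have "y \<in> set c"
      using c'(2) d(1) by auto
    show False
    proof (cases "\<kappa> y = \<kappa> x")
      case True
      \<comment> \<open>The cycle of \<open>y\<close> is read in \<open>c\<close> from its least
        letter and in \<open>c'\<close> as a rotation. If the common prefix already contains a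
        letter of it, the rotation is trivial and the words agree here; otherwise \<open>x\<close>
        is the least letter and \<open>y\<close> cannot precede it.\<close>
      let ?f = "filter (\<lambda>z. \<kappa> z = \<kappa> y)"
      obtain k where k: "?f c' = rotate k (A (\<kappa> y))"
        using rot[OF yG] by blast
      have A: "?f c = A (\<kappa> y)"
        using filter_move_same[OF yG, of c] fy by simp
      have fc: "?f c = ?f p @ x # ?f u" "?f c' = ?f p @ y # ?f v"
        using d True by simp_all
      show False
      proof (cases "?f p = []")
        case True
        then have "hd (A (\<kappa> y)) = x"
          using A fc(1) by (metis append_Nil list.sel(1))
        moreover have "y \<in> set (A (\<kappa> y))"
          using k fc(2) by (metis in_set_conv_decomp set_rotate)
        ultimately have "x \<le> y"
          using A_least[OF yG] by metis
        then show False
          using d(3) \<open>\<kappa> y = \<kappa> x\<close> by (simp add: label_order_iff)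
      next
        case False
        then have "hd (rotate k (A (\<kappa> y))) = hd (A (\<kappa> y))"
          using k A fc by (metis hd_append2)
        then have "rotate k (A (\<kappa> y)) = A (\<kappa> y)"
          using cyclic_words.A[OF cyclic_words_axioms yG] by (intro rotate_hd_eq) auto
        then show False
          using k A fc \<open>x \<noteq> y\<close> by (metis same_append_eq list.inject)
      qed
    next
      case False
      then have lt: "\<kappa> y < \<kappa> x" using le by simp
      \<comment> \<open>The label of \<open>x\<close> is too large for \<open>x\<close> to occur in
        the block of \<open>y\<close> or before it. So this block lies in the common prefix, and
        \<open>c'\<close> would contain \<open>y\<close> twice.\<close>
      obtain l m where lm: "c = l @ A (\<kappa> y) @ m" "\<And>z. z \<in> set l \<Longrightarrow> \<kappa> z < \<kappa> y"
        "m = [] \<or> \<kappa> y < \<kappa> (hd m)" "\<And>z. z \<in> set m \<Longrightarrow> \<kappa> z \<noteq> \<kappa> y"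
        using move_form[OF yG fy] by blast
      have yA: "y \<in> set (A (\<kappa> y))"
        using \<open>y \<in> set c\<close> lm by auto
      have x: "x \<notin> set (l @ A (\<kappa> y))"
        using lm(2)[of x] A_label[of "\<kappa> y" x] True lt by auto
      have "p @ x # u = (l @ A (\<kappa> y)) @ m"
        using d(2) lm(1) by simp
      then consider us where "p = (l @ A (\<kappa> y)) @ us"
        | us where "p @ us = l @ A (\<kappa> y)" "x # u = us @ m"
        unfolding append_eq_append_conv2[of p] by blast
      then show False
      proof cases
        case 1
        then show False using yA \<open>y \<notin> set p\<close> by simp
      next
        case 2
        then have "us = []"
          using x by (cases us) (auto simp flip: 2(1))
        then show False using 2 yA \<open>y \<notin> set p\<close> by auto
      qed
    qed
  next
    case False
    then have y: "filter (\<lambda>x. \<kappa> x \<notin> G - S) (x # u) = y # filter (\<lambda>x. \<kappa> x \<notin> G - S) v"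
      using keep' by simp
    \<comment> \<open>Both remainders have \<open>y\<close> as their first kept letter, so in
      \<open>c\<close> all letters from \<open>x\<close> up to \<open>y\<close> belong to fixed
      blocks and their labels ascend to that of \<open>y\<close>. Then \<open>x\<close> and
      \<open>y\<close> have the same label, although only \<open>y\<close> is kept.\<close>
    have xG: "\<kappa> x \<in> G - S"
      using y \<open>x \<noteq> y\<close> by (auto split: if_splits)
    obtain q w where qw: "x # u = q @ y # w" "\<forall>z\<in>set q. \<not> \<kappa> z \<notin> G - S"
      using filter_eq_ConsD[OF y] by blast
    then obtain q' where q': "q = x # q'"
      using \<open>x \<noteq> y\<close> by (cases q) auto
    have "\<kappa> x \<le> \<kappa> y"
    proof (rule ascending)
      show "\<kappa> z \<in> G \<and> move (\<kappa> z) c = c" if "z \<in> set (x # q')" for z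
        using qw(2) q' that fixed by auto
      show "c = p @ x # q' @ y # w"
        using d(2) qw(1) q' by simp
    qed
    then show False
      using le d(3) xG False by (metis le_antisym)
  qed
qed

end


section \<open>Cycles and refinement of permutations\<close>

definition cyc :: "('a \<Rightarrow> 'a) \<Rightarrow> 'a \<Rightarrow> 'a list" where
  "cyc p x = support p x"

lemma cyc_eqI:
  assumes "distinct xs" "map p xs = rotate1 xs" "xs \<noteq> []"
  shows "cyc p (hd xs) = xs"
proof -
  let ?k = "length xs" and ?x = "hd xs"
  have step: "p (xs ! i) = xs ! (Suc i mod ?k)" if "i < ?k" for i
    using arg_cong[OF assms(2), of "\<lambda>l. l ! i"] that by (simp add: nth_rotate1)
  have pow: "(p ^^ i) ?x = xs ! (i mod ?k)" for i
  proof (induction i)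
    case 0
    then show ?case using assms(3) by (simp add: hd_conv_nth)
  next
    case (Suc i)
    then show ?case
      using step[of "i mod ?k"] assms(3) by (simp add: mod_Suc_eq)
  qed
  have "(p ^^ i) ?x = ?x \<longleftrightarrow> ?k dvd i" for i
    unfolding pow using nth_eq_iff_index_eq[OF assms(1), of "i mod ?k" 0] assms(3)
    by (simp add: hd_conv_nth dvd_eq_mod_eq_0)
  then have "least_power p ?x = ?k"
    unfolding least_power_def using assms(3)
    by (intro Least_equality) (auto dest: dvd_imp_le)
  then show ?thesis
    by (intro nth_equalityI) (simp_all add: cyc_def pow)
qed

lemma map_cyc:
  assumes "permutation p"
  shows "map p (cyc p x) = rotate1 (cyc p x)"
proof -
  have "map p (cyc p x) = map (cycle_of_list (cyc p x)) (cyc p x)"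
    using cycle_restrict[OF assms] unfolding cyc_def by (intro map_cong refl) auto
  also have "\<dots> = rotate1 (cyc p x)"
    using cyclic_rotation[OF cycle_of_permutation[OF assms], of 1 x] by (simp add: cyc_def)
  finally show ?thesis .
qed

lemma distinct_cyc: "permutation p \<Longrightarrow> distinct (cyc p x)"
  unfolding cyc_def by (rule cycle_of_permutation)

lemma cyc_Cons: "permutation p \<Longrightarrow> \<exists>l. cyc p x = x # l"
  using least_power_of_permutation(2)[of p x] by (simp add: cyc_def upt_conv_Cons)

lemma hd_cyc [simp]: "permutation p \<Longrightarrow> hd (cyc p x) = x"
  using cyc_Cons[of p x] by auto

lemma cyc_nonempty [simp]: "permutation p \<Longrightarrow> cyc p x \<noteq> []"
  using cyc_Cons[of p x] by auto

lemma in_cyc [simp]: "permutation p \<Longrightarrow> x \<in> set (cyc p x)"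
  using cyc_Cons[of p x] by auto

lemma apply_eq_hd_rotate1: "permutation p \<Longrightarrow> p x = hd (rotate1 (cyc p x))"
  using map_cyc[of p x] cyc_Cons[of p x] by (metis list.map_sel(1) hd_cyc cyc_nonempty)

lemma map_rotated:
  assumes "map p (l1 @ l2) = rotate1 (l1 @ l2)"
  shows "map p (l2 @ l1) = rotate1 (l2 @ l1)"
proof -
  have "l2 @ l1 = rotate (length l1) (l1 @ l2)"
    by (simp add: rotate_append)
  then show ?thesis
    using assms by (metis rotate1_rotate_swap rotate_map)
qed

text \<open>Rotating \<open>as\<close> so that it starts at \<open>x\<close> rotates the filtered
  list correspondingly; both lists are then cycles read from \<open>x\<close>.\<close>

lemma cyc_filter:
  assumes "distinct as" "map p as = rotate1 as" "map q (filter Q as) = rotate1 (filter Q as)"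
    and "x \<in> set as" "Q x"
  shows "cyc q x = filter Q (cyc p x)"
proof -
  obtain l1 l2 where as: "as = l1 @ x # l2"
    using assms(4) by (metis split_list)
  have "map p ((x # l2) @ l1) = rotate1 ((x # l2) @ l1)"
    using assms(2) unfolding as by (rule map_rotated)
  then have 1: "cyc p x = (x # l2) @ l1"
    using cyc_eqI[of "(x # l2) @ l1" p] assms(1) as by auto
  have "map q (filter Q (x # l2) @ filter Q l1) = rotate1 (filter Q (x # l2) @ filter Q l1)"
    using assms(3) unfolding as filter_append by (rule map_rotated)
  then have "cyc q x = filter Q (x # l2) @ filter Q l1"
    using cyc_eqI[of "filter Q (x # l2) @ filter Q l1" q] assms(1,5) as by auto
  then show ?thesis
    using 1 by simp
qed

lemma set_cyc_eq:
  assumes p: "permutation p" and y: "y \<in> set (cyc p x)"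
  shows "set (cyc p y) = set (cyc p x)"
proof -
  obtain l1 l2 where l: "cyc p x = l1 @ y # l2"
    using y by (metis split_list)
  have "map p ((y # l2) @ l1) = rotate1 ((y # l2) @ l1)"
    using map_cyc[OF p, of x] unfolding l by (rule map_rotated)
  then have "cyc p y = (y # l2) @ l1"
    using cyc_eqI[of "(y # l2) @ l1" p] distinct_cyc[OF p, of x] l by auto
  then show ?thesis
    using l by auto
qed

lemma in_cyc_iff:
  assumes "permutation p"
  shows "y \<in> set (cyc p x) \<longleftrightarrow> set (cyc p y) = set (cyc p x)"
  using set_cyc_eq[OF assms] in_cyc[OF assms] by metis

lemma cyc_cong:
  assumes "permutation p" "\<And>y. y \<in> set (cyc p x) \<Longrightarrow> q y = p y"
  shows "cyc q x = cyc p x"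
proof -
  have "map q (cyc p x) = rotate1 (cyc p x)"
    using map_cyc[OF assms(1)] assms(2) by (metis map_cong)
  then show ?thesis
    using cyc_eqI[of "cyc p x" q] distinct_cyc[OF assms(1)] assms(1) by simp
qed

lemma cyc_fixed: "p x = x \<Longrightarrow> cyc p x = [x]"
  using cyc_eqI[of "[x]" p] by simp

lemma permutes_imp_permutation: "p permutes {1..n::nat} \<Longrightarrow> permutation p"
  using permutation_permutes by blast

lemma cyc_subset:
  assumes "p permutes {1..n::nat}" "x \<in> {1..n}"
  shows "set (cyc p x) \<subseteq> {1..n}"
proof
  fix y
  assume "y \<in> set (cyc p x)"
  then obtain i where "y = (p ^^ i) x"
    by (auto simp: cyc_def)
  then show "y \<in> {1..n}"
    using permutes_in_image[OF permutes_funpow[OF assms(1)]] assms(2) by blast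
qed

section \<open>Refinement of permutations\<close>

definition refines :: "('a \<Rightarrow> 'a) \<Rightarrow> ('a \<Rightarrow> 'a) \<Rightarrow> bool" where
  "refines p q \<longleftrightarrow> (\<forall>x. \<exists>Q. cyc p x = filter Q (cyc q x))"

lemma refines_refl: "refines p p"
  unfolding refines_def by (intro allI exI[of _ "\<lambda>_. True"]) simp

lemma refines_trans: "refines p q \<Longrightarrow> refines q r \<Longrightarrow> refines p r"
  unfolding refines_def by (metis filter_filter)

lemma refines_subset: "refines p q \<Longrightarrow> set (cyc p x) \<subseteq> set (cyc q x)"
  unfolding refines_def by (metis filter_is_subset)

lemma refines_filter: "refines p q \<Longrightarrow> cyc p x = filter (\<lambda>y. y \<in> set (cyc p x)) (cyc q x)"
proof -
  assume "refines p q"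
  then obtain Q where Q: "cyc p x = filter Q (cyc q x)"
    unfolding refines_def by blast
  have "filter Q (cyc q x) = filter (\<lambda>y. y \<in> set (filter Q (cyc q x))) (cyc q x)"
    by (intro filter_cong) auto
  then show ?thesis
    unfolding Q .
qed

lemma eq_of_cyc_eq:
  assumes "permutation p" "permutation q" "\<And>x. cyc p x = cyc q x"
  shows "p = q"
  using assms apply_eq_hd_rotate1 by (metis ext)

lemma refines_set_eq_imp_eq:
  assumes "permutation p" "permutation q" "refines p q" "\<And>x. set (cyc q x) \<subseteq> set (cyc p x)"
  shows "p = q"
proof (rule eq_of_cyc_eq[OF assms(1,2)])
  fix x
  show "cyc p x = cyc q x"
    using refines_filter[OF assms(3), of x] assms(4)[of x] by (metis filter_True subsetD)
qed

lemma refines_antisym: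
  "\<lbrakk>permutation p; permutation q; refines p q; refines q p\<rbrakk> \<Longrightarrow> p = q"
  using refines_set_eq_imp_eq refines_subset by metis

definition recycle :: "('a \<Rightarrow> 'a) \<Rightarrow> 'a list \<Rightarrow> 'a \<Rightarrow> 'a" where
  "recycle t cs x = (if x \<in> set cs then cycle_of_list cs x else t x)"

lemma map_cycle_of_list: "distinct cs \<Longrightarrow> map (cycle_of_list cs) cs = rotate1 cs"
  using cyclic_rotation[of cs 1] by simp

lemma map_recycle: "distinct cs \<Longrightarrow> map (recycle t cs) cs = rotate1 cs"
  using map_cycle_of_list by (metis (mono_tags, lifting) map_cong recycle_def)

text \<open>An injective map that sends the finite set of letters of \<open>cs\<close> into itself
  permutes it, so \<open>t\<close> also preserves the complement. The old map outside and the new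
  cycle inside therefore cannot collide.\<close>

lemma recycle_permutes:
  assumes t: "t permutes {1..n::nat}" and cs: "distinct cs" "set cs \<subseteq> {1..n}" "t ` set cs \<subseteq> set cs"
  shows "recycle t cs permutes {1..n}"
proof (rule bij_imp_permutes)
  have c: "cycle_of_list cs permutes set cs"
    by (rule cycle_permutes)
  have tcs: "t ` set cs = set cs"
    using cs(3) permutes_inj[OF t] by (intro endo_inj_surj) (auto intro: inj_on_subset)
  have in_cs: "recycle t cs x \<in> set cs \<longleftrightarrow> x \<in> set cs" for x
  proof (cases "x \<in> set cs")
    case True
    then show ?thesis
      using permutes_in_image[OF c] by (simp add: recycle_def)
  next
    case False
    then have "t x \<notin> set cs"
      using tcs permutes_inj[OF t] by (metis (no_types, lifting) imageE injD)
    then show ?thesis using False by (simp add: recycle_def)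
  qed
  have inj: "inj_on (recycle t cs) {1..n}"
  proof (rule inj_onI)
    fix x y
    assume "recycle t cs x = recycle t cs y"
    then show "x = y"
      using in_cs[of x] in_cs[of y] permutes_inj[OF c] permutes_inj[OF t]
      by (auto simp: recycle_def inj_eq split: if_splits)
  qed
  moreover have "recycle t cs ` {1..n} \<subseteq> {1..n}"
  proof
    fix y
    assume "y \<in> recycle t cs ` {1..n}"
    then obtain x where "x \<in> {1..n}" "y = recycle t cs x" by blast
    then show "y \<in> {1..n}"
      using in_cs[of x] cs(2) permutes_in_image[OF t, of x] by (cases "x \<in> set cs") (auto simp: recycle_def)
  qed
  ultimately show "bij_betw (recycle t cs) {1..n} {1..n}"
    by (simp add: bij_betw_def endo_inj_surj)
  show "recycle t cs x = x" if "x \<notin> {1..n}" for x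
    using that cs(2) permutes_not_in[OF t that] by (auto simp: recycle_def)
qed

lemma closed_cyc_disjoint:
  assumes t: "permutation t" and "\<And>y. y \<in> B \<Longrightarrow> set (cyc t y) \<subseteq> B" "x \<notin> B"
  shows "set (cyc t x) \<inter> B = {}"
proof -
  have False if "y \<in> set (cyc t x)" "y \<in> B" for y
    using assms(2)[OF that(2)] set_cyc_eq[OF t that(1)] in_cyc[OF t, of x] assms(3) by blast
  then show ?thesis by blast
qed

lemma closed_cyc_image:
  assumes t: "permutation t" and "\<And>y. y \<in> B \<Longrightarrow> set (cyc t y) \<subseteq> B"
  shows "t ` B \<subseteq> B"
proof
  fix z
  assume "z \<in> t ` B"
  then obtain y where "y \<in> B" "z = t y" by blast
  moreover have "t y \<in> set (cyc t y)"
    using map_cyc[OF t, of y] in_cyc[OF t, of y] by (metis image_eqI list.set_map set_rotate1)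
  ultimately show "z \<in> B"
    using assms(2) by blast
qed

lemma cyc_recycle_outside:
  assumes t: "permutation t" and cs: "\<And>y. y \<in> set cs \<Longrightarrow> set (cyc t y) \<subseteq> set cs" and x: "x \<notin> set cs"
  shows "cyc (recycle t cs) x = cyc t x"
proof (rule cyc_cong[OF t])
  fix y
  assume "y \<in> set (cyc t x)"
  then have "y \<notin> set cs"
    using closed_cyc_disjoint[OF t cs x] by blast
  then show "recycle t cs y = t y"
    by (simp add: recycle_def)
qed

section \<open>The order of the poset of permutations\<close>

definition perm_order :: "nat \<Rightarrow> (nat \<Rightarrow> nat) rel" where
  "perm_order n = {(p, q). p permutes {1..n} \<and> q permutes {1..n} \<and> refines p q}"

lemma partial_order_perm_order: "partial_order_on {p. p permutes {1..n}} (perm_order n)"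
  unfolding partial_order_on_def preorder_on_def
proof (intro conjI)
  show "refl_on {p. p permutes {1..n}} (perm_order n)"
    by (auto simp: refl_on_def perm_order_def refines_refl)
  show "perm_order n \<subseteq> {p. p permutes {1..n}} \<times> {p. p permutes {1..n}}"
    by (auto simp: perm_order_def)
  show "trans (perm_order n)"
    by (auto simp: trans_def perm_order_def intro: refines_trans)
  show "antisym (perm_order n)"
    unfolding antisym_def perm_order_def
    using refines_antisym permutes_imp_permutation by blast
qed

section \<open>Splitting of a cycle\<close>

lemma nths_Compl_eq_filter:
  assumes "distinct as"
  shows "nths as ({..<length as} - S) = filter (\<lambda>x. x \<notin> set (nths as S)) as"
proof -
  have "x \<in> set (nths as ({..<length as} - S)) \<longleftrightarrow> x \<notin> set (nths as S)" if "x \<in> set as" for x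
    using that assms by (auto simp: set_nths in_set_conv_nth nth_eq_iff_index_eq)
  then have "filter (\<lambda>x. x \<notin> set (nths as S)) as
      = filter (\<lambda>x. x \<in> set (nths as ({..<length as} - S))) as"
    by (intro filter_cong) auto
  also have "\<dots> = nths as ({..<length as} - S)"
    by (rule filter_in_nths[OF assms])
  finally show ?thesis ..
qed

text \<open>Both parts are filtered versions of the cycle that the new permutation rotates, so
  \<open>cyc_filter\<close> applies to each; points off the cycle never enter it.\<close>

lemma splits_to_cyc:
  assumes \<sigma>: "permutation \<sigma>" and as: "distinct as" "map \<sigma> as = rotate1 as"
    and \<tau>: "\<And>x. \<tau> x = (if x \<in> set (nths as S) then cycle_of_list (nths as S) x
      else if x \<in> set (nths as ({..<length as} - S)) then cycle_of_list (nths as ({..<length as} - S)) x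
      else \<sigma> x)"
  shows "x \<notin> set as \<Longrightarrow> cyc \<tau> x = cyc \<sigma> x"
    and "x \<in> set (nths as S) \<Longrightarrow> cyc \<tau> x = filter (\<lambda>y. y \<in> set (nths as S)) (cyc \<sigma> x)"
    and "x \<in> set as - set (nths as S) \<Longrightarrow> cyc \<tau> x = filter (\<lambda>y. y \<notin> set (nths as S)) (cyc \<sigma> x)"
proof -
  let ?A = "nths as S" and ?B = "nths as ({..<length as} - S)"
  have B: "?B = filter (\<lambda>x. x \<notin> set ?A) as"
    by (rule nths_Compl_eq_filter[OF as(1)])
  have A: "?A = filter (\<lambda>x. x \<in> set ?A) as"
    by (rule filter_in_nths[OF as(1), symmetric])
  have sub: "set ?A \<subseteq> set as" "set ?B \<subseteq> set as"
    by (rule set_nths_subset)+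
  have mA: "map \<tau> ?A = rotate1 ?A"
  proof -
    have "map \<tau> ?A = map (cycle_of_list ?A) ?A"
      by (intro map_cong refl) (simp add: \<tau>)
    then show ?thesis
      using map_cycle_of_list[OF distinct_nthsI[OF as(1)]] by simp
  qed
  have mB: "map \<tau> ?B = rotate1 ?B"
  proof -
    have "map \<tau> ?B = map (cycle_of_list ?B) ?B"
    proof (intro map_cong refl)
      fix x
      assume x: "x \<in> set ?B"
      then have "x \<notin> set ?A" by (subst (asm) B) simp
      then show "\<tau> x = cycle_of_list ?B x"
        using x by (simp add: \<tau>)
    qed
    then show ?thesis
      using map_cycle_of_list[OF distinct_nthsI[OF as(1)]] by simp
  qed
  show "cyc \<tau> x = filter (\<lambda>y. y \<in> set ?A) (cyc \<sigma> x)" if "x \<in> set ?A"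
    using that sub(1) mA by (intro cyc_filter[OF as]) (auto simp: A[symmetric])
  show "cyc \<tau> x = filter (\<lambda>y. y \<notin> set ?A) (cyc \<sigma> x)" if "x \<in> set as - set ?A"
    using that mB unfolding B by (intro cyc_filter[OF as]) auto
  show "cyc \<tau> x = cyc \<sigma> x" if x: "x \<notin> set as"
  proof (rule cyc_cong[OF \<sigma>])
    have closed: "set (cyc \<sigma> y) \<subseteq> set as" if "y \<in> set as" for y
    proof -
      obtain l1 l2 where l: "as = l1 @ y # l2"
        using \<open>y \<in> set as\<close> by (metis split_list)
      have "map \<sigma> ((y # l2) @ l1) = rotate1 ((y # l2) @ l1)"
        using as(2) unfolding l by (rule map_rotated)
      then have "cyc \<sigma> y = (y # l2) @ l1"
        using cyc_eqI[of "(y # l2) @ l1" \<sigma>] as(1) l by auto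
      then show ?thesis
        using l by auto
    qed
    fix y
    assume "y \<in> set (cyc \<sigma> x)"
    then have "y \<notin> set as"
      using closed_cyc_disjoint[OF \<sigma> closed x] by blast
    then show "\<tau> y = \<sigma> y"
      using sub by (auto simp: \<tau>)
  qed
qed

lemma splits_to_imp_refines:
  assumes "permutation \<sigma>" "splits_to \<sigma> \<tau>"
  shows "refines \<tau> \<sigma>"
proof -
  obtain as S where *: "distinct as" "map \<sigma> as = rotate1 as"
    "\<And>x. \<tau> x = (if x \<in> set (nths as S) then cycle_of_list (nths as S) x
      else if x \<in> set (nths as ({..<length as} - S)) then cycle_of_list (nths as ({..<length as} - S)) x
      else \<sigma> x)"
    using assms(2) unfolding splits_to_def by auto
  note cyc = splits_to_cyc[OF assms(1) *]
  have "\<exists>Q. cyc \<tau> x = filter Q (cyc \<sigma> x)" for x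
    using cyc[of x] refines_refl[of \<sigma>] unfolding refines_def by (metis DiffI)
  then show ?thesis
    unfolding refines_def by blast
qed

text \<open>Some cycle of \<tau> is properly contained in a cycle of \<sigma>; splitting it off
  gives \<rho>. The other cycles of \<tau> are disjoint from it and so are still sublists of what
  remains.\<close>

lemma refines_imp_splits_to:
  assumes \<tau>: "\<tau> permutes {1..n}" and \<sigma>: "\<sigma> permutes {1..n}" and r: "refines \<tau> \<sigma>" and ne: "\<tau> \<noteq> \<sigma>"
  obtains \<rho> where "\<rho> permutes {1..n}" "refines \<tau> \<rho>" "splits_to \<sigma> \<rho>" "\<rho> \<noteq> \<sigma>"
proof -
  note p\<tau> = permutes_imp_permutation[OF \<tau>] and p\<sigma> = permutes_imp_permutation[OF \<sigma>]
  obtain x where x: "\<not> set (cyc \<sigma> x) \<subseteq> set (cyc \<tau> x)"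
    using refines_set_eq_imp_eq[OF p\<tau> p\<sigma> r] ne by blast
  define as where "as = cyc \<sigma> x"
  define Ob where "Ob = set (cyc \<tau> x)"
  define S where "S = {i. i < length as \<and> as ! i \<in> Ob}"
  have as: "distinct as" "map \<sigma> as = rotate1 as"
    using distinct_cyc[OF p\<sigma>] map_cyc[OF p\<sigma>] by (simp_all add: as_def)
  have A: "nths as S = filter (\<lambda>y. y \<in> Ob) as"
    by (simp add: S_def filter_eq_nths)
  have OA: "Ob \<subseteq> set as"
    using refines_subset[OF r] by (simp add: Ob_def as_def)
  then have setA: "set (nths as S) = Ob"
    by (auto simp: A)
  define B where "B = nths as ({..<length as} - S)"
  have B: "B = filter (\<lambda>y. y \<notin> Ob) as"
    unfolding B_def nths_Compl_eq_filter[OF as(1)] setA ..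
  define \<rho> where "\<rho> = recycle (recycle \<sigma> B) (nths as S)"
  have \<rho>: "\<rho> y = (if y \<in> set (nths as S) then cycle_of_list (nths as S) y
      else if y \<in> set B then cycle_of_list B y else \<sigma> y)" for y
    by (simp add: \<rho>_def recycle_def)
  have x_in: "x \<in> Ob" "x \<in> set as"
    using in_cyc[OF p\<tau>, of x] OA by (auto simp: Ob_def)
  obtain z where z: "z \<in> set as" "z \<notin> Ob"
    using x by (auto simp: as_def Ob_def)
  have ne_S: "S \<noteq> {}" "S \<subset> {..<length as}"
    using x_in z by (auto simp: S_def in_set_conv_nth)
  have split: "splits_to \<sigma> \<rho>"
    unfolding splits_to_def using as ne_S \<rho> by (intro exI[of _ as] exI[of _ S]) (auto simp: B_def)
  note cyc = splits_to_cyc[OF p\<sigma> as, of \<rho> S, folded B_def, OF \<rho>, unfolded setA]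
  have perm: "\<rho> permutes {1..n}"
  proof -
    have inn: "set as \<subseteq> {1..n}"
    proof (cases "x \<in> {1..n}")
      case True
      then show ?thesis using cyc_subset[OF \<sigma>] by (simp add: as_def)
    next
      case False
      then have "as = [x]"
        using cyc_fixed[of \<sigma> x] permutes_not_in[OF \<sigma> False] by (simp add: as_def)
      then show ?thesis
        using x_in z by simp
    qed
    have im: "\<rho> ` set as \<subseteq> set as"
    proof
      fix y
      assume "y \<in> \<rho> ` set as"
      then obtain u where u: "u \<in> set as" "y = \<rho> u" by blast
      have "u \<in> set (nths as S) \<or> u \<in> set B"
        using u(1) setA B by auto
      then have "y \<in> set (nths as S) \<or> y \<in> set B"
        unfolding u(2) \<rho> using permutes_in_image[OF cycle_permutes, of "nths as S" u]
          permutes_in_image[OF cycle_permutes, of B u] by auto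
      then show "y \<in> set as"
        using setA OA B by auto
    qed
    have out: "\<rho> y = \<sigma> y" if "y \<notin> set as" for y
      using that set_nths_subset unfolding \<rho> B_def by (metis subsetD)
    have \<sigma>as: "\<sigma> ` set as = set as"
      using as(2) by (metis list.set_map set_rotate1)
    have inj_as: "inj_on \<rho> (set as)"
    proof (rule inj_onI)
      fix u v
      assume uv: "u \<in> set as" "v \<in> set as" "\<rho> u = \<rho> v"
      have c: "cycle_of_list (nths as S) w \<in> Ob \<longleftrightarrow> w \<in> Ob" "cycle_of_list B w \<in> set B \<longleftrightarrow> w \<in> set B" for w
        using permutes_in_image[OF cycle_permutes, of "nths as S" w] permutes_in_image[OF cycle_permutes, of B w]
        by (simp_all add: setA)
      have d: "w \<in> Ob \<longleftrightarrow> w \<notin> set B" if "w \<in> set as" for w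
        using that B by auto
      show "u = v"
        using uv c[of u] c[of v] d[of u] d[of v] d[of "\<rho> u"] im \<rho>[of u] \<rho>[of v] setA
          permutes_inj[OF cycle_permutes, of "nths as S"] permutes_inj[OF cycle_permutes, of B]
        by (auto simp: inj_eq split: if_splits)
    qed
    show ?thesis
    proof (rule bij_imp_permutes)
      have "inj_on \<rho> {1..n}"
      proof (rule inj_onI)
        fix u v
        assume uv: "\<rho> u = \<rho> v"
        have s: "\<sigma> w \<in> set as \<longleftrightarrow> w \<in> set as" for w
          using \<sigma>as permutes_inj[OF \<sigma>] by (metis inj_image_mem_iff)
        show "u = v"
        proof (cases "u \<in> set as"; cases "v \<in> set as")
          assume "u \<in> set as" "v \<in> set as"
          then show ?thesis using inj_as uv by (meson inj_onD)
        next
          assume "u \<notin> set as" "v \<notin> set as"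
          then show ?thesis using out uv permutes_inj[OF \<sigma>] by (metis injD)
        qed (use im out s uv in \<open>metis image_subset_iff\<close>)+
      qed
      moreover have "\<rho> ` {1..n} \<subseteq> {1..n}"
      proof
        fix y
        assume "y \<in> \<rho> ` {1..n}"
        then obtain u where u: "u \<in> {1..n}" "y = \<rho> u"
          by blast
        show "y \<in> {1..n}"
        proof (cases "u \<in> set as")
          case True
          then show ?thesis using im inn u(2) by blast
        next
          case False
          then show ?thesis using out[OF False] permutes_in_image[OF \<sigma>] u by simp
        qed
      qed
      ultimately show "bij_betw \<rho> {1..n} {1..n}"
        by (simp add: bij_betw_def endo_inj_surj)
      show "\<rho> y = y" if "y \<notin> {1..n}" for y
        using that inn out[of y] permutes_not_in[OF \<sigma> that] by (metis subsetD)
    qed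
  qed
  have "refines \<tau> \<rho>"
    unfolding refines_def
  proof
    fix y
    consider "y \<notin> set as" | "y \<in> Ob" | "y \<in> set as - Ob" using OA by blast
    then show "\<exists>Q. cyc \<tau> y = filter Q (cyc \<rho> y)"
    proof cases
      case 1
      then show ?thesis using cyc(1) r unfolding refines_def by metis
    next
      case 2
      then have "set (cyc \<tau> y) = Ob"
        using set_cyc_eq[OF p\<tau>] by (simp add: Ob_def)
      then have "cyc \<tau> y = cyc \<rho> y"
        using cyc(2)[OF 2] refines_filter[OF r, of y] by simp
      then show ?thesis by (intro exI[of _ "\<lambda>_. True"]) simp
    next
      case 3
      then have "set (cyc \<tau> y) \<inter> Ob = {}"
        using set_cyc_eq[OF p\<tau>] in_cyc[OF p\<tau>, of y] unfolding Ob_def by (metis DiffD2 disjoint_iff)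
      then have "filter (\<lambda>u. u \<in> set (cyc \<tau> y)) (cyc \<rho> y) = filter (\<lambda>u. u \<in> set (cyc \<tau> y)) (cyc \<sigma> y)"
        unfolding cyc(3)[OF 3] filter_filter by (intro filter_cong) auto
      then show ?thesis using refines_filter[OF r, of y] by metis
    qed
  qed
  moreover have "\<rho> \<noteq> \<sigma>"
  proof
    assume "\<rho> = \<sigma>"
    then have "set (cyc \<sigma> x) \<subseteq> Ob"
      using arg_cong[OF cyc(2)[OF x_in(1)], of set] by auto
    then show False using z by (auto simp: as_def)
  qed
  ultimately show thesis
    using that[OF perm _ split] by blast
qed


section \<open>Least elements of cycles and the rank\<close>

definition label :: "(nat \<Rightarrow> nat) \<Rightarrow> nat \<Rightarrow> nat" where
  "label p x = Min (set (cyc p x))"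

text \<open>There is one label for each cycle, fixed points included. Their number strictly
  decreases along the order and serves as a corank.\<close>

definition labels :: "nat \<Rightarrow> (nat \<Rightarrow> nat) \<Rightarrow> nat set" where
  "labels n p = {x \<in> {1..n}. label p x = x}"

lemma label_in_cyc: "permutation p \<Longrightarrow> label p x \<in> set (cyc p x)"
  unfolding label_def by (intro Min_in) auto

lemma label_eq_iff:
  assumes "permutation p"
  shows "label p y = label p x \<longleftrightarrow> y \<in> set (cyc p x)"
proof
  assume "label p y = label p x"
  then have "label p x \<in> set (cyc p y)" "label p x \<in> set (cyc p x)"
    using label_in_cyc[OF assms, of y] label_in_cyc[OF assms, of x] by simp_all
  then have "set (cyc p y) = set (cyc p x)"
    using set_cyc_eq[OF assms] by metis
  then show "y \<in> set (cyc p x)"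
    using in_cyc[OF assms, of y] by simp
qed (simp add: label_def set_cyc_eq[OF assms])

lemma label_label: "permutation p \<Longrightarrow> label p (label p x) = label p x"
  by (simp add: label_eq_iff label_in_cyc)

lemma label_le: "permutation p \<Longrightarrow> y \<in> set (cyc p x) \<Longrightarrow> label p x \<le> y"
  unfolding label_def by (intro Min_le) auto

lemma label_in_labels: "p permutes {1..n} \<Longrightarrow> x \<in> {1..n} \<Longrightarrow> label p x \<in> labels n p"
  using cyc_subset[of p n x] label_in_cyc[of p x] label_label[of p x] permutes_imp_permutation[of p n]
  unfolding labels_def by blast

lemma finite_labels [simp]: "finite (labels n p)"
  by (simp add: labels_def)

lemma labels_mono:
  assumes p: "p permutes {1..n}" and q: "q permutes {1..n}" and r: "refines p q"
  shows "labels n q \<subseteq> labels n p"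
proof
  fix x
  assume x: "x \<in> labels n q"
  note pp = permutes_imp_permutation[OF p] and pq = permutes_imp_permutation[OF q]
  have "label p x \<in> set (cyc q x)"
    using label_in_cyc[OF pp] refines_subset[OF r] by blast
  then have "x \<le> label p x"
    using label_le[OF pq, of "label p x" x] x by (simp add: labels_def)
  moreover have "label p x \<le> x"
    by (simp add: label_le[OF pp] pp)
  ultimately show "x \<in> labels n p"
    using x by (simp add: labels_def)
qed

lemma labels_eq_imp_eq:
  assumes p: "p permutes {1..n}" and q: "q permutes {1..n}" and r: "refines p q"
    and eq: "labels n p = labels n q"
  shows "p = q"
proof (rule refines_set_eq_imp_eq[OF _ _ r])
  note pp = permutes_imp_permutation[OF p] and pq = permutes_imp_permutation[OF q]
  show "permutation p" "permutation q"
    by (rule pp, rule pq)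
  fix x
  show "set (cyc q x) \<subseteq> set (cyc p x)"
  proof (cases "x \<in> {1..n}")
    case False
    then show ?thesis
      using cyc_fixed[of p x] cyc_fixed[of q x] permutes_not_in[OF p False] permutes_not_in[OF q False] by simp
  next
    case True
    \<comment> \<open>The \<open>p\<close>-label of \<open>y\<close> is a \<open>q\<close>-label by
      assumption and lies in the \<open>q\<close>-cycle of \<open>y\<close>, which has only
      one.\<close>
    have *: "label p y = label q y" if "y \<in> {1..n}" for y
    proof -
      have "label q (label p y) = label p y"
        using label_in_labels[OF p that] unfolding eq by (simp add: labels_def)
      moreover have "label q (label p y) = label q y"
        using label_eq_iff[OF pq] refines_subset[OF r] label_in_cyc[OF pp] by blast
      ultimately show ?thesis by simp
    qed
    show ?thesis
    proof
      fix y
      assume y: "y \<in> set (cyc q x)"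
      then have "y \<in> {1..n}"
        using cyc_subset[OF q True] by blast
      then have "label p y = label p x"
        using y * True label_eq_iff[OF pq] by metis
      then show "y \<in> set (cyc p x)"
        using label_eq_iff[OF pp] by blast
    qed
  qed
qed

lemma card_labels_less:
  assumes "p permutes {1..n}" "q permutes {1..n}" "refines p q" "p \<noteq> q"
  shows "card (labels n q) < card (labels n p)"
  using labels_mono[OF assms(1-3)] labels_eq_imp_eq[OF assms(1-3)] assms(4)
  by (intro psubset_card_mono) auto

lemma refines_imp_covers_closure:
  assumes "p permutes {1..n}" "q permutes {1..n}" "refines p q"
  shows "(Some p, Some q) \<in> (Pi_covers n)\<^sup>*"
  using assms(2,3)
proof (induction "card (labels n p) - card (labels n q)" arbitrary: q rule: less_induct)
  case less
  show ?case
  proof (cases "p = q")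
    case False
    then obtain \<rho> where \<rho>: "\<rho> permutes {1..n}" "refines p \<rho>" "splits_to q \<rho>" "\<rho> \<noteq> q"
      using refines_imp_splits_to[OF assms(1) less.prems] by blast
    have "refines \<rho> q"
      using splits_to_imp_refines[OF permutes_imp_permutation[OF less.prems(1)] \<rho>(3)] .
    then have "card (labels n q) < card (labels n \<rho>)"
      using card_labels_less[OF \<rho>(1) less.prems(1)] \<rho>(4) by blast
    moreover have "card (labels n \<rho>) \<le> card (labels n p)"
      using labels_mono[OF assms(1) \<rho>(1,2)] by (intro card_mono) auto
    ultimately have "(Some p, Some \<rho>) \<in> (Pi_covers n)\<^sup>*"
      using less.hyps[OF _ \<rho>(1,2)] by linarith
    moreover have "(Some \<rho>, Some q) \<in> Pi_covers n"
      by (rule Pi_covers.split[OF less.prems(1) \<rho>(1,3)])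
    ultimately show ?thesis by (rule rtrancl_into_rtrancl)
  qed simp
qed

text \<open>The adjoined maximum is covered by nothing, so a chain of covers that ends in a
  permutation consists of splittings only.\<close>

lemma covers_closure_imp_refines:
  assumes "(x, y) \<in> (Pi_covers n)\<^sup>*" "y = Some q" "x \<in> Pi_carrier n" "y \<in> Pi_carrier n"
  shows "\<exists>p. x = Some p \<and> (p, q) \<in> perm_order n"
  using assms
proof (induction arbitrary: q rule: rtrancl_induct)
  case base
  then show ?case
    by (auto simp: perm_order_def Pi_carrier_def refines_refl)
next
  case (step y z)
  from step.hyps(2) show ?case
  proof cases
    case (split \<sigma> \<tau>)
    then obtain p where p: "x = Some p" "(p, \<tau>) \<in> perm_order n"
      using step.IH[of \<tau>] step.prems by (auto simp: Pi_carrier_def)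
    have "refines \<tau> \<sigma>"
      using splits_to_imp_refines[OF permutes_imp_permutation] split by blast
    then have "(p, \<sigma>) \<in> perm_order n"
      using p(2) split refines_trans unfolding perm_order_def by blast
    then show ?thesis using p(1) split step.prems(1) by simp
  next
    case (top as)
    then show ?thesis using step.prems by simp
  qed
qed

lemma filter_concat_cyc:
  assumes "distinct L" "a \<in> set L" "\<And>b. b \<in> set L \<Longrightarrow> b \<noteq> a \<Longrightarrow> set (cyc p b) \<inter> set (cyc p a) = {}"
  shows "filter (\<lambda>y. y \<in> set (cyc p a)) (concat (map (cyc p) L)) = cyc p a"
proof -
  let ?f = "filter (\<lambda>y. y \<in> set (cyc p a))"
  obtain l1 l2 where L: "L = l1 @ a # l2"
    using assms(2) by (metis split_list)
  have nil: "?f (concat (map (cyc p) l)) = []" if "set l \<subseteq> set L" "a \<notin> set l" for l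
    using that assms(3) by (auto simp: filter_empty_conv disjoint_iff)
  have "?f (concat (map (cyc p) l1)) = []" "?f (concat (map (cyc p) l2)) = []"
    using assms(1) L by (auto intro!: nil)
  then show ?thesis
    by (simp add: L)
qed

lemma cycle_of_list_permutes: "set as = {1..n} \<Longrightarrow> cycle_of_list as permutes {1..n}"
  using cycle_permutes[of as] by simp

text \<open>Concatenating the cycles of \<open>p\<close> in any order yields a full cycle above
  \<open>p\<close>; here they are sorted by their labels. This puts every permutation below the
  adjoined maximum.\<close>

lemma exists_full_cycle:
  fixes p :: "nat \<Rightarrow> nat"
  assumes p: "p permutes {1..n}"
  obtains as where "distinct as" "set as = {1..n}" "refines p (cycle_of_list as)"
proof -
  note pp = permutes_imp_permutation[OF p]
  define L where "L = sorted_list_of_set (labels n p)"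
  define as where "as = concat (map (cyc p) L)"
  have L: "distinct L" "set L = labels n p"
    by (simp_all add: L_def)
  have dis: "set (cyc p b) \<inter> set (cyc p a) = {}" if "a \<in> labels n p" "b \<in> labels n p" "b \<noteq> a" for a b
  proof (rule ccontr)
    assume "set (cyc p b) \<inter> set (cyc p a) \<noteq> {}"
    then obtain y where "label p y = label p b" "label p y = label p a"
      using label_eq_iff[OF pp] by blast
    then show False using that by (simp add: labels_def)
  qed
  have set_as: "set as = {1..n}"
  proof
    show "set as \<subseteq> {1..n}"
      using cyc_subset[OF p] unfolding as_def set_concat set_map L(2) labels_def by blast
    show "{1..n} \<subseteq> set as"
    proof
      fix x
      assume "x \<in> {1..n}"
      then have "label p x \<in> labels n p" "x \<in> set (cyc p (label p x))"
        using label_in_labels[OF p] label_eq_iff[OF pp] label_label[OF pp] by metis+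
      then show "x \<in> set as"
        unfolding as_def set_concat set_map L(2) by blast
    qed
  qed
  have "inj_on (cyc p) (labels n p)"
    by (intro inj_onI) (metis hd_cyc pp)
  then have dist: "distinct as"
    unfolding as_def using L distinct_cyc[OF pp] dis
    by (intro distinct_concat) (auto simp: distinct_map, metis disjoint_iff)
  have "refines p (cycle_of_list as)"
    unfolding refines_def
  proof
    fix x
    show "\<exists>Q. cyc p x = filter Q (cyc (cycle_of_list as) x)"
    proof (cases "x \<in> {1..n}")
      case True
      define a where "a = label p x"
      have a: "a \<in> set L" "x \<in> set (cyc p a)"
        using label_in_labels[OF p True] label_eq_iff[OF pp] label_label[OF pp] L(2) by (metis a_def)+
      have "filter (\<lambda>y. y \<in> set (cyc p a)) as = cyc p a"
        unfolding as_def using L(2) a(1) dis by (intro filter_concat_cyc[OF L(1)]) auto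
      then have "cyc p x = filter (\<lambda>y. y \<in> set (cyc p a)) (cyc (cycle_of_list as) x)"
        using a(2) set_as True map_cyc[OF pp, of a]
        by (intro cyc_filter[OF dist map_cycle_of_list[OF dist]]) auto
      then show ?thesis
        by (intro exI[of _ "\<lambda>y. y \<in> set (cyc p a)"])
    next
      case False
      then have "cyc p x = [x]" "cyc (cycle_of_list as) x = [x]"
        using permutes_not_in[OF p False] id_outside_supp[of x as] set_as by (intro cyc_fixed; blast)+
      then show ?thesis by (intro exI[of _ "\<lambda>_. True"]) simp
    qed
  qed
  then show thesis
    using that[OF dist set_as] by blast
qed

lemma Pi_order_Some_iff: "(Some p, Some q) \<in> Pi_order n \<longleftrightarrow> (p, q) \<in> perm_order n"
proof
  assume "(Some p, Some q) \<in> Pi_order n"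
  then show "(p, q) \<in> perm_order n"
    using covers_closure_imp_refines[of "Some p" "Some q" n q] by (auto simp: Pi_order_def)
next
  assume "(p, q) \<in> perm_order n"
  then show "(Some p, Some q) \<in> Pi_order n"
    using refines_imp_covers_closure[of p n q] by (auto simp: Pi_order_def Pi_carrier_def perm_order_def)
qed

lemma Pi_order_None_right: "(Some p, None) \<in> Pi_order n \<longleftrightarrow> p permutes {1..n}"
proof
  assume p: "p permutes {1..n}"
  obtain as where as: "distinct as" "set as = {1..n}" "refines p (cycle_of_list as)"
    using exists_full_cycle[OF p] by blast
  have "(Some p, Some (cycle_of_list as)) \<in> (Pi_covers n)\<^sup>*"
    by (rule refines_imp_covers_closure[OF p cycle_of_list_permutes[OF as(2)] as(3)])
  then have "(Some p, None) \<in> (Pi_covers n)\<^sup>*"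
    using Pi_covers.top[OF as(1,2)] by (rule rtrancl_into_rtrancl)
  then show "(Some p, None) \<in> Pi_order n"
    using p by (simp add: Pi_order_def Pi_carrier_def)
qed (auto simp: Pi_order_def Pi_carrier_def)

lemma Pi_order_None_left: "(None, y) \<in> Pi_order n \<longleftrightarrow> y = None"
proof
  assume "(None, y) \<in> Pi_order n"
  then have "(None, y) \<in> (Pi_covers n)\<^sup>*" by (simp add: Pi_order_def)
  then show "y = None"
    by (cases rule: converse_rtranclE) (auto elim: Pi_covers.cases)
qed (simp add: Pi_order_def Pi_carrier_def)

lemma finite_bounded_poset_Pi: "finite_bounded_poset (Pi_carrier n) (Pi_order n)"
proof -
  note po = partial_order_perm_order[of n, unfolded partial_order_on_def preorder_on_def]
  have fin: "finite (Pi_carrier n)"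
    using finite_permutations[of "{1..n}"] by (simp add: Pi_carrier_def)
  have "refl_on (Pi_carrier n) (Pi_order n)"
    by (auto simp: refl_on_def Pi_order_def)
  moreover have "Pi_order n \<subseteq> Pi_carrier n \<times> Pi_carrier n"
    by (auto simp: Pi_order_def)
  moreover have "trans (Pi_order n)"
    unfolding Pi_order_def by (auto simp: trans_def)
  moreover have "antisym (Pi_order n)"
  proof (rule antisymI)
    fix x y
    assume *: "(x, y) \<in> Pi_order n" "(y, x) \<in> Pi_order n"
    show "x = y"
    proof (cases x)
      case None
      then show ?thesis using * Pi_order_None_left by simp
    next
      case (Some p)
      then obtain q where "y = Some q"
        using * Pi_order_None_left by (cases y) auto
      then show ?thesis
        using * Some po by (auto simp: Pi_order_Some_iff dest: antisymD)
    qed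
  qed
  moreover have "\<exists>b\<in>Pi_carrier n. \<forall>x\<in>Pi_carrier n. (b, x) \<in> Pi_order n"
  proof (intro bexI ballI)
    show "Some id \<in> Pi_carrier n"
      by (simp add: Pi_carrier_def permutes_id)
    fix x
    assume x: "x \<in> Pi_carrier n"
    show "(Some id, x) \<in> Pi_order n"
    proof (cases x)
      case None
      then show ?thesis by (simp add: Pi_order_None_right permutes_id)
    next
      case (Some q)
      then have q: "q permutes {1..n}" using x by (auto simp: Pi_carrier_def)
      have "refines id q"
        unfolding refines_def
      proof
        fix y
        obtain l where l: "cyc q y = y # l"
          using cyc_Cons[OF permutes_imp_permutation[OF q]] by blast
        moreover have "y \<notin> set l"
          using distinct_cyc[OF permutes_imp_permutation[OF q], of y] l by simp
        moreover have "cyc id y = [y]"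
          by (rule cyc_fixed) simp
        moreover have "filter (\<lambda>u. u = y) l = []"
          using calculation(2) by (auto simp: filter_empty_conv)
        ultimately show "\<exists>Q. cyc id y = filter Q (cyc q y)"
          by (intro exI[of _ "\<lambda>u. u = y"]) simp
      qed
      then show ?thesis
        using Some q by (simp add: Pi_order_Some_iff perm_order_def permutes_id)
    qed
  qed
  moreover have "\<exists>t\<in>Pi_carrier n. \<forall>x\<in>Pi_carrier n. (x, t) \<in> Pi_order n"
    by (intro bexI[of _ None]) (auto simp: Pi_carrier_def Pi_order_None_right Pi_order_None_left)
  ultimately show ?thesis
    using fin unfolding finite_bounded_poset_def partial_order_on_def preorder_on_def by blast
qed

section \<open>Merging cycles into a fixed cycle\<close>

locale based_permutation =
  fixes n :: nat and t :: "nat \<Rightarrow> nat" and x0 :: nat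
  assumes t: "t permutes {1..n}" and x0: "x0 \<in> {1..n}"
begin

lemma perm_t: "permutation t"
  by (rule permutes_imp_permutation[OF t])

definition region :: "nat set \<Rightarrow> nat set" where
  "region S = {y. label t y = label t x0 \<or> label t y \<in> S}"

definition merged :: "(nat \<Rightarrow> nat) \<Rightarrow> nat set" where
  "merged q = labels n t \<inter> set (cyc q x0) - {label t x0}"

text \<open>Only the cycles with labels in \<open>S\<close> stay merged with that of x0; every other
  part of \<open>q\<close>, on its base cycle or elsewhere, is returned to \<open>t\<close>.\<close>

definition restr :: "(nat \<Rightarrow> nat) \<Rightarrow> nat set \<Rightarrow> nat \<Rightarrow> nat" where
  "restr q S = recycle t (filter (\<lambda>y. y \<in> region S) (cyc q x0))"

definition flat :: "(nat \<Rightarrow> nat) \<Rightarrow> bool" where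
  "flat q \<longleftrightarrow> q permutes {1..n} \<and> refines t q \<and> (\<forall>x. x \<notin> set (cyc q x0) \<longrightarrow> cyc q x = cyc t x)"

lemma region_closed: "y \<in> region S \<Longrightarrow> set (cyc t y) \<subseteq> region S"
proof
  fix x
  assume y: "y \<in> region S" and "x \<in> set (cyc t y)"
  then have "label t x = label t y"
    using label_eq_iff[OF perm_t] by blast
  then show "x \<in> region S"
    using y by (simp add: region_def)
qed

lemma x0_region: "x0 \<in> region S"
  by (simp add: region_def)

text \<open>The base cycle of \<open>q\<close> and the region of \<open>S\<close> are unions of
  cycles of \<open>t\<close>. So is their intersection, and \<open>recycle\<close> therefore
  replaces whole cycles of \<open>t\<close>.\<close>

lemma restr_facts:
  assumes q: "q permutes {1..n}" "refines t q"
  shows "restr q S permutes {1..n}"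
    and "cyc (restr q S) x0 = filter (\<lambda>y. y \<in> region S) (cyc q x0)"
    and "flat (restr q S)"
    and "refines (restr q S) q"
proof -
  note pq = permutes_imp_permutation[OF q(1)]
  let ?L = "filter (\<lambda>y. y \<in> region S) (cyc q x0)"
  have L: "distinct ?L" "set ?L \<subseteq> {1..n}"
    using distinct_cyc[OF pq] cyc_subset[OF q(1) x0] by auto
  have closed: "set (cyc t y) \<subseteq> set ?L" if "y \<in> set ?L" for y
    using that region_closed[of y S] refines_subset[OF q(2), of y] set_cyc_eq[OF pq, of y x0] by auto
  show perm: "restr q S permutes {1..n}"
    unfolding restr_def
    by (rule recycle_permutes[OF t L closed_cyc_image[OF perm_t closed]])
  note pr = permutes_imp_permutation[OF perm]
  have m: "map (restr q S) ?L = rotate1 ?L"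
    unfolding restr_def by (rule map_recycle[OF L(1)])
  obtain l where "cyc q x0 = x0 # l"
    using cyc_Cons[OF pq] by blast
  then have hd: "hd ?L = x0" "?L \<noteq> []"
    using x0_region by simp_all
  show base: "cyc (restr q S) x0 = ?L"
    using cyc_eqI[OF L(1) m hd(2)] hd(1) by simp
  have out: "cyc (restr q S) x = cyc t x" if "x \<notin> set ?L" for x
    unfolding restr_def by (rule cyc_recycle_outside[OF perm_t closed that])
  have inside: "cyc (restr q S) x = filter (\<lambda>y. y \<in> region S) (cyc q x)" if "x \<in> set ?L" for x
    using that by (intro cyc_filter[OF distinct_cyc[OF pq] map_cyc[OF pq] m]) auto
  show "refines (restr q S) q"
    unfolding refines_def
  proof
    fix x
    show "\<exists>Q. cyc (restr q S) x = filter Q (cyc q x)"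
      using inside[of x] out[of x] q(2) unfolding refines_def by metis
  qed
  have "refines t (restr q S)"
    unfolding refines_def
  proof
    fix x
    show "\<exists>Q. cyc t x = filter Q (cyc (restr q S) x)"
    proof (cases "x \<in> set ?L")
      case True
      have "filter (\<lambda>y. y \<in> set (cyc t x)) (cyc (restr q S) x) = filter (\<lambda>y. y \<in> set (cyc t x)) (cyc q x)"
        unfolding inside[OF True] filter_filter
        using True region_closed[of x S] by (intro filter_cong) auto
      then show ?thesis
        using refines_filter[OF q(2), of x] by metis
    next
      case False
      then show ?thesis
        using out[OF False] by (intro exI[of _ "\<lambda>_. True"]) simp
    qed
  qed
  then show "flat (restr q S)"
    unfolding flat_def using perm base out by simp
qed

text \<open>Off its base cycle a flat permutation agrees with \<open>t\<close>, which refines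
  \<open>q\<close> anyway. Comparisons of flat elements thus reduce to the cycle of x0.\<close>

lemma flat_refinesI:
  assumes "flat p" "q permutes {1..n}" "refines t q" "cyc p x0 = filter Q (cyc q x0)"
  shows "refines p q"
  unfolding refines_def
proof
  fix x
  have pp: "permutation p" and pq: "permutation q"
    using assms(1,2) permutes_imp_permutation unfolding flat_def by blast+
  show "\<exists>Q. cyc p x = filter Q (cyc q x)"
  proof (cases "x \<in> set (cyc p x0)")
    case True
    have "cyc p x = filter Q (cyc q x)"
      using True map_cyc[OF pp, of x0] unfolding assms(4)
      by (intro cyc_filter[OF distinct_cyc[OF pq, of x0] map_cyc[OF pq]]) auto
    then show ?thesis by (intro exI[of _ Q])
  next
    case False
    then show ?thesis
      using assms(1,3) unfolding flat_def refines_def by metis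
  qed
qed

lemma flat_eqI:
  assumes "flat p" "flat q" "cyc p x0 = cyc q x0"
  shows "p = q"
proof (rule eq_of_cyc_eq)
  show "permutation p" "permutation q"
    using assms permutes_imp_permutation unfolding flat_def by blast+
next
  fix x
  have "refines p q" "refines q p"
    using flat_refinesI[OF assms(1), of q "\<lambda>_. True"] flat_refinesI[OF assms(2), of p "\<lambda>_. True"] assms
    unfolding flat_def by simp_all
  then have "p = q"
    using refines_antisym assms permutes_imp_permutation unfolding flat_def by blast
  then show "cyc p x = cyc q x" by simp
qed

text \<open>Every cycle of \<open>q\<close> is a union of cycles of \<open>t\<close> and hence
  determined by the labels that it contains.\<close>

lemma set_cyc_merged:
  assumes q: "q permutes {1..n}" "refines t q"
  shows "y \<in> set (cyc q x0) \<longleftrightarrow> y \<in> {1..n} \<and> y \<in> region (merged q)"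
proof -
  note pq = permutes_imp_permutation[OF q(1)]
  have *: "label t y \<in> set (cyc q x0) \<longleftrightarrow> y \<in> set (cyc q x0)" for y
    using label_in_cyc[OF perm_t, of y] refines_subset[OF q(2), of y] in_cyc_iff[OF pq] by (metis subsetD)
  show ?thesis
  proof
    assume y: "y \<in> set (cyc q x0)"
    then have "y \<in> {1..n}"
      using cyc_subset[OF q(1) x0] by blast
    then show "y \<in> {1..n} \<and> y \<in> region (merged q)"
      using * y label_in_labels[OF t] by (auto simp: region_def merged_def simp del: atLeastAtMost_iff)
  next
    assume "y \<in> {1..n} \<and> y \<in> region (merged q)"
    then show "y \<in> set (cyc q x0)"
      using *[of y] *[of x0] in_cyc[OF pq, of x0] by (auto simp: region_def merged_def)
  qed
qed

lemma merged_empty_iff: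
  assumes q: "q permutes {1..n}" "refines t q"
  shows "merged q = {} \<longleftrightarrow> set (cyc q x0) = set (cyc t x0)"
proof
  assume "merged q = {}"
  then show "set (cyc q x0) = set (cyc t x0)"
    using set_cyc_merged[OF q] label_eq_iff[OF perm_t] cyc_subset[OF t x0]
    by (auto simp: region_def simp del: atLeastAtMost_iff)
next
  assume "set (cyc q x0) = set (cyc t x0)"
  then show "merged q = {}"
    using label_eq_iff[OF perm_t] by (auto simp: merged_def labels_def simp flip: label_eq_iff[OF perm_t])
qed

lemma merged_restr:
  assumes q: "q permutes {1..n}" "refines t q" and S: "S \<subseteq> merged q"
  shows "merged (restr q S) = S"
  using S unfolding merged_def restr_facts(2)[OF q] by (auto simp: region_def labels_def)

lemma merged_mono: "refines p q \<Longrightarrow> merged p \<subseteq> merged q"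
  using refines_subset[of p q x0] by (auto simp: merged_def)

text \<open>Together with \<open>merged_restr\<close> this makes \<open>restr q\<close> and
  \<open>merged\<close> inverse to each other, so the flat elements below \<open>q\<close>
  correspond to the subsets of \<open>merged q\<close>.\<close>

lemma flat_eq_restr:
  assumes p: "flat p" and q: "q permutes {1..n}" "refines t q" and r: "refines p q"
  shows "p = restr q (merged p)"
proof (rule flat_eqI[OF p restr_facts(3)[OF q]])
  have pf: "p permutes {1..n}" "refines t p"
    using p by (auto simp: flat_def)
  have "filter (\<lambda>y. y \<in> region (merged p)) (cyc q x0) = filter (\<lambda>y. y \<in> set (cyc p x0)) (cyc q x0)"
    using set_cyc_merged[OF pf] cyc_subset[OF q(1) x0] by (intro filter_cong) auto
  then show "cyc p x0 = cyc (restr q (merged p)) x0"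
    using refines_filter[OF r, of x0] restr_facts(2)[OF q] by simp
qed

lemma region_mono: "S \<subseteq> S' \<Longrightarrow> region S \<subseteq> region S'"
  by (auto simp: region_def)

lemma restr_refines_iff:
  assumes q: "q permutes {1..n}" "refines t q" and S: "S \<subseteq> merged q" "S' \<subseteq> merged q"
  shows "refines (restr q S) (restr q S') \<longleftrightarrow> S \<subseteq> S'"
proof
  assume "refines (restr q S) (restr q S')"
  then show "S \<subseteq> S'"
    using merged_mono merged_restr[OF q] S by metis
next
  assume "S \<subseteq> S'"
  then have "filter (\<lambda>y. y \<in> region S) (cyc q x0)
      = filter (\<lambda>y. y \<in> region S) (filter (\<lambda>y. y \<in> region S') (cyc q x0))"
    unfolding filter_filter using region_mono by (intro filter_cong) auto
  then show "refines (restr q S) (restr q S')"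
    using restr_facts(3)[OF q, of S'] restr_facts(2)[OF q]
    by (intro flat_refinesI[OF restr_facts(3)[OF q] restr_facts(1)[OF q], of _ _ "\<lambda>y. y \<in> region S"])
      (auto simp: flat_def)
qed

text \<open>Outside the base cycle the cycles are those of \<open>t\<close>, so each merged cycle
  costs exactly one label.\<close>

lemma card_labels_flat:
  assumes q: "flat q"
  shows "card (labels n t) = card (labels n q) + card (merged q)"
proof -
  have qf: "q permutes {1..n}" "refines t q" "\<And>x. x \<notin> set (cyc q x0) \<Longrightarrow> cyc q x = cyc t x"
    using q by (auto simp: flat_def)
  note pq = permutes_imp_permutation[OF qf(1)]
  let ?E = "labels n t - set (cyc q x0)"
  have "labels n q = insert (label q x0) ?E"
  proof (intro equalityI subsetI)
    fix y
    assume y: "y \<in> labels n q"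
    show "y \<in> insert (label q x0) ?E"
    proof (cases "y \<in> set (cyc q x0)")
      case True
      then have "label q y = label q x0"
        using label_eq_iff[OF pq] by blast
      then show ?thesis using y by (simp add: labels_def)
    next
      case False
      then show ?thesis using y labels_mono[OF t qf(1,2)] by blast
    qed
  next
    fix y
    assume "y \<in> insert (label q x0) ?E"
    then show "y \<in> labels n q"
      using label_in_labels[OF qf(1) x0] qf(3)[of y] by (auto simp: labels_def label_def)
  qed
  moreover have "label q x0 \<notin> ?E"
    using label_in_cyc[OF pq] by blast
  ultimately have 1: "card (labels n q) = Suc (card ?E)"
    by simp
  have "labels n t = ?E \<union> insert (label t x0) (merged q)"
    using label_in_labels[OF t x0] label_in_cyc[OF perm_t, of x0] refines_subset[OF qf(2), of x0]
    by (auto simp: merged_def)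
  moreover have "?E \<inter> insert (label t x0) (merged q) = {}"
    using label_in_cyc[OF perm_t, of x0] refines_subset[OF qf(2), of x0] by (auto simp: merged_def)
  moreover have "finite (merged q)"
    by (simp add: merged_def)
  ultimately have "card (labels n t) = card ?E + card (insert (label t x0) (merged q))"
    by (metis card_Un_disjoint finite_Diff finite_insert finite_labels)
  also have "card (insert (label t x0) (merged q)) = Suc (card (merged q))"
    by (rule card_insert_disjoint) (simp_all add: merged_def)
  finally show ?thesis using 1 by simp
qed

end


section \<open>Elements in which the base cycle is merged\<close>

context based_permutation
begin

text \<open>The condition is on the cycle of x0 itself and not on \<open>merged\<close>, so that it
  reads the same for all base permutations with this cycle through x0.\<close>

definition merging :: "(nat \<Rightarrow> nat) set \<Rightarrow> (nat \<Rightarrow> nat) set" where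
  "merging Y = {q \<in> Y. (t, q) \<in> perm_order n \<and> set (cyc q x0) \<noteq> set (cyc t x0)}"

lemma mergingD:
  assumes "q \<in> merging Y"
  shows "q \<in> Y" "q permutes {1..n}" "refines t q" "merged q \<noteq> {}" "q \<noteq> t"
  using assms merged_empty_iff by (auto simp: merging_def perm_order_def simp del: atLeastAtMost_iff)

lemma mergingI:
  assumes "q \<in> Y" "q permutes {1..n}" "refines t q" "merged q \<noteq> {}"
  shows "q \<in> merging Y"
  using assms merged_empty_iff[OF assms(2,3)] t by (simp add: merging_def perm_order_def)

lemma merging_subset: "merging Y \<subseteq> {p. p permutes {1..n}}"
  using mergingD(2) by blast

lemma finite_merging: "finite (merging Y)"
  by (rule finite_subset[OF merging_subset]) (simp add: finite_permutations)

lemma card_chain_merging: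
  assumes X: "X \<in> order_complex (perm_order n) (merging Y)"
    and d: "\<And>q. q \<in> merging Y \<Longrightarrow> card (labels n q) > e"
  shows "card X \<le> card (labels n t) - e - 1"
proof (rule card_chain_le[OF X, where rk = "\<lambda>q. card (labels n t) - card (labels n q)" and a = 1])
  have less: "card (labels n q) < card (labels n t)" if "q \<in> merging Y" for q
    using mergingD[OF that] card_labels_less[OF t] by metis
  show "card (labels n t) - card (labels n q) \<in> {1..<1 + (card (labels n t) - e - 1)}"
    if "q \<in> merging Y" for q
    using less[OF that] d[OF that] by auto
  show "card (labels n t) - card (labels n p) < card (labels n t) - card (labels n q)"
    if "p \<in> merging Y" "q \<in> merging Y" "(p, q) \<in> perm_order n" "p \<noteq> q" for p q
  proof -
    have "card (labels n q) < card (labels n p)"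
      using that card_labels_less unfolding perm_order_def by blast
    then show ?thesis
      using less[OF that(1)] less[OF that(2)] by linarith
  qed
qed

text \<open>Undoing all merges away from the base cycle retracts \<open>merging Y\<close> onto its flat elements.\<close>

lemma spherical_merging:
  assumes down: "\<And>p q. q \<in> Y \<Longrightarrow> (p, q) \<in> perm_order n \<Longrightarrow> p \<in> Y"
    and flat: "spherical (Suc m) (order_complex (perm_order n) {q \<in> merging Y. flat q})"
    and bound: "\<And>X. X \<in> order_complex (perm_order n) (merging Y) \<Longrightarrow> card X \<le> Suc m"
  shows "spherical (Suc m) (order_complex (perm_order n) (merging Y))"
proof (rule spherical_dismantle_down[OF partial_order_perm_order finite_merging merging_subset _ flat bound])
  fix v
  assume "v \<in> merging Y - {q \<in> merging Y. flat q}"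
  then have v: "v \<in> merging Y" by blast
  note vD = mergingD[OF v]
  \<comment> \<open>This is the greatest flat element below \<open>v\<close>.\<close>
  let ?z = "restr v (merged v)"
  note z = restr_facts[OF vD(2,3), of "merged v"]
  have zv: "(?z, v) \<in> perm_order n"
    using z vD(2) by (simp add: perm_order_def)
  have tz: "refines t ?z"
    using z(3) by (simp add: flat_def)
  have "?z \<in> merging Y"
    using down[OF vD(1) zv] z(1) tz merged_restr[OF vD(2,3) order_refl] vD(4)
    by (intro mergingI) auto
  moreover have "(q, ?z) \<in> perm_order n" if "q \<in> {q \<in> merging Y. flat q}" "(q, v) \<in> perm_order n" for q
  proof -
    have q: "flat q" "refines q v" "q permutes {1..n}"
      using that by (auto simp: perm_order_def)
    have "merged q \<subseteq> merged v"
      by (rule merged_mono[OF q(2)])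
    then have "refines (restr v (merged q)) ?z"
      using restr_refines_iff[OF vD(2,3)] by simp
    then show ?thesis
      using flat_eq_restr[OF q(1) vD(2,3) q(2)] q(3) z(1) by (simp add: perm_order_def)
  qed
  ultimately show "\<exists>z\<in>{q \<in> merging Y. flat q}. (z, v) \<in> perm_order n \<and>
      (\<forall>q\<in>{q \<in> merging Y. flat q}. (q, v) \<in> perm_order n \<longrightarrow> (q, z) \<in> perm_order n)"
    using zv z(3) by (intro bexI[of _ ?z]) auto
qed auto

text \<open>If \<open>s\<close> is flat, it is the excluded maximum of the Boolean lattice, and
  \<open>card_labels_flat\<close> matches the size of the lattice with the rank. Otherwise
  \<open>restr s (merged s)\<close> differs from \<open>s\<close> and is a maximum, which gives a
  cone; the rank then merely bounds its chains.\<close>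

lemma spherical_merging_below:
  assumes s: "s permutes {1..n}" "refines t s" "merged s \<noteq> {}"
  shows "spherical (card (labels n t) - card (labels n s) - 1)
    (order_complex (perm_order n) (merging {q. (q, s) \<in> perm_order n \<and> q \<noteq> s}))"
proof -
  let ?Y = "{q. (q, s) \<in> perm_order n \<and> q \<noteq> s}"
  have more: "card (labels n q) > card (labels n s)" if "q \<in> merging ?Y" for q
    using mergingD[OF that] card_labels_less[OF _ s(1)] by (auto simp: perm_order_def)
  note bound = card_chain_merging[OF _ more]
  show ?thesis
  proof (cases "card (labels n t) - card (labels n s) - 1")
    case 0
    have "q \<notin> merging ?Y" for q
    proof
      assume q: "q \<in> merging ?Y"
      then have "card (labels n q) < card (labels n t)"
        using mergingD[OF q] card_labels_less[OF t] by metis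
      then show False
        using more[OF q] 0 by linarith
    qed
    then have "merging ?Y = {}" by blast
    then have "order_complex (perm_order n) (merging ?Y) = {{}}"
      by (auto simp: order_complex_def Chains_def)
    then show ?thesis
      using spherical_singleton_empty 0 by simp
  next
    case (Suc m)
    let ?A = "{q \<in> merging ?Y. flat q}"
    have char: "q = restr s (merged q) \<and> merged q \<subseteq> merged s" if "q \<in> ?A" for q
      using that flat_eq_restr[OF _ s(1,2)] merged_mono mergingD(1)[of q ?Y]
      by (auto simp: perm_order_def)
    have mem: "restr s S \<in> ?A \<and> merged (restr s S) = S"
      if S: "S \<subseteq> merged s" "S \<noteq> {}" "restr s S \<noteq> s" for S
    proof -
      note r = restr_facts[OF s(1,2), of S]
      have "restr s S \<in> merging ?Y"
        using r S merged_restr[OF s(1,2) S(1)] s(1)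
        by (intro mergingI) (auto simp: perm_order_def flat_def)
      then show ?thesis
        using r(3) merged_restr[OF s(1,2) S(1)] by blast
    qed
    have ord: "(p, q) \<in> perm_order n \<longleftrightarrow> merged p \<subseteq> merged q" if "p \<in> ?A" "q \<in> ?A" for p q
    proof -
      have "refines p q \<longleftrightarrow> merged p \<subseteq> merged q"
        using char[OF that(1)] char[OF that(2)] restr_refines_iff[OF s(1,2)] by metis
      then show ?thesis
        using that mergingD(2) by (auto simp: perm_order_def)
    qed
    have "spherical (Suc m) (order_complex (perm_order n) ?A)"
    proof (cases "flat s")
      case True
      have full: "restr s S = s \<longleftrightarrow> S = merged s" if "S \<subseteq> merged s" for S
        using flat_eq_restr[OF True s(1,2) refines_refl] merged_restr[OF s(1,2) that] by metis
      have bij: "bij_betw merged ?A {S. S \<subseteq> merged s \<and> S \<noteq> {} \<and> \<not> merged s \<subseteq> S}"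
        unfolding bij_betw_def
      proof
        show "inj_on merged ?A"
        proof (rule inj_onI)
          fix p q
          assume p: "p \<in> ?A" and q: "q \<in> ?A" and "merged p = merged q"
          then have "restr s (merged p) = restr s (merged q)" by (simp only:)
          then show "p = q"
            using conjunct1[OF char[OF p]] conjunct1[OF char[OF q]] by metis
        qed
        show "merged ` ?A = {S. S \<subseteq> merged s \<and> S \<noteq> {} \<and> \<not> merged s \<subseteq> S}"
        proof (intro equalityI subsetI)
          fix S
          assume "S \<in> merged ` ?A"
          then obtain q where q: "q \<in> ?A" "S = merged q" by blast
          have "q \<noteq> s" "merged q \<noteq> {}"
            using q(1) mergingD[of q ?Y] by auto
          then show "S \<in> {S. S \<subseteq> merged s \<and> S \<noteq> {} \<and> \<not> merged s \<subseteq> S}"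
            using char[OF q(1)] full[of "merged q"] q(2) by auto
        next
          fix S
          assume "S \<in> {S. S \<subseteq> merged s \<and> S \<noteq> {} \<and> \<not> merged s \<subseteq> S}"
          then have S: "S \<subseteq> merged s" "S \<noteq> {}" "restr s S \<noteq> s"
            using full[of S] by auto
          show "S \<in> merged ` ?A"
            using imageI[OF conjunct1[OF mem[OF S]], of merged] conjunct2[OF mem[OF S]] by simp
        qed
      qed
      have "spherical (card (merged s) - 1) (order_complex (perm_order n) ?A)"
      proof (rule spherical_boolean[OF partial_order_perm_order _ _ bij ord s(3) order_refl])
        show "?A \<subseteq> {p. p permutes {1..n}}"
          using merging_subset[of ?Y] by blast
      qed (simp_all add: merged_def)
      moreover have "card (merged s) - 1 = Suc m"
        using card_labels_flat[OF True] Suc by simp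
      ultimately show ?thesis by simp
    next
      case False
      let ?z = "restr s (merged s)"
      have "?z \<noteq> s"
        using False restr_facts(3)[OF s(1,2), of "merged s"] by metis
      then have z: "?z \<in> ?A" "merged ?z = merged s"
        using mem[OF order_refl s(3)] by auto
      show ?thesis
      proof (rule spherical_order_cone[OF _ z(1)])
        show "finite ?A"
          using finite_merging by simp
        show "(q, ?z) \<in> perm_order n \<or> (?z, q) \<in> perm_order n" if "q \<in> ?A" for q
          using ord[OF that z(1)] char[OF that] z(2) by simp
        show "card X \<le> Suc m" if "X \<in> order_complex (perm_order n) ?A" for X
          using bound[of X] order_complex_mono[of ?A "merging ?Y" "perm_order n"] that Suc by auto
      qed
    qed
    then have "spherical (Suc m) (order_complex (perm_order n) (merging ?Y))"
    proof (rule spherical_merging[rotated])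
      show "p \<in> ?Y" if "q \<in> ?Y" "(p, q) \<in> perm_order n" for p q
      proof -
        have "(p, s) \<in> perm_order n"
          using that refines_trans unfolding perm_order_def by blast
        moreover have "p \<noteq> s"
          using that refines_antisym permutes_imp_permutation unfolding perm_order_def by blast
        ultimately show ?thesis by blast
      qed
      show "card X \<le> Suc m" if "X \<in> order_complex (perm_order n) (merging ?Y)" for X
        using bound[OF that] Suc by simp
    qed
    then show ?thesis using Suc by simp
  qed
qed

end

section \<open>Full cycles as words\<close>

lemma distinct_insert_block:
  "\<lbrakk>f = l @ m; distinct f; distinct b; set f \<inter> set b = {}\<rbrakk>
    \<Longrightarrow> distinct (l @ b @ m) \<and> set (l @ b @ m) = set f \<union> set b"
  by auto

text \<open>The choice of 1 makes the label of x0 smaller than all others. Hence a word that starts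
  with x0 still does so after a block has been moved.\<close>

locale word_permutation = based_permutation n t x0 for n t x0 +
  assumes x0_eq: "x0 = 1"
begin

definition letters :: "nat set" where
  "letters = labels n t - {x0}"

definition full :: "(nat \<Rightarrow> nat) set" where
  "full = {c. c permutes {1..n} \<and> refines t c \<and> set (cyc c x0) = {1..n}}"

lemma label_x0: "label t x0 = x0"
  using label_le[OF perm_t in_cyc[OF perm_t], of x0] cyc_subset[OF t x0] label_in_cyc[OF perm_t, of x0]
    x0_eq by (metis atLeastAtMost_iff le_antisym subsetD)

sublocale cyclic_words "label t" "cyc t" letters
proof
  fix a
  assume a: "a \<in> letters"
  show "distinct (cyc t a) \<and> cyc t a \<noteq> []"
    using distinct_cyc[OF perm_t] perm_t by simp
  have "label t a = a"
    using a by (simp add: letters_def labels_def)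
  then show "label t x = a" "hd (cyc t a) \<le> x" if "x \<in> set (cyc t a)" for x
    using that label_eq_iff[OF perm_t, of x a] label_le[OF perm_t that] perm_t by auto
qed

lemma fullD:
  assumes "c \<in> full"
  shows "c permutes {1..n}" "refines t c" "set (cyc c x0) = {1..n}" "permutation c"
    "distinct (cyc c x0)" "merged c = letters" "flat c"
proof -
  show c: "c permutes {1..n}" "refines t c" "set (cyc c x0) = {1..n}"
    using assms by (auto simp: full_def)
  show pc: "permutation c"
    by (rule permutes_imp_permutation[OF c(1)])
  then show "distinct (cyc c x0)"
    by (rule distinct_cyc)
  show "merged c = letters"
    unfolding merged_def letters_def c(3) label_x0 by (auto simp: labels_def)
  have "cyc c x = cyc t x" if "x \<notin> {1..n}" for x
    using cyc_fixed[of c x] cyc_fixed[of t x] permutes_not_in[OF c(1) that] permutes_not_in[OF t that]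
    by simp
  then show "flat c"
    unfolding flat_def c(3) using c(1,2) by blast
qed

lemma full_eqI: "c \<in> full \<Longrightarrow> c' \<in> full \<Longrightarrow> cyc c x0 = cyc c' x0 \<Longrightarrow> c = c'"
  using flat_eqI fullD(7) by blast

lemma exists_full:
  assumes q: "q permutes {1..n}" "refines t q"
  shows "\<exists>c\<in>full. refines q c"
proof -
  obtain as where as: "distinct as" "set as = {1..n}" "refines q (cycle_of_list as)"
    using exists_full_cycle[OF q(1)] by blast
  have p: "cycle_of_list as permutes {1..n}"
    by (rule cycle_of_list_permutes[OF as(2)])
  obtain l1 l2 where l: "as = l1 @ x0 # l2"
    using as(2) x0 by (metis split_list)
  have "map (cycle_of_list as) ((x0 # l2) @ l1) = rotate1 ((x0 # l2) @ l1)"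
    using map_cycle_of_list[OF as(1)] unfolding l by (rule map_rotated)
  then have "cyc (cycle_of_list as) x0 = (x0 # l2) @ l1"
    using cyc_eqI[of "(x0 # l2) @ l1" "cycle_of_list as"] as(1) l by auto
  then have "set (cyc (cycle_of_list as) x0) = {1..n}"
    using l as(2) by auto
  then show ?thesis
    using as(3) p refines_trans[OF q(2) as(3)] by (auto simp: full_def)
qed

text \<open>The word of \<open>c\<close> is cut at x0 and may cut the cycle of \<open>t\<close>
  through \<open>x\<close> anywhere, which leaves a rotation of it.\<close>

lemma filter_label_rotated:
  assumes c: "c \<in> full" and x: "x \<in> {1..n}"
  obtains k where "filter (\<lambda>y. label t y = label t x) (cyc c x0) = rotate k (cyc t x)"
proof -
  note cD = fullD[OF c]
  obtain l1 l2 where l: "cyc c x0 = l1 @ x # l2"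
    using x cD(3) by (metis split_list)
  have "map c ((x # l2) @ l1) = rotate1 ((x # l2) @ l1)"
    using map_cyc[OF cD(4), of x0] unfolding l by (rule map_rotated)
  then have cx: "cyc c x = (x # l2) @ l1"
    using cyc_eqI[of "(x # l2) @ l1" c] cD(5) l by auto
  have P: "y \<in> set (cyc t x) \<longleftrightarrow> label t y = label t x" for y
    using label_eq_iff[OF perm_t] by blast
  have "cyc t x = filter (\<lambda>y. label t y = label t x) (x # l2) @ filter (\<lambda>y. label t y = label t x) l1"
    using refines_filter[OF cD(2), of x] unfolding P cx filter_append .
  then have "filter (\<lambda>y. label t y = label t x) (cyc c x0)
      = rotate (length (filter (\<lambda>y. label t y = label t x) (x # l2))) (cyc t x)"
    unfolding l filter_append by (simp only: rotate_append)
  then show thesis by (rule that)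
qed

text \<open>Moving a block preserves the cyclic order within every cycle of \<open>t\<close>: the
  moved cycle is inserted as a whole, and the others keep their relative order. The new word is thus
  again a full cycle above \<open>t\<close>.\<close>

lemma move_full:
  assumes c: "c \<in> full" and a: "a \<in> letters"
  obtains c' where "c' \<in> full" "cyc c' x0 = move a (cyc c x0)"
proof -
  note cD = fullD[OF c]
  let ?w = "move a (cyc c x0)"
  have al: "a \<in> {1..n}" "label t a = a" "a \<noteq> x0"
    using a by (auto simp: letters_def labels_def)
  have seta: "set (cyc t a) = {y \<in> {1..n}. label t y = a}"
    using label_eq_iff[OF perm_t, of _ a, unfolded al(2)] cyc_subset[OF t al(1)] by blast
  let ?f = "filter (\<lambda>x. label t x \<noteq> a) (cyc c x0)"
  let ?l = "takeWhile (\<lambda>x. label t x < a) ?f" and ?m = "dropWhile (\<lambda>x. label t x < a) ?f"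
  have "set ?f = {y \<in> {1..n}. label t y \<noteq> a}"
    unfolding set_filter cD(3) ..
  then have "set ?f \<inter> set (cyc t a) = {}" and un: "set ?f \<union> set (cyc t a) = {1..n}"
    unfolding seta by blast+
  then have "distinct ?w \<and> set ?w = set ?f \<union> set (cyc t a)"
    unfolding move_def using cD(5) distinct_cyc[OF perm_t]
    by (intro distinct_insert_block takeWhile_dropWhile_id[symmetric]) simp_all
  then have set: "set ?w = {1..n}" and dist: "distinct ?w"
    using un by simp_all
  have "x0 < a"
    using al x0_eq by auto
  obtain l where "cyc c x0 = x0 # l"
    using cyc_Cons[OF cD(4)] by blast
  then have hd: "hd ?w = x0" "?w \<noteq> []"
    using \<open>x0 < a\<close> label_x0 by (simp_all add: move_def)
  let ?c = "cycle_of_list ?w"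
  have cw: "cyc ?c x0 = ?w"
    using cyc_eqI[OF dist map_cycle_of_list[OF dist] hd(2)] hd(1) by simp
  have "refines t ?c"
    unfolding refines_def
  proof
    fix x
    show "\<exists>Q. cyc t x = filter Q (cyc ?c x)"
    proof (cases "x \<in> {1..n}")
      case True
      let ?Q = "\<lambda>y. label t y = label t x"
      have "map t (filter ?Q ?w) = rotate1 (filter ?Q ?w)"
      proof (cases "label t x = a")
        case True
        then show ?thesis
          using filter_move_same[OF a] map_cyc[OF perm_t, of a] by simp
      next
        case False
        then have "filter ?Q ?w = filter ?Q (cyc c x0)"
          by (intro filter_move_other[OF a]) auto
        moreover obtain k where "filter ?Q (cyc c x0) = rotate k (cyc t x)"
          using filter_label_rotated[OF c True] by blast
        ultimately show ?thesis
          using map_cyc[OF perm_t, of x] by (metis rotate1_rotate_swap rotate_map)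
      qed
      then have "cyc t x = filter ?Q (cyc ?c x)"
        using True set by (intro cyc_filter[OF dist map_cycle_of_list[OF dist]]) auto
      then show ?thesis by (intro exI[of _ ?Q])
    next
      case False
      then have "cyc t x = [x]" "cyc ?c x = [x]"
        using permutes_not_in[OF t False] id_outside_supp[of x ?w] set by (intro cyc_fixed; blast)+
      then show ?thesis by (intro exI[of _ "\<lambda>_. True"]) simp
    qed
  qed
  then have "?c \<in> full"
    using cycle_of_list_permutes[OF set] cw set by (simp add: full_def)
  then show thesis
    using that cw by blast
qed

section \<open>The lexicographic order of the full cycles\<close>

definition word_less :: "(nat \<Rightarrow> nat) \<Rightarrow> (nat \<Rightarrow> nat) \<Rightarrow> bool" where
  "word_less c' c \<longleftrightarrow> (cyc c' x0, cyc c x0) \<in> lexord (label_order (label t))"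

text \<open>The position in the lexicographic order, as the shelling is indexed by natural
  numbers.\<close>

definition word_key :: "(nat \<Rightarrow> nat) \<Rightarrow> nat" where
  "word_key c = card {c' \<in> full. word_less c' c}"

lemma finite_full: "finite full"
  by (rule finite_subset[of _ "{p. p permutes {1..n}}"]) (auto simp: full_def finite_permutations)

lemma word_less_irrefl: "\<not> word_less c c"
  unfolding word_less_def by (intro lexord_irreflexive) (auto simp: label_order_iff)

lemma word_less_trans: "word_less a b \<Longrightarrow> word_less b c \<Longrightarrow> word_less a c"
  unfolding word_less_def
  by (erule lexord_trans) (auto simp: trans_def label_order_iff)

lemma word_less_linear: "c \<in> full \<Longrightarrow> c' \<in> full \<Longrightarrow> c \<noteq> c' \<Longrightarrow> word_less c c' \<or> word_less c' c"
  unfolding word_less_def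
proof -
  have "\<forall>a b. (a, b) \<in> label_order (label t) \<or> a = b \<or> (b, a) \<in> label_order (label t)"
    by (auto simp: label_order_iff)
  then have "(cyc c x0, cyc c' x0) \<in> lexord (label_order (label t)) \<or> cyc c x0 = cyc c' x0 \<or>
      (cyc c' x0, cyc c x0) \<in> lexord (label_order (label t))"
    by (rule lexord_linear)
  then show "(cyc c x0, cyc c' x0) \<in> lexord (label_order (label t)) \<or>
      (cyc c' x0, cyc c x0) \<in> lexord (label_order (label t))"
    if "c \<in> full" "c' \<in> full" "c \<noteq> c'"
    using that full_eqI by blast
qed

lemma word_key_less:
  assumes "c' \<in> full" "word_less c' c"
  shows "word_key c' < word_key c"
  unfolding word_key_def
proof (rule psubset_card_mono)
  show "{d \<in> full. word_less d c'} \<subset> {d \<in> full. word_less d c}"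
    using assms word_less_trans word_less_irrefl by blast
qed (simp add: finite_full)

lemma word_key_less_iff:
  "c \<in> full \<Longrightarrow> c' \<in> full \<Longrightarrow> word_key c' < word_key c \<longleftrightarrow> word_less c' c"
  using word_key_less word_less_linear by (metis less_asym less_irrefl)

lemma restr_eq_iff:
  assumes "c \<in> full" "c' \<in> full"
  shows "restr c' S = restr c S \<longleftrightarrow>
    filter (\<lambda>y. y \<in> region S) (cyc c' x0) = filter (\<lambda>y. y \<in> region S) (cyc c x0)"
  using restr_facts(2)[OF fullD(1,2)[OF assms(1)]] restr_facts(2)[OF fullD(1,2)[OF assms(2)]]
  by (metis restr_def)

lemma restr_empty: "c \<in> full \<Longrightarrow> restr c {} = t"
proof (rule flat_eqI[OF restr_facts(3)[OF fullD(1,2)]])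
  assume c: "c \<in> full"
  show "flat t"
    using t by (simp add: flat_def refines_refl)
  have "y \<in> region {} \<longleftrightarrow> y \<in> set (cyc t x0)" for y
    using label_eq_iff[OF perm_t] by (auto simp: region_def)
  then show "cyc (restr c {}) x0 = cyc t x0"
    using restr_facts(2)[OF fullD(1,2)[OF c], of "{}"] refines_filter[OF fullD(2)[OF c], of x0] by simp
qed

text \<open>Since \<open>c\<close> is not the least word with its restriction to \<open>S\<close>,
  some block outside \<open>S\<close> is not at its canonical place. Moving only this block yields
  an earlier word with the same restriction to all the other labels.\<close>

lemma word_exchange:
  assumes c: "c \<in> full" "c' \<in> full" and less: "word_less c' c" and S: "S \<subseteq> letters"
    and eq: "restr c' S = restr c S"
  shows "\<exists>a\<in>letters - S. \<exists>c''\<in>full. word_less c'' c \<and> restr c'' (letters - {a}) = restr c (letters - {a})"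
proof -
  \<comment> \<open>Every label is that of x0 or in \<open>letters\<close>, so the letters kept in
    \<open>exchange\<close> are exactly those of the region.\<close>
  have reg: "label t x \<notin> letters - S' \<longleftrightarrow> x \<in> region S'" if "x \<in> {1..n}" "S' \<subseteq> letters" for x S'
    using label_in_labels[OF t that(1)] that(2) label_x0 by (auto simp: region_def letters_def)
  have keep: "filter (\<lambda>x. label t x \<notin> letters - S) (cyc d x0) = filter (\<lambda>y. y \<in> region S) (cyc d x0)"
    if "d \<in> full" for d
    using fullD(3)[OF that] reg[OF _ S] by (intro filter_cong) auto
  have "\<exists>a\<in>letters - S. move a (cyc c x0) \<noteq> cyc c x0"
  proof (rule exchange[where c' = "cyc c' x0"])
    show "\<exists>k. filter (\<lambda>x. label t x = a) (cyc c' x0) = rotate k (cyc t a)" if "a \<in> letters" for a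
      using filter_label_rotated[OF c(2), of a] that by (auto simp: letters_def labels_def)
    show "filter (\<lambda>x. label t x \<notin> letters - S) (cyc c' x0) = filter (\<lambda>x. label t x \<notin> letters - S) (cyc c x0)"
      using eq restr_eq_iff[OF c] keep c by simp
  qed (use less fullD[OF c(1)] fullD[OF c(2)] in \<open>simp_all add: word_less_def\<close>)
  then obtain a where a: "a \<in> letters - S" "move a (cyc c x0) \<noteq> cyc c x0"
    by blast
  then have aG: "a \<in> letters" by blast
  obtain c'' where c'': "c'' \<in> full" "cyc c'' x0 = move a (cyc c x0)"
    using move_full[OF c(1) aG] by blast
  have an: "a \<in> {1..n}" "label t a = a" "a \<noteq> x0"
    using aG by (auto simp: letters_def labels_def)
  obtain k where "filter (\<lambda>x. label t x = a) (cyc c x0) = rotate k (cyc t a)"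
    using filter_label_rotated[OF c(1) an(1)] an(2) by auto
  then have "word_less c'' c"
    using move_le[OF aG] a(2) c''(2) by (auto simp: word_less_def)
  moreover have "filter (\<lambda>y. y \<in> region (letters - {a})) (cyc c'' x0)
      = filter (\<lambda>y. y \<in> region (letters - {a})) (cyc c x0)"
    unfolding c''(2) using an label_x0 by (intro filter_move_other[OF aG]) (auto simp: region_def)
  then have "restr c'' (letters - {a}) = restr c (letters - {a})"
    using restr_eq_iff[OF c(1) c''(1)] by simp
  ultimately show ?thesis
    using a(1) c''(1) by blast
qed

lemma spherical_flat_words:
  assumes G: "letters \<noteq> {}"
  shows "spherical (card letters) (order_complex (perm_order n) {q \<in> merging UNIV. flat q})"
proof (rule spherical_shelling[OF partial_order_perm_order, where F = full and res = restr
      and T = merged and key = word_key])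
  let ?A = "{q \<in> merging UNIV. flat q}"
  show "?A \<subseteq> {p. p permutes {1..n}}" "finite ?A"
    using merging_subset finite_merging by auto
  show "finite letters" "letters \<noteq> {}"
    using G by (simp_all add: letters_def)
  show "full \<subseteq> ?A"
    using fullD G by (auto intro!: mergingI simp del: atLeastAtMost_iff)
  show "full \<noteq> {}"
    using exists_full[OF t refines_refl] by blast
  show "inj_on word_key full"
    using word_less_linear word_key_less by (intro inj_onI) (metis less_irrefl)
  show "restr c S \<in> ?A \<and> merged (restr c S) = S \<and> (restr c S, c) \<in> perm_order n"
    if "c \<in> full" "S \<subseteq> letters" "S \<noteq> {}" for c S
  proof -
    note cD = fullD[OF that(1)]
    note r = restr_facts[OF cD(1,2), of S]
    have m: "merged (restr c S) = S"
      using merged_restr[OF cD(1,2)] that(2) cD(6) by simp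
    then show ?thesis
      using r that(3) cD(1) by (auto intro!: mergingI simp: perm_order_def flat_def simp del: atLeastAtMost_iff)
  qed
  show "p = restr c (merged p) \<and> merged p \<subseteq> letters \<and> merged p \<noteq> {}"
    if "c \<in> full" "p \<in> ?A" "(p, c) \<in> perm_order n" for c p
  proof -
    note cD = fullD[OF that(1)]
    have p: "flat p" "refines p c" "merged p \<noteq> {}"
      using that mergingD(4)[of p UNIV] by (auto simp: perm_order_def)
    show ?thesis
      using flat_eq_restr[OF p(1) cD(1,2) p(2)] merged_mono[OF p(2)] cD(6) p(3) by simp
  qed
  show "merged c = letters" if "c \<in> full" for c
    by (rule fullD(6)[OF that])
  show "(restr c S, restr c S') \<in> perm_order n \<longleftrightarrow> S \<subseteq> S'"
    if "c \<in> full" "S \<subseteq> letters" "S' \<subseteq> letters" for c S S'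
  proof -
    note cD = fullD[OF that(1)]
    show ?thesis
      using restr_refines_iff[OF cD(1,2)] restr_facts(1)[OF cD(1,2)] that cD(6)
      by (simp add: perm_order_def)
  qed
  show "\<exists>c\<in>full. (p, c) \<in> perm_order n" if "p \<in> ?A" for p
    using exists_full[of p] that mergingD(2,3)[of p UNIV] fullD(1) by (auto simp: perm_order_def)
  show "\<exists>a\<in>letters - S. \<exists>c''\<in>full. word_key c'' < word_key c \<and>
      (letters - {a} = {} \<or> restr c'' (letters - {a}) = restr c (letters - {a}))"
    if *: "c \<in> full" "c' \<in> full" "word_key c' < word_key c" "S \<subseteq> letters" "S = {} \<or> restr c' S = restr c S"
    for c c' S
  proof -
    \<comment> \<open>All full cycles restrict to \<open>t\<close> on the empty set, so the case
      \<open>S = {}\<close> is also an equality of restrictions.\<close>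
    have "restr c' S = restr c S"
      using *(5) restr_empty[OF *(1)] restr_empty[OF *(2)] by metis
    then show ?thesis
      using word_exchange[OF *(1,2) _ *(4)] word_key_less_iff[OF *(1,2)] *(3) word_key_less by meson
  qed
qed

lemma spherical_merging_top:
  "spherical (card (labels n t) - 1) (order_complex (perm_order n) (merging UNIV))"
proof -
  have "x0 \<in> labels n t"
    using x0 label_x0 by (simp add: labels_def)
  then have card: "card letters = card (labels n t) - 1"
    by (simp add: letters_def)
  have pos: "card (labels n q) > 0" if "q \<in> merging UNIV" for q
    using label_in_labels[OF mergingD(2)[OF that] x0] by (auto simp: card_gt_0_iff)
  note bound = card_chain_merging[OF _ pos]
  show ?thesis
  proof (cases "letters = {}")
    case True
    have "q \<notin> merging UNIV" for q
      using True mergingD(4)[of q UNIV] by (auto simp: merged_def letters_def label_x0)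
    then have "merging UNIV = {}" by blast
    then have "order_complex (perm_order n) (merging UNIV) = {{}}"
      by (auto simp: order_complex_def Chains_def)
    then show ?thesis
      using spherical_singleton_empty True card by simp
  next
    case False
    then obtain m where m: "card letters = Suc m"
      by (metis card_gt_0_iff finite_Diff finite_labels gr0_implies_Suc letters_def)
    have "spherical (Suc m) (order_complex (perm_order n) (merging UNIV))"
      using spherical_flat_words[OF False] bound m card by (intro spherical_merging) auto
    then show ?thesis using m card by simp
  qed
qed

end

section \<open>Intervals\<close>

text \<open>Below the maximum there is no further condition: \<open>merging\<close> and
  \<open>perm_interval\<close> already confine the elements to permutations.\<close>

definition below :: "nat \<Rightarrow> (nat \<Rightarrow> nat) option \<Rightarrow> (nat \<Rightarrow> nat) set" where
  "below n y = (case y of None \<Rightarrow> UNIV | Some s \<Rightarrow> {q. (q, s) \<in> perm_order n \<and> q \<noteq> s})"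

text \<open>The rank of the interval from \<open>t\<close> to \<open>y\<close> is \<open>card (labels n t) - corank n y\<close>: the maximum
  lies one step above the full cycles, which have a single label.\<close>

definition corank :: "nat \<Rightarrow> (nat \<Rightarrow> nat) option \<Rightarrow> nat" where
  "corank n y = (case y of None \<Rightarrow> 0 | Some s \<Rightarrow> card (labels n s))"

definition perm_interval :: "nat \<Rightarrow> (nat \<Rightarrow> nat) \<Rightarrow> (nat \<Rightarrow> nat) option \<Rightarrow> (nat \<Rightarrow> nat) set" where
  "perm_interval n t y = {q \<in> below n y. (t, q) \<in> perm_order n \<and> q \<noteq> t}"

lemma perm_order_permutes: "(p, q) \<in> perm_order n \<Longrightarrow> p permutes {1..n} \<and> q permutes {1..n}"
  unfolding perm_order_def by blast

lemma perm_order_refines: "(p, q) \<in> perm_order n \<Longrightarrow> refines p q"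
  unfolding perm_order_def by blast

lemma perm_order_trans: "(p, q) \<in> perm_order n \<Longrightarrow> (q, r) \<in> perm_order n \<Longrightarrow> (p, r) \<in> perm_order n"
  unfolding perm_order_def using refines_trans by blast

lemma perm_order_antisym: "(p, q) \<in> perm_order n \<Longrightarrow> (q, p) \<in> perm_order n \<Longrightarrow> p = q"
  unfolding perm_order_def using refines_antisym permutes_imp_permutation by blast

lemma below_down:
  assumes "q \<in> below n y" "(p, q) \<in> perm_order n"
  shows "p \<in> below n y"
proof (cases y)
  case (Some s)
  then have s: "(q, s) \<in> perm_order n" "q \<noteq> s"
    using assms(1) by (auto simp: below_def)
  then have "(p, s) \<in> perm_order n"
    using perm_order_trans[OF assms(2)] by blast
  moreover have "p \<noteq> s"
    using perm_order_antisym[OF s(1)] assms(2) s(2) by blast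
  ultimately show ?thesis
    by (simp add: below_def Some)
qed (simp add: below_def)

lemma corank_less:
  assumes "1 \<le> n" "t permutes {1..n}" "t \<in> below n y"
  shows "corank n y < card (labels n t)"
proof (cases y)
  case None
  have "label t 1 \<in> labels n t"
    using assms(1) by (intro label_in_labels[OF assms(2)]) simp
  then show ?thesis
    using None by (auto simp: corank_def card_gt_0_iff)
next
  case (Some s)
  then have "(t, s) \<in> perm_order n" "t \<noteq> s"
    using assms(3) by (auto simp: below_def)
  then show ?thesis
    using card_labels_less Some perm_order_permutes perm_order_refines by (auto simp: corank_def)
qed

text \<open>The base \<open>u\<close> is arbitrary because this is used twice: for the lower end of
  an interval and for the elements whose links are computed.\<close>

lemma spherical_merging_interval:
  assumes n: "1 \<le> n" "x0 \<in> {1..n}" and u: "u permutes {1..n}" "u \<in> below n y"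
    and None: "y = None \<Longrightarrow> x0 = 1"
    and Some: "\<And>s. y = Some s \<Longrightarrow> set (cyc s x0) \<noteq> set (cyc u x0)"
  shows "spherical (card (labels n u) - corank n y - 1)
    (order_complex (perm_order n) (based_permutation.merging n u x0 (below n y)))"
proof -
  interpret based_permutation n u x0
    using u n by unfold_locales
  show ?thesis
  proof (cases y)
    case y: None
    interpret word_permutation n u x0
      using None[OF y] by unfold_locales
    show ?thesis
      using spherical_merging_top y by (simp add: below_def corank_def)
  next
    case (Some s)
    then have "s permutes {1..n}" "refines u s"
      using u(2) perm_order_permutes perm_order_refines by (auto simp: below_def)
    then show ?thesis
      using spherical_merging_below[of s] merged_empty_iff[of s] assms(6)[OF Some] Some
      by (simp add: below_def corank_def)
  qed
qed

lemma spherical_perm_interval: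
  assumes n: "1 \<le> n" and t: "t permutes {1..n}" "t \<in> below n y"
  shows "spherical (card (labels n t) - corank n y - 1) (order_complex (perm_order n) (perm_interval n t y))"
  using t
proof (induction "card (labels n t) - corank n y" arbitrary: y rule: less_induct)
  case less
  note t = less.prems
  let ?I = "perm_interval n t y"
  have I: "q permutes {1..n}" "q \<in> below n y" "refines t q" "q \<noteq> t" "(t, q) \<in> perm_order n"
    "corank n y < card (labels n q)" "card (labels n q) < card (labels n t)" if "q \<in> ?I" for q
  proof -
    show *: "(t, q) \<in> perm_order n" "q \<noteq> t" "q \<in> below n y"
      using that by (auto simp: perm_interval_def)
    then show **: "q permutes {1..n}" "refines t q"
      using perm_order_permutes perm_order_refines by blast+
    show "corank n y < card (labels n q)" "card (labels n q) < card (labels n t)"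
      using corank_less[OF n **(1) *(3)] card_labels_less[OF t(1) **] *(2) by auto
  qed
  show ?case
  proof (cases "card (labels n t) - corank n y - 1")
    case 0
    have "q \<notin> ?I" for q
      using I(6,7)[of q] 0 by linarith
    then have "?I = {}" by blast
    then have "order_complex (perm_order n) ?I = {{}}"
      by (auto simp: order_complex_def Chains_def)
    then show ?thesis
      using spherical_singleton_empty 0 by simp
  next
    case (Suc m)
    obtain x0 where base: "x0 \<in> {1..n}" "y = None \<Longrightarrow> x0 = 1"
      "\<And>s. y = Some s \<Longrightarrow> set (cyc s x0) \<noteq> set (cyc t x0)"
    proof (cases y)
      case None
      then show thesis using that[of 1] n by simp
    next
      case (Some s)
      then have s: "s permutes {1..n}" "refines t s" "t \<noteq> s"
        using t(2) perm_order_permutes perm_order_refines by (auto simp: below_def)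
      then obtain x where x: "\<not> set (cyc s x) \<subseteq> set (cyc t x)"
        using refines_set_eq_imp_eq[of t s] t(1) permutes_imp_permutation by blast
      have "x \<in> {1..n}"
      proof (rule ccontr)
        assume "x \<notin> {1..n}"
        then have "cyc s x = [x]" "cyc t x = [x]"
          using permutes_not_in[OF s(1)] permutes_not_in[OF t(1)] by (intro cyc_fixed; blast)+
        then show False using x by simp
      qed
      then show thesis
        using that[of x] Some x by blast
    qed
    interpret based_permutation n t x0
      using t base by unfold_locales
    let ?A = "merging (below n y)"
    have A: "spherical (Suc m) (order_complex (perm_order n) ?A)"
      using spherical_merging_interval[OF n base(1) less.prems base(2,3)] Suc by simp
    have "spherical (Suc m) (order_complex (perm_order n) ?I)"
    proof (rule spherical_extend_lower[OF partial_order_perm_order _ _ _ _ A])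
      show sub: "?I \<subseteq> {p. p permutes {1..n}}"
        using I(1) by blast
      show "finite ?I"
        by (rule finite_subset[OF sub]) (simp add: finite_permutations)
      show "?A \<subseteq> ?I"
        by (auto simp: merging_def perm_interval_def)
    next
      fix b q
      assume b: "b \<in> ?I - ?A" and q: "q \<in> ?A"
      have "set (cyc b x0) = set (cyc t x0)"
        using b by (auto simp: merging_def perm_interval_def)
      then show "(q, b) \<notin> perm_order n"
        using q refines_subset[of t q x0] refines_subset[of q b x0] perm_order_refines
        unfolding merging_def by blast
    next
      fix b
      assume b: "b \<in> ?I - ?A"
      then have bI: "b \<in> ?I" by blast
      note bf = I[OF bI]
      have eq: "set (cyc b x0) = set (cyc t x0)"
        using b by (auto simp: merging_def perm_interval_def)
      have "{q \<in> ?I. (q, b) \<in> perm_order n \<and> q \<noteq> b} = perm_interval n t (Some b)"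
        using below_down[OF bf(2)] by (auto simp: perm_interval_def below_def)
      moreover have "spherical (card (labels n t) - corank n (Some b) - 1)
          (order_complex (perm_order n) (perm_interval n t (Some b)))"
        using bf less.prems(1) by (intro less.hyps) (auto simp: corank_def below_def)
      \<comment> \<open>The cycle of x0 is the same in \<open>b\<close> and in \<open>t\<close>, so
        the elements above \<open>b\<close> that merge it do so relative to \<open>b\<close> as
        well.\<close>
      moreover have "{q \<in> ?A. (b, q) \<in> perm_order n} = based_permutation.merging n b x0 (below n y)"
      proof -
        interpret b: based_permutation n b x0
          using bf(1) base(1) by unfold_locales
        show ?thesis
          unfolding merging_def b.merging_def eq using perm_order_trans[OF bf(5)] by blast
      qed
      moreover have "spherical (card (labels n b) - corank n y - 1)
          (order_complex (perm_order n) (based_permutation.merging n b x0 (below n y)))"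
        using spherical_merging_interval[OF n base(1) bf(1,2) base(2)] base(3) eq by simp
      \<comment> \<open>The ranks of the intervals from \<open>t\<close> to \<open>b\<close> and
        from \<open>b\<close> to \<open>y\<close> add up to the whole rank \<open>m + 2\<close>;
        each of the two factors of the link loses one.\<close>
      moreover have "card (labels n t) - corank n (Some b) - 1 + (card (labels n b) - corank n y - 1) = m"
        using bf(6,7) Suc by (simp add: corank_def)
      ultimately show "\<exists>i j. i + j = m \<and>
          spherical i (order_complex (perm_order n) {q \<in> ?I. (q, b) \<in> perm_order n \<and> q \<noteq> b}) \<and>
          spherical j (order_complex (perm_order n) {q \<in> ?A. (b, q) \<in> perm_order n})"
        by (intro exI conjI) simp_all
    qed
    then show ?thesis using Suc by simp
  qed
qed

lemma order_complex_Some: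
  "order_complex (Pi_order n) (Some ` Q) = (`) Some ` order_complex (perm_order n) Q"
proof (intro equalityI subsetI)
  fix X
  assume X: "X \<in> order_complex (Pi_order n) (Some ` Q)"
  then obtain Y where Y: "Y \<subseteq> Q" "X = Some ` Y"
    by (auto simp: order_complex_def subset_image_iff)
  moreover have "finite Y"
    using X Y by (auto simp: order_complex_def dest: finite_imageD)
  moreover have "Y \<in> Chains (perm_order n)"
    using X Y unfolding order_complex_def Chains_def by (auto simp: Pi_order_Some_iff)
  ultimately show "X \<in> (`) Some ` order_complex (perm_order n) Q"
    by (auto simp: order_complex_def)
next
  fix X
  assume "X \<in> (`) Some ` order_complex (perm_order n) Q"
  then obtain Y where "X = Some ` Y" "Y \<in> order_complex (perm_order n) Q"
    by blast
  then show "X \<in> order_complex (Pi_order n) (Some ` Q)"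
    by (simp add: order_complex_def Chains_def Pi_order_Some_iff image_mono)
qed

lemma spherical_open_interval:
  assumes n: "1 \<le> n" and xy: "(x, y) \<in> Pi_order n"
  shows "\<exists>m. spherical m (order_complex (Pi_order n) (open_interval (Pi_order n) x y))"
proof (cases "x = y")
  case True
  \<comment> \<open>An interval with equal ends has no interior; its order complex is the
    (-1)-sphere.\<close>
  have "antisym (Pi_order n)"
    using finite_bounded_poset_Pi[of n] by (simp add: finite_bounded_poset_def partial_order_on_def)
  then have "open_interval (Pi_order n) x y = {}"
    unfolding open_interval_def True by (auto dest: antisymD)
  then have "order_complex (Pi_order n) (open_interval (Pi_order n) x y) = {{}}"
    by (auto simp: order_complex_def Chains_def)
  then show ?thesis
    using spherical_singleton_empty by metis
next
  case False
  then obtain t where x: "x = Some t"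
    using xy Pi_order_None_left by (cases x) auto
  have t: "t permutes {1..n}" "t \<in> below n y"
    using xy False x Pi_order_None_right[of t n] Pi_order_Some_iff[of t _ n] perm_order_permutes
    by (cases y; auto simp: below_def)+
  have "open_interval (Pi_order n) x y = Some ` perm_interval n t y"
  proof (intro set_eqI iffI)
    fix z
    assume z: "z \<in> open_interval (Pi_order n) x y"
    then obtain q where q: "z = Some q"
      using Pi_order_None_left[of y n] by (cases z) (auto simp: open_interval_def)
    then have "q \<in> perm_interval n t y"
      using z x by (cases y) (auto simp: open_interval_def perm_interval_def below_def Pi_order_Some_iff)
    then show "z \<in> Some ` perm_interval n t y"
      using q by blast
  next
    fix z
    assume "z \<in> Some ` perm_interval n t y"
    then obtain q where q: "z = Some q" "(t, q) \<in> perm_order n" "q \<noteq> t" "q \<in> below n y"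
      by (auto simp: perm_interval_def)
    then have "q permutes {1..n}"
      using perm_order_permutes by blast
    then show "z \<in> open_interval (Pi_order n) x y"
      using q x by (cases y) (auto simp: open_interval_def below_def Pi_order_Some_iff Pi_order_None_right)
  qed
  then show ?thesis
    using spherical_image[OF inj_Some spherical_perm_interval[OF n t]]
    by (intro exI) (simp only: order_complex_Some)
qed


theorem theorem8p15:
  fixes n :: nat
  assumes "n \<ge> 1"
  shows "homotopically_Cohen_Macaulay (Pi_carrier n) (Pi_order n)"
proof -
  have "\<exists>k. geometric_realization K homotopy_equivalent_space sphere_wedge (complex_dim K) k"
    if xy: "(x, y) \<in> Pi_order n" and K: "K = order_complex (Pi_order n) (open_interval (Pi_order n) x y)"
    for x y K
  proof -
    obtain m where "spherical m K"
      using spherical_open_interval[OF assms xy] K by blast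
    moreover have "{} \<in> K"
      by (simp add: K order_complex_def Chains_def)
    ultimately show ?thesis
      by (rule spherical_imp_homotopy_equivalent)
  qed
  then show ?thesis
    using finite_bounded_poset_Pi[of n] unfolding homotopically_Cohen_Macaulay_def Let_def by blast
qed

end
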